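(* Let $\Bbbk$ be a field. Given a left-right Yetter-Drinfel'd module $M$ and a finite-dimensional left-right Yetter-Drinfel'd module $N$ over a finite-dimensional $\Bbbk$-linear bialgebra $H$, each of the following four pairs of maps is a bidegree $-1$ bidifferential on $T(H)\otimes M\otimes T(H^* )\otimes N^*$: 1. $d_{bar}$ and $(-1)^n d_{cob}$; 2. $d_{bar}+(-1)^n\pi^H$ and $(-1)^n d_{cob}+(-1)^n({}^{H^*}\!\pi)$; 3. $d_{bar}+{}^H\!\pi$ and $(-1)^n d_{cob}+(-1)^{n+m}\pi^{H^*}$; 4. $d_{bar}+(-1)^n\pi^H+{}^H\!\pi$ and $(-1)^n d_{cob}+(-1)^n({}^{H^*}\!\pi)+(-1)^{n+m}\pi^{H^*}$. The signs $(-1)^n$ etc. are those one chooses on the component $H^{\otimes n}\otimes M\otimes(H^* )^{\otimes m}\otimes N^*$.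
   Context: Sweedler notation: $\Delta(h)=h_{(1)}\otimes h_{(2)}$ for $h\in H$, $\delta_M(a)=a_{(0)}\otimes a_{(1)}\in M\otimes H$. $T(X)=\bigoplus_{n\ge0}X^{\otimes n}$; tensor signs inside $H^{\otimes n}$ and $(H^* )^{\otimes m}$ are omitted, so $h_1\dots h_n$ denotes $h_1\otimes\dots\otimes h_n$, while products in $H$ and $H^*$ and actions are denoted by $\cdot$. $\langle\,,\rangle$ is evaluation. A left-right Yetter-Drinfel'd module over a bialgebra $H$ is a left $H$-module and right $H$-comodule $M$ with $(h_{(2)}m)_{(0)}\otimes(h_{(2)}m)_{(1)}h_{(1)}=h_{(1)}m_{(0)}\otimes h_{(2)}m_{(1)}$. Structures on $H^*$ are dual to those of $H$ with the "rainbow" convention: $(l\cdot l')(h)=l(h_{(2)})\,l'(h_{(1)})$, unit $\varepsilon_H$, comultiplication $l\mapsto l_{(1)}\otimes l_{(2)}$ determined by $l(hh')=l_{(1)}(h')\,l_{(2)}(h)$, counit $l\mapsto l(1_H)$. Likewise $N^*$ carries the dual structures over $H^*$: the left action $(l\cdot b)(x)=b(x_{(0)})\,l(x_{(1)})$ and the right coaction $b\mapsto b_{(0)}\otimes b_{(1)}\in N^*\otimes H^*$ determined by $b(hx)=b_{(0)}(x)\,b_{(1)}(h)$, for $l\in H^*$, $b\in N^*$, $x\in N$, $h\in H$. For $h_i\in H$, $a\in M$, $l_j\in H^*$, $b\in N^*$ put $$d_{bar}(h_1\dots h_n\otimes a\otimes l_1\dots l_m\otimes b)=\sum_{i=1}^{n-1}(-1)^i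 h_1\dots h_{i-1}(h_i\cdot h_{i+1})h_{i+2}\dots h_n\otimes a\otimes l_1\dots l_m\otimes b,$$ $$d_{cob}(h_1\dots h_n\otimes a\otimes l_1\dots l_m\otimes b)=\sum_{i=1}^{m-1}(-1)^i h_1\dots h_n\otimes a\otimes l_1\dots l_{i-1}(l_i\cdot l_{i+1})l_{i+2}\dots l_m\otimes b,$$ $${}^{H^*}\!\pi(h_1\dots h_n\otimes a\otimes l_1\dots l_m\otimes b)=\langle l_1,h_{1(2)}\cdots h_{n(2)}\cdot a_{(1)}\rangle\,h_{1(1)}\dots h_{n(1)}\otimes a_{(0)}\otimes l_2\dots l_m\otimes b,$$ $$\pi^{H^*}(h_1\dots h_n\otimes a\otimes l_1\dots l_m\otimes b)=\langle l_{m(1)},h_{1(1)}\cdots h_{n(1)}\rangle\,h_{1(2)}\dots h_{n(2)}\otimes a\otimes l_1\dots l_{m-1}\otimes l_{m(2)}\cdot b,$$ $$\pi^H(h_1\dots h_n\otimes a\otimes l_1\dots l_m\otimes b)=\langle l_{1(1)}\cdots l_{m(1)},h_{n(1)}\rangle\,h_1\dots h_{n-1}\otimes(h_{n(2)}\cdot a)\otimes l_{1(2)}\dots l_{m(2)}\otimes b,$$ $${}^H\!\pi(h_1\dots h_n\otimes a\otimes l_1\dots l_m\otimes b)=\langle l_{1(2)}\cdots l_{m(2)}\cdot b_{(1)},h_1\rangle\,h_2\dots h_n\otimes a\otimes l_{1(1)}\dots l_{m(1)}\otimes b_{(0)}.$$ Empty products in $H$, $H^*$ are the units $1_H$, $\varepsilon_H$.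 The maps $\pi^H,{}^H\!\pi$ are zero when $n=0$, and ${}^{H^*}\!\pi,\pi^{H^*}$ are zero when $m=0$; empty sums are zero. A bidegree $-1$ bidifferential for a collection $(X_k)_{k\ge0}$ consists of two families $d_k,d'_k:X_k\to X_{k-1}$ ($k>0$) with $d_{k-1}d_k=d'_{k-1}d'_k=d'_{k-1}d_k+d_{k-1}d'_k=0$ for all $k>1$. Here $X_k=\bigoplus_{n+m=k}H^{\otimes n}\otimes M\otimes(H^* )^{\otimes m}\otimes N^*$. *)

theory Defs
  imports Complex_Main "HOL-Library.Poly_Mapping" "HOL-Library.Function_Algebras"
begin

definition fscale :: "'k::field \<Rightarrow> ('g \<Rightarrow>\<^sub>0 'k) \<Rightarrow> ('g \<Rightarrow>\<^sub>0 'k)" where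
  "fscale c p = Poly_Mapping.map ((*) c) p"

definition fgen :: "'g \<Rightarrow> ('g \<Rightarrow>\<^sub>0 'k::field)" where
  "fgen g = Poly_Mapping.single g 1"

text \<open>The linear extension of \<open>F\<close>, defined on generators, to formal linear combinations;
  \<open>s\<close> is the scalar multiplication of the target.\<close>

definition linext :: "('k::field \<Rightarrow> 'v \<Rightarrow> 'v) \<Rightarrow> ('g \<Rightarrow>\<^sub>0 'k) \<Rightarrow> ('g \<Rightarrow> 'v::ab_group_add) \<Rightarrow> 'v" where
  "linext s p F = (\<Sum>g\<in>Poly_Mapping.keys p. s (Poly_Mapping.lookup p g) (F g))"

abbreviation fsum :: "('g \<Rightarrow>\<^sub>0 'k::field) \<Rightarrow> ('g \<Rightarrow> 'k) \<Rightarrow> 'k" where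
  "fsum \<equiv> linext (*)"

abbreviation fbind :: "('g \<Rightarrow>\<^sub>0 'k::field) \<Rightarrow> ('g \<Rightarrow> ('e \<Rightarrow>\<^sub>0 'k)) \<Rightarrow> ('e \<Rightarrow>\<^sub>0 'k)" where
  "fbind \<equiv> linext fscale"

lemma lookup_fscale [simp]: "Poly_Mapping.lookup (fscale c p) g = c * Poly_Mapping.lookup p g"
  unfolding fscale_def by transfer (simp add: when_def)

lemma vector_space_fscale: "vector_space (fscale :: 'k::field \<Rightarrow> ('g \<Rightarrow>\<^sub>0 'k) \<Rightarrow> _)"
  by unfold_locales
    (auto intro!: poly_mapping_eqI simp: lookup_add algebra_simps)

text \<open>A quotient of a free vector space is represented by its congruence relation \<open>r\<close> on the
  formal linear combinations of the generators; its elements are the classes of \<open>r\<close>.\<close>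

definition presented :: "'g set \<Rightarrow> ('g \<Rightarrow>\<^sub>0 'k::field) set \<Rightarrow> ('g \<Rightarrow>\<^sub>0 'k) rel" where
  "presented G R = {(p, q). Poly_Mapping.keys p \<subseteq> G \<and> Poly_Mapping.keys q \<subseteq> G
      \<and> p - q \<in> module.span fscale R}"

definition qcarrier :: "('g \<Rightarrow>\<^sub>0 'k::field) rel \<Rightarrow> ('g \<Rightarrow>\<^sub>0 'k) set set" where
  "qcarrier r = Domain r // r"

definition qzero :: "('g \<Rightarrow>\<^sub>0 'k::field) rel \<Rightarrow> ('g \<Rightarrow>\<^sub>0 'k) set" where
  "qzero r = r `` {0}"

definition qadd :: "('g \<Rightarrow>\<^sub>0 'k::field) rel \<Rightarrow> ('g \<Rightarrow>\<^sub>0 'k) set \<Rightarrow> ('g \<Rightarrow>\<^sub>0 'k) set \<Rightarrow> ('g \<Rightarrow>\<^sub>0 'k) set" where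
  "qadd r A B = (\<Union>p\<in>A. \<Union>q\<in>B. r `` {p + q})"

definition qscale :: "('g \<Rightarrow>\<^sub>0 'k::field) rel \<Rightarrow> 'k \<Rightarrow> ('g \<Rightarrow>\<^sub>0 'k) set \<Rightarrow> ('g \<Rightarrow>\<^sub>0 'k) set" where
  "qscale r c A = (\<Union>p\<in>A. r `` {fscale c p})"

definition linear_into ::
  "('k::field \<Rightarrow> 'v::ab_group_add \<Rightarrow> 'v) \<Rightarrow> ('g \<Rightarrow>\<^sub>0 'k) rel \<Rightarrow> ('v \<Rightarrow> ('g \<Rightarrow>\<^sub>0 'k) set) \<Rightarrow> bool" where
  "linear_into s r f \<longleftrightarrow>
     (\<forall>x. f x \<in> qcarrier r) \<and>
     (\<forall>x y. f (x + y) = qadd r (f x) (f y)) \<and>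
     (\<forall>c x. f (s c x) = qscale r c (f x))"

definition qlinear ::
  "('g \<Rightarrow>\<^sub>0 'k::field) rel \<Rightarrow> ('e \<Rightarrow>\<^sub>0 'k) rel \<Rightarrow> (('g \<Rightarrow>\<^sub>0 'k) set \<Rightarrow> ('e \<Rightarrow>\<^sub>0 'k) set) \<Rightarrow> bool" where
  "qlinear r r' f \<longleftrightarrow>
     (\<forall>A\<in>qcarrier r. f A \<in> qcarrier r') \<and>
     (\<forall>A\<in>qcarrier r. \<forall>B\<in>qcarrier r. f (qadd r A B) = qadd r' (f A) (f B)) \<and>
     (\<forall>c. \<forall>A\<in>qcarrier r. f (qscale r c A) = qscale r' c (f A))"

text \<open>The map induced on quotients by a map \<open>F\<close> on generators. The union is a single class of
  \<open>r'\<close> only if the linear extension of \<open>F\<close> respects the relations.\<close>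

definition induced ::
  "('e \<Rightarrow>\<^sub>0 'k::field) rel \<Rightarrow> ('g \<Rightarrow> ('e \<Rightarrow>\<^sub>0 'k)) \<Rightarrow> ('g \<Rightarrow>\<^sub>0 'k) set \<Rightarrow> ('e \<Rightarrow>\<^sub>0 'k) set" where
  "induced r' F A = (\<Union>p\<in>A. r' `` {fbind p F})"

text \<open>Linearity relations in one tensor slot. \<open>A\<close> is the subspace of vectors allowed in the slot,
  \<open>s\<close> its scalar multiplication, and each \<open>u \<in> U\<close> inserts a vector into the slot, the entries of
  the other slots being fixed; only those \<open>u\<close> count that produce generators from \<open>G\<close>.\<close>

definition slot_rels :: "'g set \<Rightarrow> 'v::ab_group_add set \<Rightarrow> ('k::field \<Rightarrow> 'v \<Rightarrow> 'v) \<Rightarrow> ('v \<Rightarrow> 'g) set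
    \<Rightarrow> ('g \<Rightarrow>\<^sub>0 'k) set" where
  "slot_rels G A s U =
     {fgen (u (x + y)) - fgen (u x) - fgen (u y) | u x y. u \<in> U \<and> u ` A \<subseteq> G \<and> x \<in> A \<and> y \<in> A} \<union>
     {fgen (u (s c x)) - fscale c (fgen (u x)) | u c x. u \<in> U \<and> u ` A \<subseteq> G \<and> x \<in> A}"

definition tensor2 ::
  "'a::ab_group_add set \<Rightarrow> ('k::field \<Rightarrow> 'a \<Rightarrow> 'a) \<Rightarrow> 'b::ab_group_add set \<Rightarrow> ('k \<Rightarrow> 'b \<Rightarrow> 'b)
    \<Rightarrow> ('a \<times> 'b \<Rightarrow>\<^sub>0 'k) rel" where
  "tensor2 A sA B sB = presented (A \<times> B)
     (slot_rels (A \<times> B) A sA {\<lambda>x. (x, y) | y. True} \<union>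
      slot_rels (A \<times> B) B sB {\<lambda>y. (x, y) | x. True})"

definition tensor3 ::
  "'a::ab_group_add set \<Rightarrow> ('k::field \<Rightarrow> 'a \<Rightarrow> 'a) \<Rightarrow> 'b::ab_group_add set \<Rightarrow> ('k \<Rightarrow> 'b \<Rightarrow> 'b)
    \<Rightarrow> 'c::ab_group_add set \<Rightarrow> ('k \<Rightarrow> 'c \<Rightarrow> 'c) \<Rightarrow> ('a \<times> 'b \<times> 'c \<Rightarrow>\<^sub>0 'k) rel" where
  "tensor3 A sA B sB C sC = presented (A \<times> B \<times> C)
     (slot_rels (A \<times> B \<times> C) A sA {\<lambda>x. (x, y, z) | y z. True} \<union>
      slot_rels (A \<times> B \<times> C) B sB {\<lambda>y. (x, y, z) | x z. True} \<union>
      slot_rels (A \<times> B \<times> C) C sC {\<lambda>z. (x, y, z) | x y. True})"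

text \<open>Sweedler notation: a formal sum of pairs representing an element of a tensor product.\<close>

definition sw :: "('g \<Rightarrow>\<^sub>0 'k::field) set \<Rightarrow> ('g \<Rightarrow>\<^sub>0 'k)" where
  "sw t = (SOME p. p \<in> t)"

text \<open>Sends \<open>x1 \<otimes> \<dots> \<otimes> xn\<close> to the simultaneous Sweedler expansion: a formal sum of pairs consisting
  of the list of first legs and the list of second legs, in the order of the \<open>x\<close>'s.\<close>

fun sw_list :: "('a \<Rightarrow> ('a \<times> 'a \<Rightarrow>\<^sub>0 'k::field) set) \<Rightarrow> 'a list \<Rightarrow> ('a list \<times> 'a list \<Rightarrow>\<^sub>0 'k)" where
  "sw_list D [] = fgen ([], [])"
| "sw_list D (x # xs) =
     fbind (sw (D x)) (\<lambda>(x1, x2). fbind (sw_list D xs) (\<lambda>(ys1, ys2). fgen (x1 # ys1, x2 # ys2)))"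

text \<open>The multiplication and the unit of \<open>H\<close> are those of the type class \<open>ring_1\<close>; its axiom
  \<open>0 \<noteq> 1\<close> is no restriction since \<open>\<epsilon> 1 = 1\<close>. Two formal sums represent the same
  tensor iff they are related by \<open>tensor2\<close> or \<open>tensor3\<close>.\<close>

locale bialgebra = vector_space sH
  for sH :: "'k::field \<Rightarrow> 'h::ring_1 \<Rightarrow> 'h" +
  fixes \<Delta> :: "'h \<Rightarrow> ('h \<times> 'h \<Rightarrow>\<^sub>0 'k) set"
    and \<epsilon> :: "'h \<Rightarrow> 'k"
  assumes scale_mult_left: "sH c x * y = sH c (x * y)"
    and scale_mult_right: "x * sH c y = sH c (x * y)"
    and comult_linear: "linear_into sH (tensor2 UNIV sH UNIV sH) \<Delta>"
    and counit_linear: "Vector_Spaces.linear sH (*) \<epsilon>"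
    and coassoc: "(fbind (sw (\<Delta> h)) (\<lambda>(h1, h2). fbind (sw (\<Delta> h1)) (\<lambda>(h11, h12). fgen (h11, h12, h2))),
                   fbind (sw (\<Delta> h)) (\<lambda>(h1, h2). fbind (sw (\<Delta> h2)) (\<lambda>(h21, h22). fgen (h1, h21, h22))))
                  \<in> tensor3 UNIV sH UNIV sH UNIV sH"
    and counit_left: "linext sH (sw (\<Delta> h)) (\<lambda>(h1, h2). sH (\<epsilon> h1) h2) = h"
    and counit_right: "linext sH (sw (\<Delta> h)) (\<lambda>(h1, h2). sH (\<epsilon> h2) h1) = h"
    and comult_mult: "(sw (\<Delta> (h * g)),
                   fbind (sw (\<Delta> h)) (\<lambda>(h1, h2). fbind (sw (\<Delta> g)) (\<lambda>(g1, g2). fgen (h1 * g1, h2 * g2))))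
                  \<in> tensor2 UNIV sH UNIV sH"
    and comult_one: "fgen (1, 1) \<in> \<Delta> 1"
    and counit_mult: "\<epsilon> (h * g) = \<epsilon> h * \<epsilon> g"
    and counit_one: "\<epsilon> 1 = 1"

locale left_module = M: vector_space sM
  for sH :: "'k::field \<Rightarrow> 'h::ring_1 \<Rightarrow> 'h"
    and sM :: "'k \<Rightarrow> 'm::ab_group_add \<Rightarrow> 'm" +
  fixes act :: "'h \<Rightarrow> 'm \<Rightarrow> 'm"
  assumes act_add_left: "act (h + g) a = act h a + act g a"
    and act_scale_left: "act (sH c h) a = sM c (act h a)"
    and act_add_right: "act h (a + a') = act h a + act h a'"
    and act_scale_right: "act h (sM c a) = sM c (act h a)"
    and act_one: "act 1 a = a"
    and act_mult: "act (h * g) a = act h (act g a)"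

locale right_comodule = M: vector_space sM
  for sH :: "'k::field \<Rightarrow> 'h::ring_1 \<Rightarrow> 'h"
    and \<Delta> :: "'h \<Rightarrow> ('h \<times> 'h \<Rightarrow>\<^sub>0 'k) set"
    and \<epsilon> :: "'h \<Rightarrow> 'k"
    and sM :: "'k \<Rightarrow> 'm::ab_group_add \<Rightarrow> 'm" +
  fixes \<delta> :: "'m \<Rightarrow> ('m \<times> 'h \<Rightarrow>\<^sub>0 'k) set"
  assumes coact_linear: "linear_into sM (tensor2 UNIV sM UNIV sH) \<delta>"
    and coact_coassoc: "(fbind (sw (\<delta> a)) (\<lambda>(a0, a1). fbind (sw (\<delta> a0)) (\<lambda>(a00, a01). fgen (a00, a01, a1))),
                   fbind (sw (\<delta> a)) (\<lambda>(a0, a1). fbind (sw (\<Delta> a1)) (\<lambda>(a11, a12). fgen (a0, a11, a12))))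
                  \<in> tensor3 UNIV sM UNIV sH UNIV sH"
    and coact_counit: "linext sM (sw (\<delta> a)) (\<lambda>(a0, a1). sM (\<epsilon> a1) a0) = a"

locale yetter_drinfeld =
  bialgebra sH \<Delta> \<epsilon> + left_module sH sM act + right_comodule sH \<Delta> \<epsilon> sM \<delta>
  for sH :: "'k::field \<Rightarrow> 'h::ring_1 \<Rightarrow> 'h" and \<Delta> \<epsilon>
    and sM :: "'k \<Rightarrow> 'm::ab_group_add \<Rightarrow> 'm" and act \<delta> +
  assumes yd_compat:
    "(fbind (sw (\<Delta> h)) (\<lambda>(h1, h2). fbind (sw (\<delta> (act h2 a))) (\<lambda>(x0, x1). fgen (x0, x1 * h1))),
      fbind (sw (\<Delta> h)) (\<lambda>(h1, h2). fbind (sw (\<delta> a)) (\<lambda>(a0, a1). fgen (act h1 a0, h2 * a1))))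
     \<in> tensor2 UNIV sM UNIV sH"

definition dual :: "('k::field \<Rightarrow> 'v::ab_group_add \<Rightarrow> 'v) \<Rightarrow> ('v \<Rightarrow> 'k) set" where
  "dual s = {l. Vector_Spaces.linear s (*) l}"

definition dscale :: "'k::field \<Rightarrow> ('v \<Rightarrow> 'k) \<Rightarrow> ('v \<Rightarrow> 'k)" where
  "dscale c l = (\<lambda>x. c * l x)"

text \<open>The "rainbow" convention: \<open>(l l')(h) = l(h2) l'(h1)\<close>, \<open>l(h h') = l1(h') l2(h)\<close>,
  \<open>(l b)(x) = b(x0) l(x1)\<close>, \<open>b(h x) = b0(x) b1(h)\<close>. The two descriptions below determine a tensor
  uniquely because tensors of functionals are separated by evaluation; it exists because
  \<open>H\<close> and \<open>N\<close> are finite-dimensional.\<close>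

definition dual_mult :: "('h \<Rightarrow> ('h \<times> 'h \<Rightarrow>\<^sub>0 'k::field) set) \<Rightarrow> ('h \<Rightarrow> 'k) \<Rightarrow> ('h \<Rightarrow> 'k) \<Rightarrow> ('h \<Rightarrow> 'k)" where
  "dual_mult \<Delta> l l' = (\<lambda>h. fsum (sw (\<Delta> h)) (\<lambda>(h1, h2). l h2 * l' h1))"

definition dual_prod :: "('h \<Rightarrow> ('h \<times> 'h \<Rightarrow>\<^sub>0 'k::field) set) \<Rightarrow> ('h \<Rightarrow> 'k) \<Rightarrow> ('h \<Rightarrow> 'k) list \<Rightarrow> ('h \<Rightarrow> 'k)" where
  "dual_prod \<Delta> \<epsilon> ls = foldr (dual_mult \<Delta>) ls \<epsilon>"

definition dual_comult :: "('k::field \<Rightarrow> 'h::ring_1 \<Rightarrow> 'h) \<Rightarrow> ('h \<Rightarrow> 'k)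
    \<Rightarrow> (('h \<Rightarrow> 'k) \<times> ('h \<Rightarrow> 'k) \<Rightarrow>\<^sub>0 'k) set" where
  "dual_comult sH l = (THE t. t \<in> qcarrier (tensor2 (dual sH) dscale (dual sH) dscale) \<and>
     (\<forall>h h'. l (h * h') = fsum (sw t) (\<lambda>(l1, l2). l1 h' * l2 h)))"

definition dual_act :: "('n \<Rightarrow> ('n \<times> 'h \<Rightarrow>\<^sub>0 'k::field) set) \<Rightarrow> ('h \<Rightarrow> 'k) \<Rightarrow> ('n \<Rightarrow> 'k) \<Rightarrow> ('n \<Rightarrow> 'k)" where
  "dual_act \<delta> l b = (\<lambda>x. fsum (sw (\<delta> x)) (\<lambda>(x0, x1). b x0 * l x1))"

definition dual_coact :: "('k::field \<Rightarrow> 'h::ring_1 \<Rightarrow> 'h) \<Rightarrow> ('k \<Rightarrow> 'n::ab_group_add \<Rightarrow> 'n)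
    \<Rightarrow> ('h \<Rightarrow> 'n \<Rightarrow> 'n) \<Rightarrow> ('n \<Rightarrow> 'k) \<Rightarrow> (('n \<Rightarrow> 'k) \<times> ('h \<Rightarrow> 'k) \<Rightarrow>\<^sub>0 'k) set" where
  "dual_coact sH sN act b = (THE t. t \<in> qcarrier (tensor2 (dual sN) dscale (dual sH) dscale) \<and>
     (\<forall>h x. b (act h x) = fsum (sw t) (\<lambda>(b0, b1). b0 x * b1 h)))"

text \<open>A generator \<open>(hs, a, ls, b)\<close> stands for the pure tensor
  \<open>h1 \<otimes> \<dots> \<otimes> hn \<otimes> a \<otimes> l1 \<otimes> \<dots> \<otimes> lm \<otimes> b\<close>.\<close>

type_synonym ('h, 'm, 'n, 'k) gen = "'h list \<times> 'm \<times> ('h \<Rightarrow> 'k) list \<times> ('n \<Rightarrow> 'k)"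

definition gens :: "('k::field \<Rightarrow> 'h::ring_1 \<Rightarrow> 'h) \<Rightarrow> ('k \<Rightarrow> 'n::ab_group_add \<Rightarrow> 'n) \<Rightarrow> nat
    \<Rightarrow> ('h, 'm, 'n, 'k) gen set" where
  "gens sH sN k = {(hs, a, ls, b). length hs + length ls = k \<and> set ls \<subseteq> dual sH \<and> b \<in> dual sN}"

text \<open>All relations are between generators with the same \<open>n\<close> and \<open>m\<close>, so this quotient is the
  direct sum, over \<open>n + m = k\<close>, of the tensor products of \<open>n\<close> copies of \<open>H\<close>, of \<open>M\<close>, of \<open>m\<close> copies
  of the dual of \<open>H\<close>, and of the dual of \<open>N\<close>.\<close>

definition X_space :: "('k::field \<Rightarrow> 'h::ring_1 \<Rightarrow> 'h) \<Rightarrow> ('k \<Rightarrow> 'm::ab_group_add \<Rightarrow> 'm)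
    \<Rightarrow> ('k \<Rightarrow> 'n::ab_group_add \<Rightarrow> 'n) \<Rightarrow> nat \<Rightarrow> (('h, 'm, 'n, 'k) gen \<Rightarrow>\<^sub>0 'k) rel" where
  "X_space sH sM sN k = presented (gens sH sN k)
     (slot_rels (gens sH sN k) UNIV sH {\<lambda>h. (hs @ h # hs', a, ls, b) | hs hs' a ls b. True} \<union>
      slot_rels (gens sH sN k) UNIV sM {\<lambda>a. (hs, a, ls, b) | hs ls b. True} \<union>
      slot_rels (gens sH sN k) (dual sH) dscale {\<lambda>l. (hs, a, ls @ l # ls', b) | hs a ls ls' b. True} \<union>
      slot_rels (gens sH sN k) (dual sN) dscale {\<lambda>b. (hs, a, ls, b) | hs a ls. True})"

definition d_bar :: "('h::ring_1, 'm, 'n, 'k::field) gen \<Rightarrow> (('h, 'm, 'n, 'k) gen \<Rightarrow>\<^sub>0 'k)" where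
  "d_bar = (\<lambda>(hs, a, ls, b). \<Sum>i\<in>{1..<length hs}.
     fscale ((-1) ^ i) (fgen (take (i - 1) hs @ (hs ! (i - 1) * hs ! i) # drop (i + 1) hs, a, ls, b)))"

definition d_cob :: "('h \<Rightarrow> ('h \<times> 'h \<Rightarrow>\<^sub>0 'k::field) set)
    \<Rightarrow> ('h, 'm, 'n, 'k) gen \<Rightarrow> (('h, 'm, 'n, 'k) gen \<Rightarrow>\<^sub>0 'k)" where
  "d_cob \<Delta> = (\<lambda>(hs, a, ls, b). \<Sum>i\<in>{1..<length ls}.
     fscale ((-1) ^ i)
       (fgen (hs, a, take (i - 1) ls @ dual_mult \<Delta> (ls ! (i - 1)) (ls ! i) # drop (i + 1) ls, b)))"

text \<open>In the names below, \<open>left\<close> and \<open>right\<close> tell on which side of \<open>\<pi>\<close> the superscript is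
  written: \<open>pi_H_right\<close> is \<open>\<pi>\<^sup>H\<close>, and \<open>pi_H_left\<close> has its superscript on the left.\<close>

definition pi_Hdual_left :: "('h::ring_1 \<Rightarrow> ('h \<times> 'h \<Rightarrow>\<^sub>0 'k::field) set) \<Rightarrow> ('m \<Rightarrow> ('m \<times> 'h \<Rightarrow>\<^sub>0 'k) set)
    \<Rightarrow> ('h, 'm, 'n, 'k) gen \<Rightarrow> (('h, 'm, 'n, 'k) gen \<Rightarrow>\<^sub>0 'k)" where
  "pi_Hdual_left \<Delta> \<delta>M = (\<lambda>(hs, a, ls, b). if ls = [] then 0 else
     fbind (sw_list \<Delta> hs) (\<lambda>(hs1, hs2). fbind (sw (\<delta>M a)) (\<lambda>(a0, a1).
       fscale ((hd ls) (prod_list hs2 * a1)) (fgen (hs1, a0, tl ls, b)))))"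

definition pi_Hdual_right :: "('k::field \<Rightarrow> 'h::ring_1 \<Rightarrow> 'h) \<Rightarrow> ('h \<Rightarrow> ('h \<times> 'h \<Rightarrow>\<^sub>0 'k) set)
    \<Rightarrow> ('n \<Rightarrow> ('n \<times> 'h \<Rightarrow>\<^sub>0 'k) set)
    \<Rightarrow> ('h, 'm, 'n, 'k) gen \<Rightarrow> (('h, 'm, 'n, 'k) gen \<Rightarrow>\<^sub>0 'k)" where
  "pi_Hdual_right sH \<Delta> \<delta>N = (\<lambda>(hs, a, ls, b). if ls = [] then 0 else
     fbind (sw (dual_comult sH (last ls))) (\<lambda>(l1, l2). fbind (sw_list \<Delta> hs) (\<lambda>(hs1, hs2).
       fscale (l1 (prod_list hs1)) (fgen (hs2, a, butlast ls, dual_act \<delta>N l2 b)))))"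

definition pi_H_right :: "('k::field \<Rightarrow> 'h::ring_1 \<Rightarrow> 'h) \<Rightarrow> ('h \<Rightarrow> ('h \<times> 'h \<Rightarrow>\<^sub>0 'k) set) \<Rightarrow> ('h \<Rightarrow> 'k)
    \<Rightarrow> ('h \<Rightarrow> 'm \<Rightarrow> 'm)
    \<Rightarrow> ('h, 'm, 'n, 'k) gen \<Rightarrow> (('h, 'm, 'n, 'k) gen \<Rightarrow>\<^sub>0 'k)" where
  "pi_H_right sH \<Delta> \<epsilon> actM = (\<lambda>(hs, a, ls, b). if hs = [] then 0 else
     fbind (sw_list (dual_comult sH) ls) (\<lambda>(ls1, ls2). fbind (sw (\<Delta> (last hs))) (\<lambda>(g1, g2).
       fscale (dual_prod \<Delta> \<epsilon> ls1 g1) (fgen (butlast hs, actM g2 a, ls2, b)))))"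

definition pi_H_left :: "('k::field \<Rightarrow> 'h::ring_1 \<Rightarrow> 'h) \<Rightarrow> ('h \<Rightarrow> ('h \<times> 'h \<Rightarrow>\<^sub>0 'k) set) \<Rightarrow> ('h \<Rightarrow> 'k)
    \<Rightarrow> ('k \<Rightarrow> 'n::ab_group_add \<Rightarrow> 'n) \<Rightarrow> ('h \<Rightarrow> 'n \<Rightarrow> 'n)
    \<Rightarrow> ('h, 'm, 'n, 'k) gen \<Rightarrow> (('h, 'm, 'n, 'k) gen \<Rightarrow>\<^sub>0 'k)" where
  "pi_H_left sH \<Delta> \<epsilon> sN actN = (\<lambda>(hs, a, ls, b). if hs = [] then 0 else
     fbind (sw_list (dual_comult sH) ls) (\<lambda>(ls1, ls2). fbind (sw (dual_coact sH sN actN b)) (\<lambda>(b0, b1).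
       fscale (dual_prod \<Delta> \<epsilon> (ls2 @ [b1]) (hd hs)) (fgen (tl hs, a, ls1, b0)))))"

definition sign_n :: "(('h, 'm, 'n, 'k::field) gen \<Rightarrow> (('h, 'm, 'n, 'k) gen \<Rightarrow>\<^sub>0 'k))
    \<Rightarrow> ('h, 'm, 'n, 'k) gen \<Rightarrow> (('h, 'm, 'n, 'k) gen \<Rightarrow>\<^sub>0 'k)" where
  "sign_n F = (\<lambda>(hs, a, ls, b). fscale ((-1) ^ length hs) (F (hs, a, ls, b)))"

definition sign_nm :: "(('h, 'm, 'n, 'k::field) gen \<Rightarrow> (('h, 'm, 'n, 'k) gen \<Rightarrow>\<^sub>0 'k))
    \<Rightarrow> ('h, 'm, 'n, 'k) gen \<Rightarrow> (('h, 'm, 'n, 'k) gen \<Rightarrow>\<^sub>0 'k)" where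
  "sign_nm F = (\<lambda>(hs, a, ls, b). fscale ((-1) ^ (length hs + length ls)) (F (hs, a, ls, b)))"

definition family :: "(nat \<Rightarrow> ('g \<Rightarrow>\<^sub>0 'k::field) rel) \<Rightarrow> ('g \<Rightarrow> ('g \<Rightarrow>\<^sub>0 'k))
    \<Rightarrow> nat \<Rightarrow> ('g \<Rightarrow>\<^sub>0 'k) set \<Rightarrow> ('g \<Rightarrow>\<^sub>0 'k) set" where
  "family X F k = induced (X (k - 1)) F"

definition bidifferential :: "(nat \<Rightarrow> ('g \<Rightarrow>\<^sub>0 'k::field) rel)
    \<Rightarrow> (nat \<Rightarrow> ('g \<Rightarrow>\<^sub>0 'k) set \<Rightarrow> ('g \<Rightarrow>\<^sub>0 'k) set)
    \<Rightarrow> (nat \<Rightarrow> ('g \<Rightarrow>\<^sub>0 'k) set \<Rightarrow> ('g \<Rightarrow>\<^sub>0 'k) set) \<Rightarrow> bool" where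
  "bidifferential X d d' \<longleftrightarrow>
     (\<forall>k>0. qlinear (X k) (X (k - 1)) (d k) \<and> qlinear (X k) (X (k - 1)) (d' k)) \<and>
     (\<forall>k>1. \<forall>x\<in>qcarrier (X k).
        d (k - 1) (d k x) = qzero (X (k - 2)) \<and>
        d' (k - 1) (d' k x) = qzero (X (k - 2)) \<and>
        qadd (X (k - 2)) (d' (k - 1) (d k x)) (d (k - 1) (d' k x)) = qzero (X (k - 2)))"

end

theory Submission
  imports Defs
begin

text \<open>
  The relations to be proved are equalities in iterated tensor products, which are presented here as
  quotients of formal sums. Two formal sums represent the same tensor if and only if every
  multilinear functional takes the same value on them (\<open>span_iff_annihilated\<close>). Therefore every
  map of the complex is replaced by its transpose, which acts on multilinear functionals
  \<open>\<Phi>(h1 ... hn, a, l1 ... lm, b)\<close>, and Sweedler calculus becomes the manipulation of finite sums of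
  scalars. Coassociativity, multiplicativity of the coproduct and the Yetter-Drinfeld condition turn
  into rules for rewriting such sums under a multilinear functional.

  The structure carried by the complex is symmetric. With the rainbow convention the dual of \<open>H\<close> is
  a bialgebra and the dual of \<open>N\<close> a Yetter-Drinfeld module over it (\<open>yd_on_dual\<close>), and the
  evaluation pairing satisfies conditions that do not distinguish \<open>H\<close> from its dual. Exchanging
  \<open>(H, M)\<close> with \<open>(H*, N*)\<close> exchanges \<open>d_bar\<close> with \<open>d_cob\<close>, \<open>\<pi>^H\<close> with \<open>\<pi>^{H*}\<close>, and \<open>{}^H\<pi>\<close> with
  \<open>{}^{H*}\<pi>\<close>. The theory is therefore developed for two abstract Yetter-Drinfeld modules in duality,
  and half of the relations follow from the other half.

  The relations have simple reasons.

  \<^item> The first differential is \<open>d_bar + s (-1)^n \<pi>^H + t {}^H\<pi>\<close> with \<open>s, t \<in> {0, 1}\<close>. The maps \<open>\<pi>^H\<close> and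
    \<open>{}^H\<pi>\<close> absorb the last and the first entry of \<open>h1 ... hn\<close>. Absorbing two neighbouring entries
    in turn is absorbing their product, and this supplies the two boundary terms that the bar
    differential lacks (\<open>piH_piH\<close>, \<open>Hpi_Hpi\<close>). Absorbing at opposite ends commutes by coassociativity
    (\<open>piH_Hpi\<close>). Hence the square is zero.

  \<^item> Without its sign the second differential is the mirror image of the first, so its square is
    zero too.

  \<^item> Without that sign the two differentials commute, summand by summand. The bar differential
    commutes with \<open>{}^{H*}\<pi>\<close> and \<open>\<pi>^{H*}\<close> as the coproduct is multiplicative (\<open>bar_Hdpi\<close>,
    \<open>bar_piHd\<close>); \<open>\<pi>^H\<close> commutes with \<open>{}^{H*}\<pi>\<close> precisely by the Yetter-Drinfeld condition on \<open>M\<close>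
    (\<open>piH_Hdpi\<close>), and \<open>{}^H\<pi>\<close> with \<open>\<pi>^{H*}\<close> by that on \<open>N\<close>; the two remaining pairs commute by duality and
    coassociativity (\<open>Hpi_Hdpi\<close>, \<open>piH_piHd\<close>). The sign \<open>(-1)^n\<close>, which the first differential
    changes, turns commutation into anticommutation.

  In lemma names and in the transposes \<open>tr_...\<close>, the abbreviations \<open>piH\<close>, \<open>Hpi\<close>, \<open>piHd\<close> and \<open>Hdpi\<close> stand for
  \<open>\<pi>^H\<close>, \<open>{}^H\<pi>\<close>, \<open>\<pi>^{H*}\<close> and \<open>{}^{H*}\<pi>\<close>.
\<close>

section \<open>Formal sums\<close>

lemma fsum_superset:
  assumes "finite S" "Poly_Mapping.keys p \<subseteq> S"
  shows "fsum p f = (\<Sum>g\<in>S. Poly_Mapping.lookup p g * f g)"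
  unfolding linext_def using assms by (intro sum.mono_neutral_left) (auto simp: in_keys_iff)

lemma fsum_add: "fsum (p + q) f = fsum p f + fsum q f"
proof -
  let ?S = "Poly_Mapping.keys p \<union> Poly_Mapping.keys q"
  have "fsum (p + q) f = (\<Sum>g\<in>?S. Poly_Mapping.lookup (p + q) g * f g)"
    by (intro fsum_superset) (auto simp: keys_add)
  also have "\<dots> = (\<Sum>g\<in>?S. Poly_Mapping.lookup p g * f g) + (\<Sum>g\<in>?S. Poly_Mapping.lookup q g * f g)"
    by (simp add: lookup_add distrib_right sum.distrib)
  also have "\<dots> = fsum p f + fsum q f"
    by (simp add: fsum_superset[of ?S])
  finally show ?thesis .
qed

lemma keys_fscale: "Poly_Mapping.keys (fscale c p) \<subseteq> Poly_Mapping.keys p"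
  by (auto simp: in_keys_iff)

lemma fsum_fscale: "fsum (fscale c p) f = c * fsum p f"
  by (subst fsum_superset[OF finite_keys keys_fscale])
    (simp add: fsum_superset[OF finite_keys subset_refl] sum_distrib_left mult.assoc)

lemma fsum_zero [simp]: "fsum 0 f = 0"
  by (simp add: linext_def)

lemma fsum_fgen [simp]: "fsum (fgen g) f = f g"
  by (simp add: linext_def fgen_def)

lemma fsum_uminus: "fsum (- p) f = - fsum p f"
  using fsum_add[of "- p" p f] by (simp add: eq_neg_iff_add_eq_0)

lemma fsum_diff: "fsum (p - q) f = fsum p f - fsum q f"
  using fsum_add[of p "- q" f] by (simp add: fsum_uminus)

lemma fsum_sum: "fsum (sum p I) f = (\<Sum>i\<in>I. fsum (p i) f)"
  by (induction I rule: infinite_finite_induct) (auto simp: fsum_add)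

lemma fsum_fbind: "fsum (fbind p F) f = fsum p (\<lambda>g. fsum (F g) f)"
  by (simp add: linext_def[of fscale] fsum_sum fsum_fscale) (simp add: linext_def)

lemma fsum_cong: "(\<And>g. g \<in> Poly_Mapping.keys p \<Longrightarrow> f g = f' g) \<Longrightarrow> fsum p f = fsum p f'"
  by (simp add: linext_def)

lemma keys_sum_subset: "Poly_Mapping.keys (sum p I) \<subseteq> (\<Union>i\<in>I. Poly_Mapping.keys (p i))"
  by (induction I rule: infinite_finite_induct) (use keys_add in fastforce)+

lemma keys_fbind:
  assumes "\<And>g. g \<in> Poly_Mapping.keys p \<Longrightarrow> Poly_Mapping.keys (F g) \<subseteq> G"
  shows "Poly_Mapping.keys (fbind p F) \<subseteq> G"
  unfolding linext_def using assms keys_sum_subset keys_fscale by fastforce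

lemma keys_fgen [simp]: "Poly_Mapping.keys (fgen g :: 'g \<Rightarrow>\<^sub>0 'k::field) = {g}"
  by (simp add: fgen_def)

interpretation fs: vector_space "fscale :: 'k::field \<Rightarrow> ('g \<Rightarrow>\<^sub>0 'k) \<Rightarrow> _"
  by (rule vector_space_fscale)

lemma lookup_fsum: "Poly_Mapping.lookup p g = fsum p (\<lambda>x. if x = g then 1 else 0)"
  by (auto simp: linext_def in_keys_iff if_distrib sum.delta cong: if_cong)

lemma fbind_add: "fbind (p + q) F = fbind p F + fbind q F"
  by (rule poly_mapping_eqI) (simp only: lookup_add lookup_fsum fsum_fbind fsum_add)

lemma fbind_fscale: "fbind (fscale c p) F = fscale c (fbind p F)"
  by (rule poly_mapping_eqI) (simp only: lookup_fscale lookup_fsum fsum_fbind fsum_fscale)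

text \<open>A functional on the generators extends linearly to formal sums; it descends to the quotient by
  \<open>R\<close> exactly when it satisfies the following condition.\<close>

definition annihilates :: "('g \<Rightarrow>\<^sub>0 'k::field) set \<Rightarrow> ('g \<Rightarrow> 'k) \<Rightarrow> bool" where
  "annihilates R \<Phi> \<longleftrightarrow> (\<forall>r\<in>R. fsum r \<Phi> = 0)"

lemma annihilates_span:
  assumes "annihilates R \<Phi>" "p \<in> fs.span R"
  shows "fsum p \<Phi> = 0"
  using assms(2)
  by (induction rule: fs.span_induct_alt)
    (use assms(1) in \<open>auto simp: annihilates_def fsum_add fsum_fscale\<close>)

text \<open>A vector outside the span of \<open>R\<close> can be added to a basis of that span, and then a
  linear form vanishes on the span but not on the vector. Hence equality in a quotient can be
  tested on functionals, which is what turns every identity between tensors in the sequel into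
  an identity between scalars.\<close>

lemma span_iff_annihilated:
  fixes p :: "'g \<Rightarrow>\<^sub>0 'k::field"
  shows "p \<in> fs.span R \<longleftrightarrow> (\<forall>\<Phi>. annihilates R \<Phi> \<longrightarrow> fsum p \<Phi> = 0)"
proof
  show "p \<in> fs.span R \<Longrightarrow> \<forall>\<Phi>. annihilates R \<Phi> \<longrightarrow> fsum p \<Phi> = 0"
    using annihilates_span by blast
next
  assume ann: "\<forall>\<Phi>. annihilates R \<Phi> \<longrightarrow> fsum p \<Phi> = 0"
  show "p \<in> fs.span R"
  proof (rule ccontr)
    assume notin: "p \<notin> fs.span R"
    interpret kk: vector_space_pair "fscale :: 'k \<Rightarrow> ('g \<Rightarrow>\<^sub>0 'k) \<Rightarrow> _" "(*) :: 'k \<Rightarrow> 'k \<Rightarrow> 'k"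
      by unfold_locales (auto simp: algebra_simps)
    obtain B where B: "B \<subseteq> R" "fs.independent B" "R \<subseteq> fs.span B"
      using fs.maximal_independent_subset by blast
    have span: "fs.span B = fs.span R"
      using B by (meson fs.span_minimal fs.span_mono fs.subspace_span subset_antisym)
    have "fs.independent (insert p B)"
      using B(2) notin span by (simp add: fs.independent_insertI)
    then obtain f where f: "Vector_Spaces.linear fscale (*) f"
      "\<forall>x\<in>insert p B. f x = (if x = p then 1 else 0 :: 'k)"
      using kk.linear_independent_extend[of "insert p B" "\<lambda>x. if x = p then 1 else 0"] by auto
    have f_fsum: "f q = fsum q (\<lambda>g. f (fgen g))" for q
    proof -
      have "q = fbind q fgen"
      proof (rule poly_mapping_eqI)
        fix g show "Poly_Mapping.lookup q g = Poly_Mapping.lookup (fbind q fgen) g"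
          by (auto simp: linext_def lookup_sum fgen_def lookup_single when_def in_keys_iff
              if_distrib sum.delta cong: if_cong)
      qed
      then have "f q = f (\<Sum>g\<in>Poly_Mapping.keys q. fscale (Poly_Mapping.lookup q g) (fgen g))"
        by (simp add: linext_def)
      also have "\<dots> = fsum q (\<lambda>g. f (fgen g))"
        by (simp add: linext_def kk.linear_sum[OF f(1)] kk.linear_scale[OF f(1)])
      finally show ?thesis .
    qed
    have "f x = 0" if "x \<in> fs.span B" for x
      using that
    proof (induction rule: fs.span_induct_alt)
      case base then show ?case using f(1) kk.linear_0 by blast
    next
      case (step c x y)
      have "x \<noteq> p" using step(1) notin span fs.span_base by blast
      then show ?case using step f
        by (simp add: kk.linear_add[OF f(1)] kk.linear_scale[OF f(1)])
    qed
    then have "annihilates R (\<lambda>g. f (fgen g))"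
      using B(3) by (auto simp: annihilates_def f_fsum[symmetric])
    then have "f p = 0" using ann by (simp add: f_fsum[of p])
    then show False using f(2) by simp
  qed
qed

lemma presented_iff:
  "(p, q) \<in> presented G R \<longleftrightarrow> Poly_Mapping.keys p \<subseteq> G \<and> Poly_Mapping.keys q \<subseteq> G \<and>
     (\<forall>\<Phi>. annihilates R \<Phi> \<longrightarrow> fsum p \<Phi> = fsum q \<Phi>)"
  unfolding presented_def by (simp add: span_iff_annihilated fsum_diff)

section \<open>Sweedler sums\<close>

text \<open>Sweedler notation for scalars: \<open>swsum D h \<beta>\<close> is
  \<open>\<beta>(h_(1), h_(2))\<close> with the
  summation sign restored. As the sums are finite, two of them over independent formal sums can
  be interchanged.\<close>

definition fs2 :: "('a \<times> 'b \<Rightarrow>\<^sub>0 'k::field) \<Rightarrow> ('a \<Rightarrow> 'b \<Rightarrow> 'k) \<Rightarrow> 'k" where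
  "fs2 p \<beta> = fsum p (\<lambda>(x, y). \<beta> x y)"

abbreviation swsum :: "('c \<Rightarrow> ('a \<times> 'b \<Rightarrow>\<^sub>0 'k::field) set) \<Rightarrow> 'c \<Rightarrow> ('a \<Rightarrow> 'b \<Rightarrow> 'k) \<Rightarrow> 'k" where
  "swsum D x \<equiv> fs2 (sw (D x))"

lemma fs2_sum_keys: "fs2 p \<beta> = (\<Sum>(x, y)\<in>Poly_Mapping.keys p. Poly_Mapping.lookup p (x, y) * \<beta> x y)"
  unfolding fs2_def linext_def by (intro sum.cong) auto

lemma fs2_commute: "fs2 p (\<lambda>x y. fs2 q (\<lambda>u v. F x y u v)) = fs2 q (\<lambda>u v. fs2 p (\<lambda>x y. F x y u v))"
  unfolding fs2_def linext_def case_prod_beta sum_distrib_left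
  by (subst sum.swap) (simp add: ac_simps)

lemma fs2_mult_left: "fs2 p (\<lambda>x y. c * F x y) = c * fs2 p F"
  unfolding fs2_def linext_def by (simp add: sum_distrib_left case_prod_beta ac_simps)

lemma fs2_mult_right: "fs2 p (\<lambda>x y. F x y * c) = fs2 p F * c"
  using fs2_mult_left[of p c F] by (simp add: mult.commute)

lemma fs2_add: "fs2 p (\<lambda>x y. F x y + G x y) = fs2 p F + fs2 p G"
  unfolding fs2_def linext_def by (simp add: case_prod_beta algebra_simps sum.distrib)

lemma fs2_uminus: "fs2 p (\<lambda>x y. - F x y) = - fs2 p F"
  using fs2_mult_left[of p "-1" F] by simp

lemma fs2_diff: "fs2 p (\<lambda>x y. F x y - G x y) = fs2 p F - fs2 p G"
  using fs2_add[of p F "\<lambda>x y. - G x y"] by (simp add: fs2_uminus)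

lemma fs2_zero [simp]: "fs2 p (\<lambda>x y. 0) = 0"
  using fs2_mult_left[of p 0 "\<lambda>x y. 0"] by simp

lemma fs2_sum: "fs2 p (\<lambda>x y. \<Sum>i\<in>I. F i x y) = (\<Sum>i\<in>I. fs2 p (F i))"
  by (induction I rule: infinite_finite_induct) (auto simp: fs2_add)

lemma fs2_cong:
  "(\<And>x y. (x, y) \<in> Poly_Mapping.keys p \<Longrightarrow> F x y = G x y) \<Longrightarrow> fs2 p F = fs2 p G"
  unfolding fs2_def by (intro fsum_cong) auto

lemma fs2_fgen [simp]: "fs2 (fgen (x, y)) F = F x y"
  by (simp add: fs2_def)

lemma fs2_fbind: "fs2 (fbind p (\<lambda>(x, y). G x y)) F = fs2 p (\<lambda>x y. fs2 (G x y) F)"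
  unfolding fs2_def fsum_fbind by (intro fsum_cong) auto

lemma fs2_sw_list_Nil [simp]: "fs2 (sw_list D []) F = F [] []"
  by simp

lemma fs2_sw_list_Cons:
  "fs2 (sw_list D (x # xs)) F
     = swsum D x (\<lambda>x1 x2. fs2 (sw_list D xs) (\<lambda>us vs. F (x1 # us) (x2 # vs)))"
  by (simp add: fs2_fbind)

declare sw_list.simps [simp del]

lemma fs2_sw_list_append:
  "fs2 (sw_list D (xs @ ys)) F
     = fs2 (sw_list D xs) (\<lambda>us vs. fs2 (sw_list D ys) (\<lambda>us' vs'. F (us @ us') (vs @ vs')))"
proof (induction xs arbitrary: F)
  case Nil then show ?case by simp
next
  case (Cons x xs) then show ?case by (simp add: fs2_sw_list_Cons)
qed

lemmas push_in = fs2_mult_left[symmetric] fs2_mult_right[symmetric]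

text \<open>Both sides are the sum of \<open>\<alpha> l2 h2 * \<beta> q b1 h1 * \<gamma> l1 v a1 * \<phi> u
  a0 p b0\<close> over all six decompositions; this is the whole combinatorial content of the
  commutation of \<open>{}^H\<pi>\<close> with \<open>{}^{H*}\<pi>\<close>.\<close>

lemma fs2_interchange:
  "fs2 l (\<lambda>l1 l2. fs2 ls (\<lambda>p q. fs2 b (\<lambda>b0 b1. fs2 h (\<lambda>h1 h2. \<alpha> l2 h2 * \<beta> q b1 h1) *
     fs2 hs (\<lambda>u v. fs2 a (\<lambda>a0 a1. \<gamma> l1 v a1 * \<phi> u a0 p b0)))))
   = fs2 h (\<lambda>h1 h2. fs2 hs (\<lambda>u v. fs2 a (\<lambda>a0 a1. fs2 l (\<lambda>l1 l2. \<gamma> l1 v a1 * \<alpha> l2 h2) *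
     fs2 ls (\<lambda>p q. fs2 b (\<lambda>b0 b1. \<beta> q b1 h1 * \<phi> u a0 p b0)))))"
proof -
  have *: "?thesis \<longleftrightarrow> fs2 l (\<lambda>l1 l2. fs2 ls (\<lambda>p q. fs2 b (\<lambda>b0 b1. fs2 h (\<lambda>h1 h2. fs2 hs (\<lambda>u v. fs2 a (\<lambda>a0 a1.
      \<alpha> l2 h2 * \<beta> q b1 h1 * (\<gamma> l1 v a1 * \<phi> u a0 p b0)))))))
    = fs2 h (\<lambda>h1 h2. fs2 hs (\<lambda>u v. fs2 a (\<lambda>a0 a1. fs2 l (\<lambda>l1 l2. fs2 ls (\<lambda>p q. fs2 b (\<lambda>b0 b1.
      \<alpha> l2 h2 * \<beta> q b1 h1 * (\<gamma> l1 v a1 * \<phi> u a0 p b0)))))))"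
    by (simp only: fs2_mult_right[symmetric])
      (simp only: fs2_mult_left[symmetric] mult.left_commute mult.commute mult.assoc)
  show ?thesis
    unfolding *
    by (simp only: fs2_commute[of b h] fs2_commute[of ls h] fs2_commute[of l h]
       fs2_commute[of b hs] fs2_commute[of ls hs] fs2_commute[of l hs]
       fs2_commute[of b a] fs2_commute[of ls a] fs2_commute[of l a])
qed

section \<open>Multilinear functionals on a subspace\<close>

text \<open>Linearity is required on a subset only, because the dual of \<open>H\<close> is a proper subset
  of the type of all functions on \<open>H\<close>.\<close>

definition lin_on :: "'a::ab_group_add set \<Rightarrow> ('k::field \<Rightarrow> 'a \<Rightarrow> 'a) \<Rightarrow> ('a \<Rightarrow> 'k) \<Rightarrow> bool" where
  "lin_on A s f \<longleftrightarrow> (\<forall>x\<in>A. \<forall>y\<in>A. f (x + y) = f x + f y) \<and> (\<forall>c. \<forall>x\<in>A. f (s c x) = c * f x)"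

definition bilin_on ::
  "'a::ab_group_add set \<Rightarrow> ('k::field \<Rightarrow> 'a \<Rightarrow> 'a) \<Rightarrow> 'b::ab_group_add set \<Rightarrow> ('k \<Rightarrow> 'b \<Rightarrow> 'b)
    \<Rightarrow> ('a \<Rightarrow> 'b \<Rightarrow> 'k) \<Rightarrow> bool" where
  "bilin_on A s B t \<beta> \<longleftrightarrow>
     (\<forall>y\<in>B. lin_on A s (\<lambda>x. \<beta> x y)) \<and> (\<forall>x\<in>A. lin_on B t (\<lambda>y. \<beta> x y))"

definition trilin_on ::
  "'a::ab_group_add set \<Rightarrow> ('k::field \<Rightarrow> 'a \<Rightarrow> 'a) \<Rightarrow> 'b::ab_group_add set \<Rightarrow> ('k \<Rightarrow> 'b \<Rightarrow> 'b)
    \<Rightarrow> 'c::ab_group_add set \<Rightarrow> ('k \<Rightarrow> 'c \<Rightarrow> 'c) \<Rightarrow> ('a \<Rightarrow> 'b \<Rightarrow> 'c \<Rightarrow> 'k) \<Rightarrow> bool" where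
  "trilin_on A s B t C r \<tau> \<longleftrightarrow>
     (\<forall>y\<in>B. \<forall>z\<in>C. lin_on A s (\<lambda>x. \<tau> x y z)) \<and> (\<forall>x\<in>A. \<forall>z\<in>C. lin_on B t (\<lambda>y. \<tau> x y z)) \<and>
     (\<forall>x\<in>A. \<forall>y\<in>B. lin_on C r (\<lambda>z. \<tau> x y z))"

definition lists_on :: "'a set \<Rightarrow> nat \<Rightarrow> 'a list set" where
  "lists_on A n = {xs. set xs \<subseteq> A \<and> length xs = n}"

definition multilin_on :: "'a::ab_group_add set \<Rightarrow> ('k::field \<Rightarrow> 'a \<Rightarrow> 'a) \<Rightarrow> nat \<Rightarrow> ('a list \<Rightarrow> 'k) \<Rightarrow> bool" where
  "multilin_on A s n f \<longleftrightarrow> (\<forall>us vs. set us \<subseteq> A \<longrightarrow> set vs \<subseteq> A \<longrightarrow> length us + length vs + 1 = n \<longrightarrow>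
     lin_on A s (\<lambda>x. f (us @ x # vs)))"

lemma lin_onI:
  assumes "\<And>x y. x \<in> A \<Longrightarrow> y \<in> A \<Longrightarrow> f (x + y) = f x + f y"
    and "\<And>c x. x \<in> A \<Longrightarrow> f (s c x) = c * f x"
  shows "lin_on A s f"
  using assms by (auto simp: lin_on_def)

lemma lin_on_zero: "lin_on A s (\<lambda>x. 0)"
  by (simp add: lin_on_def)

lemma lin_on_mult_left: "lin_on A s f \<Longrightarrow> lin_on A s (\<lambda>x. c * f x)"
  by (simp add: lin_on_def algebra_simps)

lemma lin_on_mult_right: "lin_on A s f \<Longrightarrow> lin_on A s (\<lambda>x. f x * c)"
  by (simp add: lin_on_def algebra_simps)

lemma lin_on_add: "lin_on A s f \<Longrightarrow> lin_on A s g \<Longrightarrow> lin_on A s (\<lambda>x. f x + g x)"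
  by (simp add: lin_on_def algebra_simps)

lemma lin_on_uminus: "lin_on A s f \<Longrightarrow> lin_on A s (\<lambda>x. - f x)"
  by (simp add: lin_on_def algebra_simps)

lemma lin_on_diff: "lin_on A s f \<Longrightarrow> lin_on A s g \<Longrightarrow> lin_on A s (\<lambda>x. f x - g x)"
  by (simp add: lin_on_def algebra_simps)

lemma lin_on_fs2:
  assumes "\<And>u v. (u, v) \<in> Poly_Mapping.keys p \<Longrightarrow> lin_on A s (\<lambda>x. F x u v)"
  shows "lin_on A s (\<lambda>x. fs2 p (F x))"
proof (rule lin_onI)
  fix x y assume "x \<in> A" "y \<in> A"
  then have "fs2 p (F (x + y)) = fs2 p (\<lambda>u v. F x u v + F y u v)"
    using assms by (intro fs2_cong) (auto simp: lin_on_def)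
  then show "fs2 p (F (x + y)) = fs2 p (F x) + fs2 p (F y)"
    by (simp add: fs2_add)
next
  fix c x assume "x \<in> A"
  then have "fs2 p (F (s c x)) = fs2 p (\<lambda>u v. c * F x u v)"
    using assms by (intro fs2_cong) (auto simp: lin_on_def)
  then show "fs2 p (F (s c x)) = c * fs2 p (F x)"
    by (simp add: fs2_mult_left)
qed

lemma bilin_onI:
  assumes "\<And>y. y \<in> B \<Longrightarrow> lin_on A s (\<lambda>x. \<beta> x y)" "\<And>x. x \<in> A \<Longrightarrow> lin_on B t (\<lambda>y. \<beta> x y)"
  shows "bilin_on A s B t \<beta>"
  using assms by (auto simp: bilin_on_def)

lemma trilin_onI:
  assumes "\<And>y z. y \<in> B \<Longrightarrow> z \<in> C \<Longrightarrow> lin_on A s (\<lambda>x. \<tau> x y z)"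
    and "\<And>x z. x \<in> A \<Longrightarrow> z \<in> C \<Longrightarrow> lin_on B t (\<lambda>y. \<tau> x y z)"
    and "\<And>x y. x \<in> A \<Longrightarrow> y \<in> B \<Longrightarrow> lin_on C r (\<lambda>z. \<tau> x y z)"
  shows "trilin_on A s B t C r \<tau>"
  using assms by (auto simp: trilin_on_def)

lemma multilin_onI:
  assumes "\<And>us vs. set us \<subseteq> A \<Longrightarrow> set vs \<subseteq> A \<Longrightarrow> length us + length vs + 1 = n
             \<Longrightarrow> lin_on A s (\<lambda>x. f (us @ x # vs))"
  shows "multilin_on A s n f"
  using assms by (auto simp: multilin_on_def)

lemma multilin_onD:
  "multilin_on A s n f \<Longrightarrow> set us \<subseteq> A \<Longrightarrow> set vs \<subseteq> A \<Longrightarrow> length us + length vs + 1 = n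
     \<Longrightarrow> lin_on A s (\<lambda>x. f (us @ x # vs))"
  by (auto simp: multilin_on_def)

lemma multilin_on_hd:
  "multilin_on A s (Suc n) f \<Longrightarrow> vs \<in> lists_on A n \<Longrightarrow> lin_on A s (\<lambda>x. f (x # vs))"
  using multilin_onD[of A s "Suc n" f "[]" vs] by (auto simp: lists_on_def)

lemma multilin_on_last:
  "multilin_on A s (Suc n) f \<Longrightarrow> us \<in> lists_on A n \<Longrightarrow> lin_on A s (\<lambda>x. f (us @ [x]))"
  using multilin_onD[of A s "Suc n" f us "[]"] by (auto simp: lists_on_def)

lemma multilin_on_Cons:
  assumes "multilin_on A s (Suc n) f" "x \<in> A"
  shows "multilin_on A s n (\<lambda>xs. f (x # xs))"
proof (rule multilin_onI)
  fix us vs assume "set us \<subseteq> A" "set vs \<subseteq> A" "length us + length vs + 1 = n"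
  then show "lin_on A s (\<lambda>y. f (x # us @ y # vs))"
    using multilin_onD[OF assms(1), of "x # us" vs] assms(2) by simp
qed

lemma multilin_on_snoc:
  assumes "multilin_on A s (Suc n) f" "x \<in> A"
  shows "multilin_on A s n (\<lambda>xs. f (xs @ [x]))"
proof (rule multilin_onI)
  fix us vs assume "set us \<subseteq> A" "set vs \<subseteq> A" "length us + length vs + 1 = n"
  then show "lin_on A s (\<lambda>y. f ((us @ y # vs) @ [x]))"
    using multilin_onD[OF assms(1), of us "vs @ [x]"] assms(2) by simp
qed

lemma multilin_on_fs2:
  assumes "\<And>u v. (u, v) \<in> Poly_Mapping.keys p \<Longrightarrow> multilin_on A s n (\<lambda>xs. F xs u v)"
  shows "multilin_on A s n (\<lambda>xs. fs2 p (F xs))"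
  by (intro multilin_onI lin_on_fs2 multilin_onD[OF assms])

lemma multilin_on_mult_left: "multilin_on A s n f \<Longrightarrow> multilin_on A s n (\<lambda>xs. c * f xs)"
  by (simp add: multilin_on_def lin_on_mult_left)

lemma multilin_on_mult_right: "multilin_on A s n f \<Longrightarrow> multilin_on A s n (\<lambda>xs. f xs * c)"
  by (simp add: multilin_on_def lin_on_mult_right)

lemma lists_on_Cons [simp]: "x # xs \<in> lists_on A (Suc n) \<longleftrightarrow> x \<in> A \<and> xs \<in> lists_on A n"
  by (auto simp: lists_on_def)

lemma lists_on_Nil [simp]: "[] \<in> lists_on A n \<longleftrightarrow> n = 0"
  by (auto simp: lists_on_def)

lemma lists_on_snoc [simp]: "xs @ [x] \<in> lists_on A (Suc n) \<longleftrightarrow> x \<in> A \<and> xs \<in> lists_on A n"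
  by (auto simp: lists_on_def)

lemma multilin_on_add:
  "multilin_on A s n f \<Longrightarrow> multilin_on A s n g \<Longrightarrow> multilin_on A s n (\<lambda>xs. f xs + g xs)"
  by (simp add: multilin_on_def lin_on_add)

lemma lists_on_SucE:
  assumes "xs \<in> lists_on X (Suc n)"
  obtains ys y where "xs = ys @ [y]" "ys \<in> lists_on X n" "y \<in> X"
  using assms by (cases xs rule: rev_cases) (auto simp: lists_on_def)

lemma lists_on_Suc_ConsE:
  assumes "xs \<in> lists_on X (Suc n)"
  obtains ys y where "xs = y # ys" "ys \<in> lists_on X n" "y \<in> X"
  using assms by (cases xs) (auto simp: lists_on_def)

section \<open>Yetter-Drinfeld modules on subspaces\<close>

text \<open>The axioms of a bialgebra with a left-right Yetter-Drinfeld module, on subsets \<open>A\<close>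
  and \<open>M\<close> of the ambient types, with every equation between tensors replaced by its
  evaluation on multilinear functionals. In this form \<open>H\<close> (where \<open>A\<close>
  is the whole type) and its dual satisfy literally the same axioms. The counit of either one
  appears as the unit of the other.\<close>

locale yd_on =
  fixes A :: "'a::ab_group_add set" and sA :: "'k::field \<Rightarrow> 'a \<Rightarrow> 'a"
    and mul :: "'a \<Rightarrow> 'a \<Rightarrow> 'a" and one :: 'a
    and D :: "'a \<Rightarrow> ('a \<times> 'a \<Rightarrow>\<^sub>0 'k) set"
    and M :: "'m::ab_group_add set" and sM :: "'k \<Rightarrow> 'm \<Rightarrow> 'm"
    and act :: "'a \<Rightarrow> 'm \<Rightarrow> 'm" and \<delta> :: "'m \<Rightarrow> ('m \<times> 'a \<Rightarrow>\<^sub>0 'k) set"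
  assumes mul_closed: "x \<in> A \<Longrightarrow> y \<in> A \<Longrightarrow> mul x y \<in> A"
    and one_closed: "one \<in> A"
    and act_closed: "x \<in> A \<Longrightarrow> a \<in> M \<Longrightarrow> act x a \<in> M"
    and D_closed: "x \<in> A \<Longrightarrow> Poly_Mapping.keys (sw (D x)) \<subseteq> A \<times> A"
    and \<delta>_closed: "a \<in> M \<Longrightarrow> Poly_Mapping.keys (sw (\<delta> a)) \<subseteq> M \<times> A"
    and mul_assoc: "x \<in> A \<Longrightarrow> y \<in> A \<Longrightarrow> z \<in> A \<Longrightarrow> mul (mul x y) z = mul x (mul y z)"
    and one_mul: "x \<in> A \<Longrightarrow> mul one x = x"
    and mul_one: "x \<in> A \<Longrightarrow> mul x one = x"
    and act_mul: "x \<in> A \<Longrightarrow> y \<in> A \<Longrightarrow> a \<in> M \<Longrightarrow> act (mul x y) a = act x (act y a)"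
    and lin_mul_left: "lin_on A sA f \<Longrightarrow> y \<in> A \<Longrightarrow> lin_on A sA (\<lambda>x. f (mul x y))"
    and lin_mul_right: "lin_on A sA f \<Longrightarrow> x \<in> A \<Longrightarrow> lin_on A sA (\<lambda>y. f (mul x y))"
    and lin_act_left: "lin_on M sM g \<Longrightarrow> a \<in> M \<Longrightarrow> lin_on A sA (\<lambda>x. g (act x a))"
    and lin_act_right: "lin_on M sM g \<Longrightarrow> x \<in> A \<Longrightarrow> lin_on M sM (\<lambda>a. g (act x a))"
    and lin_D: "bilin_on A sA A sA \<beta> \<Longrightarrow> lin_on A sA (\<lambda>x. swsum D x \<beta>)"
    and lin_\<delta>: "bilin_on M sM A sA \<gamma> \<Longrightarrow> lin_on M sM (\<lambda>a. swsum \<delta> a \<gamma>)"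
    and D_coassoc: "trilin_on A sA A sA A sA \<tau> \<Longrightarrow> x \<in> A \<Longrightarrow>
        swsum D x (\<lambda>x1 x2. swsum D x1 (\<lambda>x11 x12. \<tau> x11 x12 x2))
          = swsum D x (\<lambda>x1 x2. swsum D x2 (\<lambda>x21 x22. \<tau> x1 x21 x22))"
    and D_mul: "bilin_on A sA A sA \<beta> \<Longrightarrow> x \<in> A \<Longrightarrow> y \<in> A \<Longrightarrow>
        swsum D (mul x y) \<beta> = swsum D x (\<lambda>x1 x2. swsum D y (\<lambda>y1 y2. \<beta> (mul x1 y1) (mul x2 y2)))"
    and D_one: "bilin_on A sA A sA \<beta> \<Longrightarrow> swsum D one \<beta> = \<beta> one one"
    and \<delta>_coassoc: "trilin_on M sM A sA A sA \<sigma> \<Longrightarrow> a \<in> M \<Longrightarrow>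
        swsum \<delta> a (\<lambda>a0 a1. swsum \<delta> a0 (\<lambda>a00 a01. \<sigma> a00 a01 a1))
          = swsum \<delta> a (\<lambda>a0 a1. swsum D a1 (\<lambda>a11 a12. \<sigma> a0 a11 a12))"
    and yd: "bilin_on M sM A sA \<gamma> \<Longrightarrow> x \<in> A \<Longrightarrow> a \<in> M \<Longrightarrow>
        swsum D x (\<lambda>x1 x2. swsum \<delta> (act x2 a) (\<lambda>y0 y1. \<gamma> y0 (mul y1 x1)))
          = swsum D x (\<lambda>x1 x2. swsum \<delta> a (\<lambda>a0 a1. \<gamma> (act x1 a0) (mul x2 a1)))"
begin

definition prod :: "'a list \<Rightarrow> 'a" where
  "prod xs = foldr mul xs one"

lemma prod_Nil [simp]: "prod [] = one"
  by (simp add: prod_def)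

lemma prod_Cons [simp]: "prod (x # xs) = mul x (prod xs)"
  by (simp add: prod_def)

lemma prod_closed [intro]: "set xs \<subseteq> A \<Longrightarrow> prod xs \<in> A"
  by (induction xs) (auto simp: one_closed mul_closed)

lemma prod_lists_on: "xs \<in> lists_on A n \<Longrightarrow> prod xs \<in> A"
  by (auto simp: lists_on_def)

lemma prod_append: "set xs \<subseteq> A \<Longrightarrow> set ys \<subseteq> A \<Longrightarrow> prod (xs @ ys) = mul (prod xs) (prod ys)"
  by (induction xs) (auto simp: one_mul mul_assoc prod_closed)

lemma prod_snoc: "set xs \<subseteq> A \<Longrightarrow> y \<in> A \<Longrightarrow> prod (xs @ [y]) = mul (prod xs) y"
  by (simp add: prod_append mul_one)

lemma D_keys: "(u, v) \<in> Poly_Mapping.keys (sw (D x)) \<Longrightarrow> x \<in> A \<Longrightarrow> u \<in> A \<and> v \<in> A"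
  using D_closed by blast

lemma \<delta>_keys: "(u, v) \<in> Poly_Mapping.keys (sw (\<delta> a)) \<Longrightarrow> a \<in> M \<Longrightarrow> u \<in> M \<and> v \<in> A"
  using \<delta>_closed by blast

lemma keys_sw_list:
  "xs \<in> lists_on A n \<Longrightarrow> Poly_Mapping.keys (sw_list D xs) \<subseteq> lists_on A n \<times> lists_on A n"
proof (induction xs arbitrary: n)
  case Nil then show ?case by (simp add: sw_list.simps)
next
  case (Cons x xs)
  then obtain m where m: "n = Suc m" by (cases n) (auto simp: lists_on_def)
  have x: "x \<in> A" and xs: "xs \<in> lists_on A m" using Cons.prems m by auto
  show ?case
    unfolding sw_list.simps m using D_closed[OF x] Cons.IH[OF xs]
    by (auto intro!: keys_fbind split: prod.splits)
qed

lemma list_keys: "(us, vs) \<in> Poly_Mapping.keys (sw_list D xs) \<Longrightarrow> xs \<in> lists_on A n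
    \<Longrightarrow> us \<in> lists_on A n \<and> vs \<in> lists_on A n"
  using keys_sw_list by blast

lemma swD_cong: "x \<in> A \<Longrightarrow> (\<And>u v. u \<in> A \<Longrightarrow> v \<in> A \<Longrightarrow> F u v = G u v) \<Longrightarrow> swsum D x F = swsum D x G"
  by (intro fs2_cong) (use D_keys in blast)

lemma sw\<delta>_cong: "a \<in> M \<Longrightarrow> (\<And>u v. u \<in> M \<Longrightarrow> v \<in> A \<Longrightarrow> F u v = G u v) \<Longrightarrow> swsum \<delta> a F = swsum \<delta> a G"
  by (intro fs2_cong) (use \<delta>_keys in blast)

lemma sw_list_cong: "xs \<in> lists_on A n \<Longrightarrow>
    (\<And>us vs. us \<in> lists_on A n \<Longrightarrow> vs \<in> lists_on A n \<Longrightarrow> F us vs = G us vs)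
    \<Longrightarrow> fs2 (sw_list D xs) F = fs2 (sw_list D xs) G"
  by (intro fs2_cong) (use list_keys in blast)

lemma lin_swD: "h \<in> A \<Longrightarrow> (\<And>u v. u \<in> A \<Longrightarrow> v \<in> A \<Longrightarrow> lin_on X s (\<lambda>x. F x u v))
    \<Longrightarrow> lin_on X s (\<lambda>x. swsum D h (F x))"
  by (intro lin_on_fs2) (use D_keys in blast)

lemma lin_sw\<delta>: "a \<in> M \<Longrightarrow> (\<And>u v. u \<in> M \<Longrightarrow> v \<in> A \<Longrightarrow> lin_on X s (\<lambda>x. F x u v))
    \<Longrightarrow> lin_on X s (\<lambda>x. swsum \<delta> a (F x))"
  by (intro lin_on_fs2) (use \<delta>_keys in blast)

lemma lin_sw_list: "xs \<in> lists_on A n \<Longrightarrow>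
    (\<And>us vs. us \<in> lists_on A n \<Longrightarrow> vs \<in> lists_on A n \<Longrightarrow> lin_on X s (\<lambda>x. F x us vs))
    \<Longrightarrow> lin_on X s (\<lambda>x. fs2 (sw_list D xs) (F x))"
  by (intro lin_on_fs2) (use list_keys in blast)

lemma lin_D': "(\<And>v. v \<in> A \<Longrightarrow> lin_on A sA (\<lambda>u. F u v)) \<Longrightarrow> (\<And>u. u \<in> A \<Longrightarrow> lin_on A sA (\<lambda>v. F u v))
    \<Longrightarrow> lin_on A sA (\<lambda>x. swsum D x F)"
  by (intro lin_D bilin_onI)

lemma lin_\<delta>': "(\<And>v. v \<in> A \<Longrightarrow> lin_on M sM (\<lambda>u. F u v)) \<Longrightarrow> (\<And>u. u \<in> M \<Longrightarrow> lin_on A sA (\<lambda>v. F u v))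
    \<Longrightarrow> lin_on M sM (\<lambda>x. swsum \<delta> x F)"
  by (intro lin_\<delta> bilin_onI)

lemma multilin_prod:
  assumes "lin_on A sA f"
  shows "multilin_on A sA n (\<lambda>xs. f (prod xs))"
proof (rule multilin_onI)
  fix us vs assume us: "set us \<subseteq> A" and vs: "set vs \<subseteq> A"
  from us assms show "lin_on A sA (\<lambda>x. f (prod (us @ x # vs)))"
  proof (induction us arbitrary: f)
    case Nil
    then show ?case using vs lin_mul_left[of f "prod vs"] by auto
  next
    case (Cons u us)
    then show ?case using lin_mul_right[of f u] by simp
  qed
qed

text \<open>Expanding all the entries of a list simultaneously is multilinear in the list, since each single
  coproduct is linear.\<close>

lemma multilin_sw_list:
  assumes "\<And>vs. vs \<in> lists_on A n \<Longrightarrow> multilin_on A sA n (\<lambda>us. F us vs)"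
    and "\<And>us. us \<in> lists_on A n \<Longrightarrow> multilin_on A sA n (\<lambda>vs. F us vs)"
  shows "multilin_on A sA n (\<lambda>xs. fs2 (sw_list D xs) F)"
proof (rule multilin_onI)
  fix us vs :: "'a list"
  assume us: "set us \<subseteq> A" and vs: "set vs \<subseteq> A" and n: "length us + length vs + 1 = n"
  have us': "us \<in> lists_on A (length us)" and vs': "vs \<in> lists_on A (length vs)"
    using us vs by (auto simp: lists_on_def)
  show "lin_on A sA (\<lambda>x. fs2 (sw_list D (us @ x # vs)) F)"
    unfolding fs2_sw_list_append fs2_sw_list_Cons
  proof (rule lin_sw_list[OF us'], rule lin_D')
    fix u1 u2 v assume u: "u1 \<in> lists_on A (length us)" "u2 \<in> lists_on A (length us)" and v: "v \<in> A"
    show "lin_on A sA (\<lambda>x. fs2 (sw_list D vs) (\<lambda>us' vs'. F (u1 @ x # us') (u2 @ v # vs')))"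
      by (rule lin_sw_list[OF vs'], rule multilin_onD[OF assms(1)])
        (use u v n in \<open>auto simp: lists_on_def\<close>)
    show "lin_on A sA (\<lambda>x. fs2 (sw_list D vs) (\<lambda>us' vs'. F (u1 @ v # us') (u2 @ x # vs')))"
      by (rule lin_sw_list[OF vs'], rule multilin_onD[OF assms(2)])
        (use u v n in \<open>auto simp: lists_on_def\<close>)
  qed
qed

text \<open>The coproduct of a product of several factors, from its multiplicativity for two factors and for
  the unit.\<close>

lemma D_prod:
  assumes \<beta>: "bilin_on A sA A sA \<beta>" and "set xs \<subseteq> A"
  shows "swsum D (prod xs) \<beta> = fs2 (sw_list D xs) (\<lambda>us vs. \<beta> (prod us) (prod vs))"
  using assms
proof (induction xs arbitrary: \<beta>)
  case Nil then show ?case by (simp add: D_one)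
next
  case (Cons x xs)
  have x: "x \<in> A" and xs: "set xs \<subseteq> A" using Cons.prems by auto
  have "swsum D (prod (x # xs)) \<beta>
      = swsum D x (\<lambda>x1 x2. swsum D (prod xs) (\<lambda>y1 y2. \<beta> (mul x1 y1) (mul x2 y2)))"
    using Cons.prems x xs by (simp add: D_mul prod_closed)
  also have "\<dots> = swsum D x (\<lambda>x1 x2. fs2 (sw_list D xs) (\<lambda>us vs. \<beta> (mul x1 (prod us)) (mul x2 (prod vs))))"
  proof (rule swD_cong[OF x])
    fix x1 x2 assume "x1 \<in> A" "x2 \<in> A"
    then have "bilin_on A sA A sA (\<lambda>y1 y2. \<beta> (mul x1 y1) (mul x2 y2))"
      using Cons.prems(1) lin_mul_right[of "\<lambda>x. \<beta> x (mul x2 y)" x1 for y]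
        lin_mul_right[of "\<lambda>x. \<beta> (mul x1 y) x" x2 for y] mul_closed
      by (auto simp: bilin_on_def)
    from Cons.IH[OF this xs] show "swsum D (prod xs) (\<lambda>y1 y2. \<beta> (mul x1 y1) (mul x2 y2))
        = fs2 (sw_list D xs) (\<lambda>us vs. \<beta> (mul x1 (prod us)) (mul x2 (prod vs)))" .
  qed
  finally show ?case by (simp add: fs2_sw_list_Cons)
qed

text \<open>Coassociativity of the entrywise coproduct on tensor powers of \<open>A\<close>. The
  induction peels off the first entry; the functional \<open>G\<close> collects what the
  remaining entries contribute as a trilinear functional of the three parts of the first one.\<close>

lemma sw_list_coassoc:
  assumes "hs \<in> lists_on A n"
    and "\<And>v w. v \<in> lists_on A n \<Longrightarrow> w \<in> lists_on A n \<Longrightarrow> multilin_on A sA n (\<lambda>u. T u v w)"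
    and "\<And>u w. u \<in> lists_on A n \<Longrightarrow> w \<in> lists_on A n \<Longrightarrow> multilin_on A sA n (\<lambda>v. T u v w)"
    and "\<And>u v. u \<in> lists_on A n \<Longrightarrow> v \<in> lists_on A n \<Longrightarrow> multilin_on A sA n (\<lambda>w. T u v w)"
  shows "fs2 (sw_list D hs) (\<lambda>x y. fs2 (sw_list D x) (\<lambda>x1 x2. T x1 x2 y))
       = fs2 (sw_list D hs) (\<lambda>x y. fs2 (sw_list D y) (\<lambda>y1 y2. T x y1 y2))"
  using assms
proof (induction hs arbitrary: n T)
  case Nil then show ?case by simp
next
  case (Cons h hs)
  then obtain m where m: "n = Suc m" by (cases n) (auto simp: lists_on_def)
  have h: "h \<in> A" and hs: "hs \<in> lists_on A m" using Cons.prems(1) m by auto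
  note T = Cons.prems(2-4)[unfolded m]
  define G where "G u v w = fs2 (sw_list D hs) (\<lambda>x y. fs2 (sw_list D x) (\<lambda>x1 x2. T (u # x1) (v # x2) (w # y)))"
    for u v w
  have "fs2 (sw_list D (h # hs)) (\<lambda>x y. fs2 (sw_list D x) (\<lambda>x1 x2. T x1 x2 y))
      = swsum D h (\<lambda>h1 h2. swsum D h1 (\<lambda>h11 h12. G h11 h12 h2))"
    unfolding G_def fs2_sw_list_Cons by (subst (2) fs2_commute) simp
  also have "\<dots> = swsum D h (\<lambda>h1 h2. swsum D h2 (\<lambda>h21 h22. G h1 h21 h22))"
  proof (rule D_coassoc[OF trilin_onI h])
    show "lin_on A sA (\<lambda>x. G x y z)" if "y \<in> A" "z \<in> A" for y z
      unfolding G_def using that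
      by - (rule lin_sw_list[OF hs], rule lin_sw_list, assumption, rule multilin_on_hd[OF T(1)], auto)
    show "lin_on A sA (\<lambda>y. G x y z)" if "x \<in> A" "z \<in> A" for x z
      unfolding G_def using that
      by - (rule lin_sw_list[OF hs], rule lin_sw_list, assumption, rule multilin_on_hd[OF T(2)], auto)
    show "lin_on A sA (\<lambda>z. G x y z)" if "x \<in> A" "y \<in> A" for x y
      unfolding G_def using that
      by - (rule lin_sw_list[OF hs], rule lin_sw_list, assumption, rule multilin_on_hd[OF T(3)], auto)
  qed
  also have "\<dots> = swsum D h (\<lambda>h1 h2. swsum D h2 (\<lambda>h21 h22.
      fs2 (sw_list D hs) (\<lambda>x y. fs2 (sw_list D y) (\<lambda>y1 y2. T (h1 # x) (h21 # y1) (h22 # y2)))))"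
    unfolding G_def
  proof (intro swD_cong h)
    fix h1 h2 h21 h22 assume "h1 \<in> A" "h2 \<in> A" and a: "h21 \<in> A" "h22 \<in> A"
    show "fs2 (sw_list D hs) (\<lambda>x y. fs2 (sw_list D x) (\<lambda>x1 x2. T (h1 # x1) (h21 # x2) (h22 # y)))
      = fs2 (sw_list D hs) (\<lambda>x y. fs2 (sw_list D y) (\<lambda>y1 y2. T (h1 # x) (h21 # y1) (h22 # y2)))"
      by (rule Cons.IH[OF hs]; rule multilin_on_Cons; (rule T)?)
        (use \<open>h1 \<in> A\<close> a in auto)
  qed auto
  also have "\<dots> = fs2 (sw_list D (h # hs)) (\<lambda>x y. fs2 (sw_list D y) (\<lambda>y1 y2. T x y1 y2))"
    unfolding fs2_sw_list_Cons by (subst (2) fs2_commute) simp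
  finally show ?case .
qed

text \<open>How the Yetter-Drinfeld condition enters the commutation relations. Both sides are regrouped by
  coassociativity as \<open>c(h_(1))\<close> times an expression in \<open>h_(2)\<close> and
  \<open>h_(3)\<close>, and the Yetter-Drinfeld condition is applied to those two legs: acting
  with \<open>h_(3)\<close> and then coacting is traded for coacting first.\<close>

lemma yd_core:
  assumes f: "lin_on A sA f" and c: "lin_on A sA c" and g: "lin_on M sM g" and h: "h \<in> A" and a: "a \<in> M"
  shows "swsum D h (\<lambda>h1 h2. swsum \<delta> a (\<lambda>a0 a1. swsum D h1 (\<lambda>x y. c x * (f (mul h2 a1) * g (act y a0)))))
    = swsum D h (\<lambda>x y. swsum D x (\<lambda>x1 x2. swsum \<delta> (act y a) (\<lambda>m0 m1. c x1 * (f (mul m1 x2) * g m0))))"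
proof -
  have "swsum D h (\<lambda>h1 h2. swsum \<delta> a (\<lambda>a0 a1. swsum D h1 (\<lambda>x y. c x * (f (mul h2 a1) * g (act y a0)))))
    = swsum D h (\<lambda>h1 h2. swsum D h1 (\<lambda>x y. swsum \<delta> a (\<lambda>a0 a1. c x * (f (mul h2 a1) * g (act y a0)))))"
    by (subst (2) fs2_commute) (rule refl)
  also have "\<dots> = swsum D h (\<lambda>x h2. swsum D h2 (\<lambda>y1 y2. swsum \<delta> a (\<lambda>a0 a1. c x * (f (mul y2 a1) * g (act y1 a0)))))"
    by (rule D_coassoc[OF trilin_onI h]; rule lin_sw\<delta>[OF a])
      (auto intro!: lin_on_mult_left lin_on_mult_right c lin_act_left[OF g] lin_mul_left[OF f])
  also have "\<dots> = swsum D h (\<lambda>x h2. swsum D h2 (\<lambda>y1 y2. swsum \<delta> (act y2 a) (\<lambda>m0 m1. c x * (f (mul m1 y1) * g m0))))"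
  proof (rule swD_cong[OF h])
    fix x h2 assume "x \<in> A" and h2: "h2 \<in> A"
    have "bilin_on M sM A sA (\<lambda>m0 m1. c x * (f m1 * g m0))"
      by (intro bilin_onI lin_on_mult_left lin_on_mult_right f g)
    from yd[OF this h2 a]
    show "swsum D h2 (\<lambda>y1 y2. swsum \<delta> a (\<lambda>a0 a1. c x * (f (mul y2 a1) * g (act y1 a0))))
      = swsum D h2 (\<lambda>y1 y2. swsum \<delta> (act y2 a) (\<lambda>m0 m1. c x * (f (mul m1 y1) * g m0)))" ..
  qed
  also have "\<dots> = swsum D h (\<lambda>h1 h2. swsum D h1 (\<lambda>x1 x2. swsum \<delta> (act h2 a) (\<lambda>m0 m1. c x1 * (f (mul m1 x2) * g m0))))"
  proof (rule D_coassoc[OF trilin_onI h, symmetric])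
    show "lin_on A sA (\<lambda>x. swsum \<delta> (act z a) (\<lambda>m0 m1. c x * (f (mul m1 y) * g m0)))" if "z \<in> A" for y z
      by (rule lin_sw\<delta>) (auto intro!: lin_on_mult_right c act_closed a that)
    show "lin_on A sA (\<lambda>y. swsum \<delta> (act z a) (\<lambda>m0 m1. c x * (f (mul m1 y) * g m0)))" if "z \<in> A" for x z
      by (rule lin_sw\<delta>) (auto intro!: lin_on_mult_left lin_on_mult_right act_closed a that lin_mul_right[OF f])
    show "lin_on A sA (\<lambda>z. swsum \<delta> (act z a) (\<lambda>m0 m1. c x * (f (mul m1 y) * g m0)))" if "y \<in> A" for x y
      by (rule lin_act_left[OF lin_\<delta>' a])
        (auto intro!: lin_on_mult_left lin_on_mult_right g lin_mul_left[OF f] that)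
  qed
  finally show ?thesis .
qed

end

section \<open>The bar differential\<close>

text \<open>The transpose of the bar differential. The recursion on the first entry replaces the alternating
  sum over positions: multiplying two later entries is the same operation on the tail with the
  opposite sign.\<close>

fun bar :: "('a \<Rightarrow> 'a \<Rightarrow> 'a) \<Rightarrow> ('a list \<Rightarrow> 'k::field) \<Rightarrow> 'a list \<Rightarrow> 'k" where
  "bar m f (x # y # zs) = - f (m x y # zs) - bar m (\<lambda>ws. f (x # ws)) (y # zs)"
| "bar m f [] = 0"
| "bar m f [x] = 0"

text \<open>The bar differential acting on two lists at once, multiplying in both lists at the same
  positions. It is what the bar differential becomes after an entrywise coproduct.\<close>

fun bar2 :: "('a \<Rightarrow> 'a \<Rightarrow> 'a) \<Rightarrow> ('a list \<Rightarrow> 'a list \<Rightarrow> 'k::field) \<Rightarrow> 'a list \<Rightarrow> 'a list \<Rightarrow> 'k" where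
  "bar2 m F (x # x' # us) (y # y' # vs)
     = - F (m x x' # us) (m y y' # vs) - bar2 m (\<lambda>u v. F (x # u) (y # v)) (x' # us) (y' # vs)"
| "bar2 m F _ _ = 0"

lemma bar_add: "bar m (\<lambda>ws. f ws + g ws) xs = bar m f xs + bar m g xs"
  by (induction m f xs arbitrary: g rule: bar.induct) auto

lemma bar_mult: "bar m (\<lambda>ws. c * f ws) xs = c * bar m f xs"
  by (induction m f xs rule: bar.induct) (auto simp: algebra_simps)

lemma bar_zero [simp]: "bar m (\<lambda>ws. 0) xs = 0"
  using bar_mult[of m 0 "\<lambda>ws. 0" xs] by simp

lemma bar_uminus: "bar m (\<lambda>ws. - f ws) xs = - bar m f xs"
  using bar_mult[of m "-1" f xs] by simp

lemma bar_diff: "bar m (\<lambda>ws. f ws - g ws) xs = bar m f xs - bar m g xs"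
  using bar_add[of m f "\<lambda>ws. - g ws" xs] by (simp add: bar_uminus)

lemma bar_sum: "bar m (\<lambda>ws. \<Sum>i\<in>I. f i ws) xs = (\<Sum>i\<in>I. bar m (f i) xs)"
  by (induction I rule: infinite_finite_induct) (auto simp: bar_add)

lemma bar_fs2: "bar m (\<lambda>ws. fs2 p (F ws)) xs = fs2 p (\<lambda>u v. bar m (\<lambda>ws. F ws u v) xs)"
  by (simp add: fs2_sum_keys bar_sum bar_mult case_prod_beta)

lemma bar_cong:
  "(\<And>w ws. f (w # ws) = g (w # ws)) \<Longrightarrow> bar m f xs = bar m g xs"
proof (induction m f xs arbitrary: g rule: bar.induct)
  case (1 m f x y zs)
  show ?case using 1(1)[of "\<lambda>ws. g (x # ws)"] 1(2) by simp
qed auto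

text \<open>For use with \<open>\<pi>^H\<close>, which consumes the last entry: the summand that multiplies
  the last two entries behaves differently from those that leave the last entry alone.\<close>

lemma bar_snoc:
  "bar m f (xs @ [y, z])
     = bar m (\<lambda>ws. f (ws @ [z])) (xs @ [y]) + (- 1) ^ Suc (length xs) * f (xs @ [m y z])"
proof (induction xs arbitrary: f)
  case Nil then show ?case by simp
next
  case (Cons x xs)
  show ?case
  proof (cases xs)
    case Nil then show ?thesis by simp
  next
    case [simp]: (Cons x' xs')
    show ?thesis using Cons.IH[of "\<lambda>ws. f (x # ws)"] by simp
  qed
qed

lemma bar_commute:
  "bar m (\<lambda>xs. bar m' (\<lambda>ys. F xs ys) vs) us = bar m' (\<lambda>ys. bar m (\<lambda>xs. F xs ys) us) vs"
  by (induction m "\<lambda>xs. bar m' (\<lambda>ys. F xs ys) vs" us arbitrary: F rule: bar.induct)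
    (simp_all add: bar_diff bar_uminus)

context yd_on
begin

text \<open>Induction on the list: the terms that only touch the tail cancel by the induction hypothesis,
  and the terms involving the first entry cancel by associativity.\<close>

lemma bar_bar: "set xs \<subseteq> A \<Longrightarrow> bar mul (bar mul f) xs = 0"
proof (induction xs arbitrary: f)
  case Nil then show ?case by simp
next
  case (Cons x ys)
  show ?case
  proof (cases ys)
    case Nil then show ?thesis by simp
  next
    case ys: (Cons y zs)
    have "bar mul (\<lambda>ws. bar mul f (x # ws)) ys
        = bar mul (\<lambda>ws. - f (mul x (hd ws) # tl ws) - bar mul (\<lambda>v. f (x # v)) ws) ys"
      by (rule bar_cong) simp
    also have "\<dots> = - bar mul (\<lambda>ws. f (mul x (hd ws) # tl ws)) ys"
      using Cons.IH[of "\<lambda>v. f (x # v)"] Cons.prems by (simp add: bar_diff bar_uminus)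
    also have "bar mul (\<lambda>ws. f (mul x (hd ws) # tl ws)) ys = bar mul f (mul x y # zs)"
      using Cons.prems ys by (cases zs) (auto simp: mul_assoc)
    finally show ?thesis by (simp add: ys)
  qed
qed

lemma lin_bar:
  assumes "\<And>ws. ws \<in> lists_on A n \<Longrightarrow> lin_on X s (\<lambda>x. F x ws)" "xs \<in> lists_on A (Suc n)"
  shows "lin_on X s (\<lambda>x. bar mul (F x) xs)"
  using assms
proof (induction xs arbitrary: F n)
  case (Cons x ys)
  show ?case
  proof (cases ys)
    case ys: (Cons y zs)
    then obtain m where m: "n = Suc m" using Cons.prems(2) by (cases n) (auto simp: lists_on_def)
    have mem: "x \<in> A" "y \<in> A" "zs \<in> lists_on A m" using Cons.prems(2) ys m by auto
    have "lin_on X s (\<lambda>z. bar mul (\<lambda>ws. F z (x # ws)) ys)"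
      by (rule Cons.IH) (use mem ys m in \<open>auto intro: Cons.prems(1)\<close>)
    moreover have "lin_on X s (\<lambda>z. F z (mul x y # zs))"
      by (rule Cons.prems(1)) (use mem m in \<open>auto intro: mul_closed\<close>)
    ultimately show ?thesis
      unfolding ys by (simp add: lin_on_diff lin_on_uminus)
  qed (simp add: lin_on_zero)
qed (simp add: lin_on_zero)

lemma multilin_bar:
  assumes "multilin_on A sA n f"
  shows "multilin_on A sA (Suc n) (bar mul f)"
proof (rule multilin_onI)
  fix us vs assume "set us \<subseteq> A" "set vs \<subseteq> A" "length us + length vs + 1 = Suc n"
  then show "lin_on A sA (\<lambda>x. bar mul f (us @ x # vs))"
    using assms
  proof (induction us arbitrary: f n)
    case Nil
    show ?case
    proof (cases vs)
      case vs: (Cons v ws)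
      then obtain m where m: "n = Suc m" and mem: "v \<in> A" "ws \<in> lists_on A m"
        using Nil by (cases n) (auto simp: lists_on_def)
      have f: "multilin_on A sA (Suc m) f" using Nil m by simp
      have "lin_on A sA (\<lambda>x. f (mul x v # ws))"
        by (rule lin_mul_left[OF multilin_on_hd[OF f]]) (use mem in auto)
      moreover have "lin_on A sA (\<lambda>x. bar mul (\<lambda>ws. f (x # ws)) vs)"
        by (rule lin_bar[OF multilin_on_hd[OF f]]) (use mem vs in auto)
      ultimately show ?thesis
        unfolding vs by (simp add: lin_on_diff lin_on_uminus)
    qed (simp add: lin_on_zero)
  next
    case (Cons u us)
    then obtain m where m: "n = Suc m" and u: "u \<in> A" by (cases n) auto
    have f: "multilin_on A sA (Suc m) f" using Cons m by simp
    have 1: "lin_on A sA (\<lambda>x. bar mul (\<lambda>ws. f (u # ws)) (us @ x # vs))"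
      by (rule Cons.IH[OF _ _ _ multilin_on_Cons[OF f u]]) (use Cons.prems m in auto)
    show ?case
    proof (cases us)
      case us: Nil
      have "lin_on A sA (\<lambda>x. f (mul u x # vs))"
        by (rule lin_mul_right[OF multilin_on_hd[OF f] u]) (use Cons.prems m us in \<open>auto simp: lists_on_def\<close>)
      with 1 show ?thesis by (simp add: us lin_on_diff lin_on_uminus)
    next
      case us: (Cons u' us')
      have "lin_on A sA (\<lambda>x. f ((mul u u' # us') @ x # vs))"
        by (rule multilin_onD[OF f]) (use Cons.prems m us in \<open>auto intro: mul_closed\<close>)
      with 1 show ?thesis by (simp add: us lin_on_diff lin_on_uminus)
    qed
  qed
qed

text \<open>Since the coproduct is multiplicative, merging two entries before the entrywise coproduct is
  merging both pairs of entries after it.\<close>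

lemma bar_sw_list:
  assumes "xs \<in> lists_on A (Suc n)"
    and "\<And>vs. vs \<in> lists_on A n \<Longrightarrow> multilin_on A sA n (\<lambda>us. F us vs)"
    and "\<And>us. us \<in> lists_on A n \<Longrightarrow> multilin_on A sA n (\<lambda>vs. F us vs)"
  shows "bar mul (\<lambda>ws. fs2 (sw_list D ws) F) xs = fs2 (sw_list D xs) (bar2 mul F)"
  using assms
proof (induction xs arbitrary: F n)
  case Nil then show ?case by simp
next
  case (Cons x ys)
  show ?case
  proof (cases ys)
    case Nil then show ?thesis by (simp add: fs2_sw_list_Cons)
  next
    case ys: (Cons y zs)
    then obtain m where m: "n = Suc m" using Cons.prems(1) by (cases n) (auto simp: lists_on_def)
    have mem: "x \<in> A" "y \<in> A" "zs \<in> lists_on A m" using Cons.prems(1) ys m by auto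
    note F = Cons.prems(2-3)[unfolded m]
    have 1: "fs2 (sw_list D (mul x y # zs)) F
      = swsum D x (\<lambda>x1 x2. swsum D y (\<lambda>y1 y2.
          fs2 (sw_list D zs) (\<lambda>us vs. F (mul x1 y1 # us) (mul x2 y2 # vs))))"
      unfolding fs2_sw_list_Cons
    proof (rule D_mul[OF bilin_onI])
      show "lin_on A sA (\<lambda>u. fs2 (sw_list D zs) (\<lambda>us vs. F (u # us) (v # vs)))" if "v \<in> A" for v
        by (rule lin_sw_list[OF mem(3)], rule multilin_on_hd[OF F(1)]) (use that in auto)
      show "lin_on A sA (\<lambda>u. fs2 (sw_list D zs) (\<lambda>us vs. F (v # us) (u # vs)))" if "v \<in> A" for v
        by (rule lin_sw_list[OF mem(3)], rule multilin_on_hd[OF F(2)]) (use that in auto)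
    qed (use mem in auto)
    have "bar mul (\<lambda>ws. fs2 (sw_list D (x # ws)) F) ys
      = swsum D x (\<lambda>x1 x2. bar mul (\<lambda>ws. fs2 (sw_list D ws) (\<lambda>us vs. F (x1 # us) (x2 # vs))) ys)"
      unfolding fs2_sw_list_Cons by (simp add: bar_fs2)
    also have "\<dots> = swsum D x (\<lambda>x1 x2. fs2 (sw_list D ys) (bar2 mul (\<lambda>us vs. F (x1 # us) (x2 # vs))))"
      by (intro swD_cong mem Cons.IH[of m] multilin_on_Cons[OF F(1)] multilin_on_Cons[OF F(2)])
        (use mem ys in auto)
    finally have 2: "bar mul (\<lambda>ws. fs2 (sw_list D (x # ws)) F) ys
      = swsum D x (\<lambda>x1 x2. fs2 (sw_list D ys) (bar2 mul (\<lambda>us vs. F (x1 # us) (x2 # vs))))" .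
    show ?thesis
      using 1 2 by (simp add: ys fs2_sw_list_Cons fs2_diff fs2_uminus)
  qed
qed

text \<open>If the second list enters only through the product of its entries, merging entries there has no
  effect, so that the simultaneous differential is the bar differential in the first list.\<close>

lemma bar2_prod_right:
  "length us = length vs \<Longrightarrow> set vs \<subseteq> A \<Longrightarrow>
     bar2 mul (\<lambda>u v. G u (prod v)) us vs = bar mul (\<lambda>u. G u (prod vs)) us"
proof (induction us arbitrary: vs G)
  case (Cons x us)
  then obtain y ws where vs: "vs = y # ws" by (cases vs) auto
  show ?case
  proof (cases us)
    case us: (Cons x' us')
    then obtain y' ws' where ws: "ws = y' # ws'" using Cons.prems vs by (cases ws) auto
    show ?thesis
      using Cons.IH[of ws "\<lambda>u p. G (x # u) (mul y p)"] Cons.prems us vs ws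
      by (simp add: mul_assoc prod_closed)
  qed (simp add: vs)
qed simp

lemma bar2_prod_left:
  "length us = length vs \<Longrightarrow> set us \<subseteq> A \<Longrightarrow>
     bar2 mul (\<lambda>u v. G (prod u) v) us vs = bar mul (\<lambda>v. G (prod us) v) vs"
proof (induction us arbitrary: vs G)
  case (Cons x us)
  then obtain y ws where vs: "vs = y # ws" by (cases vs) auto
  show ?case
  proof (cases us)
    case us: (Cons x' us')
    then obtain y' ws' where ws: "ws = y' # ws'" using Cons.prems vs by (cases ws) auto
    show ?thesis
      using Cons.IH[of ws "\<lambda>p v. G (mul x p) (y # v)"] Cons.prems us vs ws
      by (simp add: mul_assoc prod_closed)
  qed (use Cons.prems vs in simp)
qed simp

lemma bar_cong_on:
  assumes "\<And>ws. ws \<in> lists_on A n \<Longrightarrow> f ws = g ws" "xs \<in> lists_on A (Suc n)"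
  shows "bar mul f xs = bar mul g xs"
  using assms
proof (induction xs arbitrary: f g n)
  case (Cons x ys)
  show ?case
  proof (cases ys)
    case ys: (Cons y zs)
    then obtain m where m: "n = Suc m" using Cons.prems(2) by (cases n) (auto simp: lists_on_def)
    have mem: "x \<in> A" "y \<in> A" "zs \<in> lists_on A m" using Cons.prems(2) ys m by auto
    have "bar mul (\<lambda>ws. f (x # ws)) ys = bar mul (\<lambda>ws. g (x # ws)) ys"
      by (rule Cons.IH) (use mem ys m in \<open>auto intro: Cons.prems(1)\<close>)
    moreover have "f (mul x y # zs) = g (mul x y # zs)"
      by (rule Cons.prems(1)) (use mem m in \<open>auto intro: mul_closed\<close>)
    ultimately show ?thesis
      unfolding ys by simp
  qed simp
qed simp

end

section \<open>Two Yetter-Drinfeld modules in duality\<close>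

text \<open>Two structures of the same kind in duality. The pairing follows the rainbow convention, in which
  both dual operations reverse the order; therefore the two sides enter symmetrically, and
  exchanging them is again an instance of this locale. Every statement proved below thus has a
  mirror image, under which bar differential and cobar differential, \<open>\<pi>^H\<close> and
  \<open>\<pi>^{H*}\<close>, \<open>{}^H\<pi>\<close> and \<open>{}^{H*}\<pi>\<close> are
  exchanged.\<close>

locale yd_pair =
  A: yd_on A sA mulA oneA DA M sM actM \<delta>M + B: yd_on B sB mulB oneB DB N sN actN \<delta>N
  for A :: "'a::ab_group_add set" and sA :: "'k::field \<Rightarrow> 'a \<Rightarrow> 'a" and mulA oneA DA
    and M :: "'m::ab_group_add set" and sM actM \<delta>M
    and B :: "'b::ab_group_add set" and sB :: "'k::field \<Rightarrow> 'b \<Rightarrow> 'b" and mulB oneB DB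
    and N :: "'n::ab_group_add set" and sN actN \<delta>N +
  fixes pr :: "'b \<Rightarrow> 'a \<Rightarrow> 'k"
  assumes pr_lin_A: "l \<in> B \<Longrightarrow> lin_on A sA (\<lambda>h. pr l h)"
    and pr_lin_B: "h \<in> A \<Longrightarrow> lin_on B sB (\<lambda>l. pr l h)"
    and pr_mul_B: "l \<in> B \<Longrightarrow> l' \<in> B \<Longrightarrow> h \<in> A \<Longrightarrow>
        pr (mulB l l') h = swsum DA h (\<lambda>h1 h2. pr l h2 * pr l' h1)"
    and pr_mul_A: "l \<in> B \<Longrightarrow> h \<in> A \<Longrightarrow> h' \<in> A \<Longrightarrow>
        pr l (mulA h h') = swsum DB l (\<lambda>l1 l2. pr l1 h' * pr l2 h)"
begin

lemma flip: "yd_pair B sB mulB oneB DB N sN actN \<delta>N A sA mulA oneA DA M sM actM \<delta>M (\<lambda>h l. pr l h)"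
  by (intro yd_pair.intro B.yd_on_axioms A.yd_on_axioms yd_pair_axioms.intro)
    (simp_all add: pr_lin_A pr_lin_B pr_mul_A pr_mul_B mult.commute)

text \<open>The functionals on \<open>A^n \<otimes> M \<otimes> B^m \<otimes> N\<close>, with the powers
  meaning tensor powers.\<close>

definition multilin :: "nat \<Rightarrow> nat \<Rightarrow> ('a list \<Rightarrow> 'm \<Rightarrow> 'b list \<Rightarrow> 'n \<Rightarrow> 'k) \<Rightarrow> bool" where
  "multilin n m \<Phi> \<longleftrightarrow>
     (\<forall>a\<in>M. \<forall>ls\<in>lists_on B m. \<forall>b\<in>N. multilin_on A sA n (\<lambda>hs. \<Phi> hs a ls b)) \<and>
     (\<forall>hs\<in>lists_on A n. \<forall>ls\<in>lists_on B m. \<forall>b\<in>N. lin_on M sM (\<lambda>a. \<Phi> hs a ls b)) \<and>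
     (\<forall>hs\<in>lists_on A n. \<forall>a\<in>M. \<forall>b\<in>N. multilin_on B sB m (\<lambda>ls. \<Phi> hs a ls b)) \<and>
     (\<forall>hs\<in>lists_on A n. \<forall>a\<in>M. \<forall>ls\<in>lists_on B m. lin_on N sN (\<lambda>b. \<Phi> hs a ls b))"

lemma multilin_hs: "multilin n m \<Phi> \<Longrightarrow> a \<in> M \<Longrightarrow> ls \<in> lists_on B m \<Longrightarrow> b \<in> N \<Longrightarrow> multilin_on A sA n (\<lambda>hs. \<Phi> hs a ls b)"
  and multilin_a: "multilin n m \<Phi> \<Longrightarrow> hs \<in> lists_on A n \<Longrightarrow> ls \<in> lists_on B m \<Longrightarrow> b \<in> N \<Longrightarrow> lin_on M sM (\<lambda>a. \<Phi> hs a ls b)"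
  and multilin_ls: "multilin n m \<Phi> \<Longrightarrow> hs \<in> lists_on A n \<Longrightarrow> a \<in> M \<Longrightarrow> b \<in> N \<Longrightarrow> multilin_on B sB m (\<lambda>ls. \<Phi> hs a ls b)"
  and multilin_b: "multilin n m \<Phi> \<Longrightarrow> hs \<in> lists_on A n \<Longrightarrow> a \<in> M \<Longrightarrow> ls \<in> lists_on B m \<Longrightarrow> lin_on N sN (\<lambda>b. \<Phi> hs a ls b)"
  by (auto simp: multilin_def)

text \<open>The maps of the complex act on functionals by transposition. The transposes of
  \<open>d_bar\<close>, \<open>(-1)^n \<pi>^H\<close> and \<open>{}^H\<pi>\<close> follow; the
  sign is part of the second one, so that sign bookkeeping is confined to the identities that
  involve it. The transpose of a composite is the composite of the transposes in the opposite
  order, which is harmless since all the relations to be proved are symmetric.\<close>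

definition tr_bar :: "('a list \<Rightarrow> 'm \<Rightarrow> 'b list \<Rightarrow> 'n \<Rightarrow> 'k) \<Rightarrow> 'a list \<Rightarrow> 'm \<Rightarrow> 'b list \<Rightarrow> 'n \<Rightarrow> 'k" where
  "tr_bar \<Phi> hs a ls b = bar mulA (\<lambda>xs. \<Phi> xs a ls b) hs"

definition tr_piH :: "('a list \<Rightarrow> 'm \<Rightarrow> 'b list \<Rightarrow> 'n \<Rightarrow> 'k) \<Rightarrow> 'a list \<Rightarrow> 'm \<Rightarrow> 'b list \<Rightarrow> 'n \<Rightarrow> 'k" where
  "tr_piH \<Phi> hs a ls b = (if hs = [] then 0 else (- 1) ^ length hs *
     fs2 (sw_list DB ls) (\<lambda>p q. swsum DA (last hs) (\<lambda>x y.
       pr (B.prod p) x * \<Phi> (butlast hs) (actM y a) q b)))"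

definition tr_Hpi :: "('a list \<Rightarrow> 'm \<Rightarrow> 'b list \<Rightarrow> 'n \<Rightarrow> 'k) \<Rightarrow> 'a list \<Rightarrow> 'm \<Rightarrow> 'b list \<Rightarrow> 'n \<Rightarrow> 'k" where
  "tr_Hpi \<Phi> hs a ls b = (if hs = [] then 0 else
     fs2 (sw_list DB ls) (\<lambda>p q. swsum \<delta>N b (\<lambda>b0 b1.
       pr (B.prod (q @ [b1])) (hd hs) * \<Phi> (tl hs) a p b0)))"

lemma tr_piH_Nil [simp]: "tr_piH \<Phi> [] a ls b = 0"
  and tr_Hpi_Nil [simp]: "tr_Hpi \<Phi> [] a ls b = 0"
  by (simp_all add: tr_piH_def tr_Hpi_def)

lemma tr_piH_snoc: "tr_piH \<Phi> (hs @ [h]) a ls b = (- 1) ^ Suc (length hs) *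
     fs2 (sw_list DB ls) (\<lambda>p q. swsum DA h (\<lambda>x y. pr (B.prod p) x * \<Phi> hs (actM y a) q b))"
  by (simp add: tr_piH_def)

lemma tr_Hpi_Cons: "tr_Hpi \<Phi> (h # hs) a ls b =
     fs2 (sw_list DB ls) (\<lambda>p q. swsum \<delta>N b (\<lambda>b0 b1. pr (B.prod (q @ [b1])) h * \<Phi> hs a p b0))"
  by (simp add: tr_Hpi_def)

lemma lin_pr_mult: "l \<in> B \<Longrightarrow> lin_on A sA (\<lambda>h. pr l h * c)"
  by (rule lin_on_mult_right[OF pr_lin_A])

lemma multilin_pr_prod: "h \<in> A \<Longrightarrow> multilin_on B sB m (\<lambda>ls. pr (B.prod ls) h)"
  by (rule B.multilin_prod[OF pr_lin_B])

lemma multilin_pr_prod_snoc: "h \<in> A \<Longrightarrow> l \<in> B \<Longrightarrow> multilin_on B sB m (\<lambda>ls. pr (B.prod (ls @ [l])) h)"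
  by (rule multilin_on_snoc[OF multilin_pr_prod])

lemma lin_pr_prod_last:
  "h \<in> A \<Longrightarrow> ls \<in> lists_on B m \<Longrightarrow> lin_on B sB (\<lambda>l. pr (B.prod (ls @ [l])) h)"
  using multilin_on_last[OF multilin_pr_prod] by blast

text \<open>Pairing a product of \<open>B\<close> with a product of two elements of \<open>A\<close> splits
  every factor by its coproduct.\<close>

lemma pr_prod_mul_A:
  assumes "ls \<in> lists_on B m" "h \<in> A" "h' \<in> A"
  shows "pr (B.prod ls) (mulA h h') = fs2 (sw_list DB ls) (\<lambda>p q. pr (B.prod p) h' * pr (B.prod q) h)"
proof -
  have ls: "set ls \<subseteq> B" using assms(1) by (auto simp: lists_on_def)
  have "bilin_on B sB B sB (\<lambda>l1 l2. pr l1 h' * pr l2 h)"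
    using assms by (intro bilin_onI lin_on_mult_left lin_on_mult_right pr_lin_B)
  from B.D_prod[OF this ls] show ?thesis
    using assms ls by (simp add: pr_mul_A B.prod_closed)
qed

lemma multilin_tr_bar:
  assumes \<Phi>: "multilin n m \<Phi>"
  shows "multilin (Suc n) m (tr_bar \<Phi>)"
  unfolding multilin_def tr_bar_def
proof (intro conjI ballI)
  show "multilin_on A sA (Suc n) (\<lambda>hs. bar mulA (\<lambda>xs. \<Phi> xs a ls b) hs)"
    if "a \<in> M" "ls \<in> lists_on B m" "b \<in> N" for a ls b
    by (rule A.multilin_bar[OF multilin_hs[OF \<Phi> that]])
  show "lin_on M sM (\<lambda>a. bar mulA (\<lambda>xs. \<Phi> xs a ls b) hs)"
    if "hs \<in> lists_on A (Suc n)" "ls \<in> lists_on B m" "b \<in> N" for hs ls b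
    by (rule A.lin_bar[OF multilin_a[OF \<Phi>]]) (use that in auto)
  show "multilin_on B sB m (\<lambda>ls. bar mulA (\<lambda>xs. \<Phi> xs a ls b) hs)"
    if "hs \<in> lists_on A (Suc n)" "a \<in> M" "b \<in> N" for hs a b
    by (rule multilin_onI, rule A.lin_bar, rule multilin_onD[OF multilin_ls[OF \<Phi>]]) (use that in auto)
  show "lin_on N sN (\<lambda>b. bar mulA (\<lambda>xs. \<Phi> xs a ls b) hs)"
    if "hs \<in> lists_on A (Suc n)" "a \<in> M" "ls \<in> lists_on B m" for hs a ls
    by (rule A.lin_bar[OF multilin_b[OF \<Phi>]]) (use that in auto)
qed

lemma multilin_tr_piH:
  assumes \<Phi>: "multilin n m \<Phi>"
  shows "multilin (Suc n) m (tr_piH \<Phi>)"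
  unfolding multilin_def
proof (intro conjI ballI)
  fix a ls b assume that: "a \<in> M" "ls \<in> lists_on B m" "b \<in> N"
  show "multilin_on A sA (Suc n) (\<lambda>hs. tr_piH \<Phi> hs a ls b)"
  proof (rule multilin_onI)
    fix us vs assume us: "set us \<subseteq> A" "set vs \<subseteq> A" "length us + length vs + 1 = Suc n"
    show "lin_on A sA (\<lambda>x. tr_piH \<Phi> (us @ x # vs) a ls b)"
    proof (cases vs rule: rev_cases)
      case Nil
      have us': "us \<in> lists_on A n" using us Nil by (auto simp: lists_on_def)
      show ?thesis
        unfolding Nil tr_piH_snoc
        by (intro lin_on_mult_left, rule B.lin_sw_list[OF that(2)], rule A.lin_D',
            rule lin_pr_mult, erule B.prod_lists_on,
            rule lin_on_mult_left, rule A.lin_act_left[OF multilin_a[OF \<Phi> us']])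
          (use that in \<open>auto intro: A.act_closed\<close>)
    next
      case (snoc ws w)
      then have w: "w \<in> A" using us by auto
      have "lin_on A sA (\<lambda>x. tr_piH \<Phi> ((us @ x # ws) @ [w]) a ls b)"
        unfolding tr_piH_snoc length_append list.size
        by (intro lin_on_mult_left, rule B.lin_sw_list[OF that(2)], rule A.lin_swD[OF w],
            rule lin_on_mult_left, rule multilin_onD[OF multilin_hs[OF \<Phi>]])
          (use that us snoc in \<open>auto intro: A.act_closed\<close>)
      then show ?thesis by (simp add: snoc)
    qed
  qed
next
  fix hs ls b assume that: "hs \<in> lists_on A (Suc n)" "ls \<in> lists_on B m" "b \<in> N"
  then obtain us h where [simp]: "hs = us @ [h]" and mem: "us \<in> lists_on A n" "h \<in> A"
    by (elim lists_on_SucE)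
  show "lin_on M sM (\<lambda>a. tr_piH \<Phi> hs a ls b)"
    unfolding \<open>hs = us @ [h]\<close> tr_piH_snoc
    by (intro lin_on_mult_left, rule B.lin_sw_list[OF that(2)], rule A.lin_swD[OF mem(2)],
        rule lin_on_mult_left, rule A.lin_act_right[OF multilin_a[OF \<Phi> mem(1)]])
      (use that in auto)
next
  fix hs a b assume that: "hs \<in> lists_on A (Suc n)" "a \<in> M" "b \<in> N"
  then obtain us h where [simp]: "hs = us @ [h]" and mem: "us \<in> lists_on A n" "h \<in> A"
    by (elim lists_on_SucE)
  have *: "multilin_on B sB m (\<lambda>ls. fs2 (sw_list DB ls) (\<lambda>p q. swsum DA h (\<lambda>x y. pr (B.prod p) x * \<Phi> us (actM y a) q b)))"
  proof (rule B.multilin_sw_list)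
    show "multilin_on B sB m (\<lambda>p. swsum DA h (\<lambda>x y. pr (B.prod p) x * \<Phi> us (actM y a) q b))" for q
      by (intro multilin_on_fs2 multilin_on_mult_right multilin_pr_prod) (use A.D_keys mem in blast)
    show "multilin_on B sB m (\<lambda>q. swsum DA h (\<lambda>x y. pr (B.prod p) x * \<Phi> us (actM y a) q b))" for p
      by (intro multilin_on_fs2 multilin_on_mult_left multilin_ls[OF \<Phi> mem(1)] that A.act_closed)
        (use A.D_keys mem in blast)
  qed
  show "multilin_on B sB m (\<lambda>ls. tr_piH \<Phi> hs a ls b)"
    unfolding \<open>hs = us @ [h]\<close> tr_piH_snoc by (rule multilin_on_mult_left[OF *])
next
  fix hs a ls assume that: "hs \<in> lists_on A (Suc n)" "a \<in> M" "ls \<in> lists_on B m"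
  then obtain us h where [simp]: "hs = us @ [h]" and mem: "us \<in> lists_on A n" "h \<in> A"
    by (elim lists_on_SucE)
  show "lin_on N sN (\<lambda>b. tr_piH \<Phi> hs a ls b)"
    unfolding \<open>hs = us @ [h]\<close> tr_piH_snoc
    by (intro lin_on_mult_left, rule B.lin_sw_list[OF that(3)], rule A.lin_swD[OF mem(2)],
        rule lin_on_mult_left, rule multilin_b[OF \<Phi> mem(1)])
      (use that in \<open>auto intro: A.act_closed\<close>)
qed

lemma multilin_tr_Hpi:
  assumes \<Phi>: "multilin n m \<Phi>"
  shows "multilin (Suc n) m (tr_Hpi \<Phi>)"
  unfolding multilin_def
proof (intro conjI ballI)
  fix a ls b assume that: "a \<in> M" "ls \<in> lists_on B m" "b \<in> N"
  show "multilin_on A sA (Suc n) (\<lambda>hs. tr_Hpi \<Phi> hs a ls b)"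
  proof (rule multilin_onI)
    fix us vs assume us: "set us \<subseteq> A" "set vs \<subseteq> A" "length us + length vs + 1 = Suc n"
    show "lin_on A sA (\<lambda>x. tr_Hpi \<Phi> (us @ x # vs) a ls b)"
    proof (cases us)
      case Nil
      show ?thesis
        unfolding Nil append_Nil tr_Hpi_Cons
        by (rule B.lin_sw_list[OF that(2)], rule B.lin_sw\<delta>[OF that(3)], rule lin_pr_mult, rule B.prod_closed)
          (auto simp: lists_on_def)
    next
      case (Cons w ws)
      show ?thesis
        unfolding Cons append_Cons tr_Hpi_Cons
        by (rule B.lin_sw_list[OF that(2)], rule B.lin_sw\<delta>[OF that(3)],
            rule lin_on_mult_left, rule multilin_onD[OF multilin_hs[OF \<Phi>]])
          (use that us Cons in auto)
    qed
  qed
next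
  fix hs ls b assume that: "hs \<in> lists_on A (Suc n)" "ls \<in> lists_on B m" "b \<in> N"
  then obtain us h where [simp]: "hs = h # us" and mem: "us \<in> lists_on A n" "h \<in> A"
    by (elim lists_on_Suc_ConsE)
  show "lin_on M sM (\<lambda>a. tr_Hpi \<Phi> hs a ls b)"
    unfolding \<open>hs = h # us\<close> tr_Hpi_Cons
    by (rule B.lin_sw_list[OF that(2)], rule B.lin_sw\<delta>[OF that(3)],
        rule lin_on_mult_left, rule multilin_a[OF \<Phi> mem(1)])
next
  fix hs a b assume that: "hs \<in> lists_on A (Suc n)" "a \<in> M" "b \<in> N"
  then obtain us h where [simp]: "hs = h # us" and mem: "us \<in> lists_on A n" "h \<in> A"
    by (elim lists_on_Suc_ConsE)
  show "multilin_on B sB m (\<lambda>ls. tr_Hpi \<Phi> hs a ls b)"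
    unfolding \<open>hs = h # us\<close> tr_Hpi_Cons
  proof (rule B.multilin_sw_list)
    show "multilin_on B sB m (\<lambda>p. swsum \<delta>N b (\<lambda>b0 b1. pr (B.prod (q @ [b1])) h * \<Phi> us a p b0))" for q
      by (intro multilin_on_fs2 multilin_on_mult_left multilin_ls[OF \<Phi> mem(1)] that)
        (use B.\<delta>_keys that in blast)
    show "multilin_on B sB m (\<lambda>q. swsum \<delta>N b (\<lambda>b0 b1. pr (B.prod (q @ [b1])) h * \<Phi> us a p b0))" for p
      by (intro multilin_on_fs2 multilin_on_mult_right multilin_pr_prod_snoc mem)
        (use B.\<delta>_keys that in blast)
  qed
next
  fix hs a ls assume that: "hs \<in> lists_on A (Suc n)" "a \<in> M" "ls \<in> lists_on B m"
  then obtain us h where [simp]: "hs = h # us" and mem: "us \<in> lists_on A n" "h \<in> A"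
    by (elim lists_on_Suc_ConsE)
  show "lin_on N sN (\<lambda>b. tr_Hpi \<Phi> hs a ls b)"
    unfolding \<open>hs = h # us\<close> tr_Hpi_Cons
    by (rule B.lin_sw_list[OF that(3)], rule B.lin_\<delta>',
        rule lin_on_mult_left, rule multilin_b[OF \<Phi> mem(1) that(2)], assumption,
        rule lin_on_mult_right, rule lin_pr_prod_last[OF mem(2)])
qed

section \<open>The first differential squares to zero\<close>

text \<open>Applying \<open>\<pi>^H\<close> twice absorbs the last two entries one after the other. By
  coassociativity in the entries of \<open>ls\<close>, by duality and by multiplicativity of the
  coproduct this equals absorbing their product \<open>h h'\<close> at once, and that is, up to
  sign, the last summand of the bar differential followed by \<open>\<pi>^H\<close>. All the
  other summands of the bar differential commute with \<open>\<pi>^H\<close>.\<close>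

lemma piH_piH:
  assumes \<Phi>: "multilin n m \<Phi>" and hs: "hs \<in> lists_on A n" and h: "h \<in> A" and h': "h' \<in> A"
    and a: "a \<in> M" and ls: "ls \<in> lists_on B m" and b: "b \<in> N"
  shows "tr_piH (tr_piH \<Phi>) (hs @ [h, h']) a ls b + tr_piH (tr_bar \<Phi>) (hs @ [h, h']) a ls b
       + tr_bar (tr_piH \<Phi>) (hs @ [h, h']) a ls b = 0"
proof -
  have len: "length hs = n" using hs by (simp add: lists_on_def)
  have sign: "(- 1) ^ n * ((- 1) ^ n * y) = y" for y :: 'k
    by (simp flip: mult.assoc power_add mult_2)
  define T where "T p1 p2 q = swsum DA h' (\<lambda>x y. swsum DA h (\<lambda>z w.
      pr (B.prod p1) x * (pr (B.prod p2) z * \<Phi> hs (actM w (actM y a)) q b)))" for p1 p2 q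
  have "tr_piH (tr_piH \<Phi>) (hs @ [h, h']) a ls b
      = - fs2 (sw_list DB ls) (\<lambda>p q. fs2 (sw_list DB q) (\<lambda>q1 q2. T p q1 q2))"
  proof -
    have "tr_piH (tr_piH \<Phi>) (hs @ [h, h']) a ls b
      = - fs2 (sw_list DB ls) (\<lambda>p q. swsum DA h' (\<lambda>x y. fs2 (sw_list DB q) (\<lambda>q1 q2.
          swsum DA h (\<lambda>z w. pr (B.prod p) x * (pr (B.prod q1) z * \<Phi> hs (actM w (actM y a)) q2 b)))))"
      using tr_piH_snoc[of "tr_piH \<Phi>" "hs @ [h]" h' a ls b]
      by (simp add: tr_piH_snoc len mult.left_commute[of "pr u v" "(- 1) ^ n" for u v] fs2_mult_left fs2_uminus sign)
    also have "\<dots> = - fs2 (sw_list DB ls) (\<lambda>p q. fs2 (sw_list DB q) (\<lambda>q1 q2. T p q1 q2))"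
      unfolding T_def by (subst (2) fs2_commute) (rule refl)
    finally show ?thesis .
  qed
  also have "fs2 (sw_list DB ls) (\<lambda>p q. fs2 (sw_list DB q) (\<lambda>q1 q2. T p q1 q2))
      = fs2 (sw_list DB ls) (\<lambda>p q. fs2 (sw_list DB p) (\<lambda>p1 p2. T p1 p2 q))"
  proof (rule B.sw_list_coassoc[symmetric, OF ls])
    show "multilin_on B sB m (\<lambda>u. T u v w)" for v w
      unfolding T_def
      by (intro multilin_on_fs2 multilin_on_mult_right multilin_pr_prod) (use A.D_keys h h' in blast)
    show "multilin_on B sB m (\<lambda>v. T u v w)" for u w
      unfolding T_def
      by (intro multilin_on_fs2 multilin_on_mult_left multilin_on_mult_right multilin_pr_prod)
        (use A.D_keys h h' in blast)
    show "multilin_on B sB m (\<lambda>w. T u v w)" for u v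
      unfolding T_def
      by (intro multilin_on_fs2 multilin_on_mult_left multilin_ls[OF \<Phi> hs] A.act_closed a b)
        (use A.D_keys h h' in blast)+
  qed
  also have "\<dots> = fs2 (sw_list DB ls) (\<lambda>p q. swsum DA (mulA h h') (\<lambda>x y. pr (B.prod p) x * \<Phi> hs (actM y a) q b))"
  proof (rule B.sw_list_cong[OF ls])
    fix p q assume p: "p \<in> lists_on B m" and q: "q \<in> lists_on B m"
    have "bilin_on A sA A sA (\<lambda>x y. pr (B.prod p) x * \<Phi> hs (actM y a) q b)"
      by (intro bilin_onI lin_pr_mult lin_on_mult_left A.lin_act_left[OF multilin_a[OF \<Phi> hs q b] a] B.prod_lists_on[OF p])
    then have "swsum DA (mulA h h') (\<lambda>x y. pr (B.prod p) x * \<Phi> hs (actM y a) q b)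
      = swsum DA h (\<lambda>z w. swsum DA h' (\<lambda>x y. pr (B.prod p) (mulA z x) * \<Phi> hs (actM (mulA w y) a) q b))"
      by (rule A.D_mul[OF _ h h'])
    also have "\<dots> = swsum DA h (\<lambda>z w. swsum DA h' (\<lambda>x y. fs2 (sw_list DB p) (\<lambda>p1 p2.
        pr (B.prod p1) x * (pr (B.prod p2) z * \<Phi> hs (actM w (actM y a)) q b))))"
      by (intro A.swD_cong h h') (simp add: pr_prod_mul_A[OF p] A.act_mul a push_in mult.assoc)
    also have "\<dots> = fs2 (sw_list DB p) (\<lambda>p1 p2. T p1 p2 q)"
      unfolding T_def
      by (subst fs2_commute[of "sw (DA h)" "sw (DA h')"], subst fs2_commute[of "sw (DA h)" "sw_list DB p"])
        (rule fs2_commute)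
    finally show "fs2 (sw_list DB p) (\<lambda>p1 p2. T p1 p2 q)
      = swsum DA (mulA h h') (\<lambda>x y. pr (B.prod p) x * \<Phi> hs (actM y a) q b)" ..
  qed
  finally have 1: "tr_piH (tr_piH \<Phi>) (hs @ [h, h']) a ls b = - ((- 1) ^ Suc n * tr_piH \<Phi> (hs @ [mulA h h']) a ls b)"
    by (simp add: tr_piH_snoc len sign)
  \<comment> \<open>The summands of the bar differential that do not touch the last entry.\<close>
  have "bar mulA (\<lambda>ws. tr_piH \<Phi> (ws @ [h']) a ls b) (hs @ [h])
      = bar mulA (\<lambda>ws. (- 1) ^ Suc n *
     fs2 (sw_list DB ls) (\<lambda>p q. swsum DA h' (\<lambda>x y. pr (B.prod p) x * \<Phi> ws (actM y a) q b))) (hs @ [h])"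
    by (rule A.bar_cong_on) (use hs h in \<open>auto simp: tr_piH_snoc lists_on_def\<close>)
  also have "\<dots> = - tr_piH (tr_bar \<Phi>) (hs @ [h, h']) a ls b"
    using tr_piH_snoc[of "tr_bar \<Phi>" "hs @ [h]" h' a ls b]
    by (simp add: bar_mult bar_uminus bar_fs2 tr_bar_def len)
  finally show ?thesis
    using 1 by (simp add: tr_bar_def bar_snoc len)
qed

text \<open>As for \<open>\<pi>^H\<close>, at the other end of the list: absorbing the first two entries
  successively is absorbing their product. Coassociativity is now used both for the entries of
  \<open>ls\<close> and for the coaction on \<open>N\<close>.\<close>

lemma Hpi_Hpi:
  assumes \<Phi>: "multilin n m \<Phi>" and hs: "hs \<in> lists_on A n" and h: "h \<in> A" and h': "h' \<in> A"
    and a: "a \<in> M" and ls: "ls \<in> lists_on B m" and b: "b \<in> N"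
  shows "tr_Hpi (tr_Hpi \<Phi>) (h # h' # hs) a ls b + tr_Hpi (tr_bar \<Phi>) (h # h' # hs) a ls b
       + tr_bar (tr_Hpi \<Phi>) (h # h' # hs) a ls b = 0"
proof -
  define T where "T p q1 q2 = swsum \<delta>N b (\<lambda>b0 b1. swsum DB b1 (\<lambda>c1 c2.
     pr (B.prod (q2 @ [c2])) h * (pr (B.prod (q1 @ [c1])) h' * \<Phi> hs a p b0)))" for p q1 q2
  have "tr_Hpi (tr_Hpi \<Phi>) (h # h' # hs) a ls b
    = fs2 (sw_list DB ls) (\<lambda>p q. swsum \<delta>N b (\<lambda>b0 b1. fs2 (sw_list DB p) (\<lambda>p1 p2. swsum \<delta>N b0 (\<lambda>b00 b01.
        pr (B.prod (q @ [b1])) h * (pr (B.prod (p2 @ [b01])) h' * \<Phi> hs a p1 b00)))))"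
    by (simp add: tr_Hpi_Cons push_in)
  also have "\<dots> = fs2 (sw_list DB ls) (\<lambda>p q. fs2 (sw_list DB p) (\<lambda>p1 p2. swsum \<delta>N b (\<lambda>b0 b1. swsum \<delta>N b0 (\<lambda>b00 b01.
        pr (B.prod (q @ [b1])) h * (pr (B.prod (p2 @ [b01])) h' * \<Phi> hs a p1 b00)))))"
    by (subst (2) fs2_commute) (rule refl)
  also have "\<dots> = fs2 (sw_list DB ls) (\<lambda>p q. fs2 (sw_list DB p) (\<lambda>p1 p2. T p1 p2 q))"
    unfolding T_def
  proof (intro B.sw_list_cong[OF ls] B.sw_list_cong[where n = m] B.\<delta>_coassoc[OF trilin_onI b])
    fix p q p1 p2 assume *: "q \<in> lists_on B m" "p1 \<in> lists_on B m" "p2 \<in> lists_on B m"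
    show "lin_on N sN (\<lambda>x. pr (B.prod (q @ [z])) h * (pr (B.prod (p2 @ [y])) h' * \<Phi> hs a p1 x))" for y z
      by (intro lin_on_mult_left multilin_b[OF \<Phi> hs a] *)
    show "lin_on B sB (\<lambda>y. pr (B.prod (q @ [z])) h * (pr (B.prod (p2 @ [y])) h' * \<Phi> hs a p1 x))" for x z
      by (intro lin_on_mult_left lin_on_mult_right lin_pr_prod_last[OF h' *(3)])
    show "lin_on B sB (\<lambda>z. pr (B.prod (q @ [z])) h * (pr (B.prod (p2 @ [y])) h' * \<Phi> hs a p1 x))" for x y
      by (intro lin_on_mult_left lin_on_mult_right lin_pr_prod_last[OF h *(1)])
  qed
  also have "\<dots> = fs2 (sw_list DB ls) (\<lambda>p q. fs2 (sw_list DB q) (\<lambda>q1 q2. T p q1 q2))"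
  proof (rule B.sw_list_coassoc[OF ls])
    show "multilin_on B sB m (\<lambda>u. T u v w)" for v w
      unfolding T_def
      by (intro multilin_on_fs2 multilin_on_mult_left multilin_ls[OF \<Phi> hs] a) (use B.\<delta>_keys b in blast)
    show "multilin_on B sB m (\<lambda>v. T u v w)" for u w
      unfolding T_def
      by (intro multilin_on_fs2 multilin_on_mult_left multilin_on_mult_right multilin_pr_prod_snoc h')
        (auto dest: B.\<delta>_keys[OF _ b] B.D_keys)
    show "multilin_on B sB m (\<lambda>w. T u v w)" for u v
      unfolding T_def
      by (intro multilin_on_fs2 multilin_on_mult_left multilin_on_mult_right multilin_pr_prod_snoc h)
        (auto dest: B.\<delta>_keys[OF _ b] B.D_keys)
  qed
  also have "\<dots> = tr_Hpi \<Phi> (mulA h h' # hs) a ls b"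
    unfolding tr_Hpi_Cons
  proof (rule B.sw_list_cong[OF ls])
    fix p q assume p: "p \<in> lists_on B m" and q: "q \<in> lists_on B m"
    have "swsum \<delta>N b (\<lambda>b0 b1. pr (B.prod (q @ [b1])) (mulA h h') * \<Phi> hs a p b0)
      = swsum \<delta>N b (\<lambda>b0 b1. fs2 (sw_list DB q) (\<lambda>q1 q2. swsum DB b1 (\<lambda>c1 c2.
     pr (B.prod (q2 @ [c2])) h * (pr (B.prod (q1 @ [c1])) h' * \<Phi> hs a p b0))))"
    proof (intro B.sw\<delta>_cong b)
      fix b0 b1 assume "b1 \<in> B"
      then have "q @ [b1] \<in> lists_on B (Suc m)" using q by simp
      from pr_prod_mul_A[OF this h h'] show "pr (B.prod (q @ [b1])) (mulA h h') * \<Phi> hs a p b0 = fs2 (sw_list DB q) (\<lambda>q1 q2. swsum DB b1 (\<lambda>c1 c2.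
     pr (B.prod (q2 @ [c2])) h * (pr (B.prod (q1 @ [c1])) h' * \<Phi> hs a p b0)))"
        by (simp add: fs2_sw_list_append fs2_sw_list_Cons push_in mult_ac)
    qed
    also have "\<dots> = fs2 (sw_list DB q) (\<lambda>q1 q2. T p q1 q2)"
      unfolding T_def by (rule fs2_commute)
    finally show "fs2 (sw_list DB q) (\<lambda>q1 q2. T p q1 q2)
      = swsum \<delta>N b (\<lambda>b0 b1. pr (B.prod (q @ [b1])) (mulA h h') * \<Phi> hs a p b0)" ..
  qed
  finally have 1: "tr_Hpi (tr_Hpi \<Phi>) (h # h' # hs) a ls b = tr_Hpi \<Phi> (mulA h h' # hs) a ls b" .
  have "bar mulA (\<lambda>ws. tr_Hpi \<Phi> (h # ws) a ls b) (h' # hs) = tr_Hpi (tr_bar \<Phi>) (h # h' # hs) a ls b"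
    by (simp add: tr_Hpi_Cons bar_fs2 bar_mult tr_bar_def)
  then show ?thesis
    using 1 by (simp add: tr_bar_def)
qed

text \<open>The two maps absorb different ends of the list \<open>hs\<close> and use the two outer legs of
  the iterated coproduct of the entries of \<open>ls\<close>, so they commute by
  coassociativity; the sign in \<open>tr_piH\<close> depends on the length of \<open>hs\<close>
  and makes them anticommute.\<close>

lemma piH_Hpi:
  assumes \<Phi>: "multilin n m \<Phi>" and hs: "hs \<in> lists_on A n" and h: "h \<in> A" and h': "h' \<in> A"
    and a: "a \<in> M" and ls: "ls \<in> lists_on B m" and b: "b \<in> N"
  shows "tr_piH (tr_Hpi \<Phi>) (h # hs @ [h']) a ls b + tr_Hpi (tr_piH \<Phi>) (h # hs @ [h']) a ls b = 0"
proof -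
  define T where "T p1 p2 q = swsum DA h' (\<lambda>x y. swsum \<delta>N b (\<lambda>b0 b1.
     pr (B.prod p1) x * (pr (B.prod (q @ [b1])) h * \<Phi> hs (actM y a) p2 b0)))" for p1 p2 q
  have len: "length hs = n" using hs by (simp add: lists_on_def)
  have "tr_piH (tr_Hpi \<Phi>) (h # hs @ [h']) a ls b
    = (- 1) ^ n * fs2 (sw_list DB ls) (\<lambda>p q. swsum DA h' (\<lambda>x y. fs2 (sw_list DB q) (\<lambda>q1 q2. swsum \<delta>N b (\<lambda>b0 b1.
       pr (B.prod p) x * (pr (B.prod (q2 @ [b1])) h * \<Phi> hs (actM y a) q1 b0)))))"
    using tr_piH_snoc[of "tr_Hpi \<Phi>" "h # hs" h' a ls b]
    by (simp add: len tr_Hpi_Cons) (simp add: fs2_mult_left)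
  also have "\<dots> = (- 1) ^ n * fs2 (sw_list DB ls) (\<lambda>p q. fs2 (sw_list DB q) (\<lambda>q1 q2. T p q1 q2))"
    unfolding T_def by (subst (2) fs2_commute) (rule refl)
  also have "fs2 (sw_list DB ls) (\<lambda>p q. fs2 (sw_list DB q) (\<lambda>q1 q2. T p q1 q2))
    = fs2 (sw_list DB ls) (\<lambda>p q. fs2 (sw_list DB p) (\<lambda>p1 p2. T p1 p2 q))"
  proof (rule B.sw_list_coassoc[OF ls, symmetric])
    show "multilin_on B sB m (\<lambda>u. T u v w)" for v w
      unfolding T_def
      by (intro multilin_on_fs2 multilin_on_mult_right multilin_pr_prod) (use A.D_keys h' in blast)
    show "multilin_on B sB m (\<lambda>v. T u v w)" for u w
      unfolding T_def
      by (intro multilin_on_fs2 multilin_on_mult_left multilin_ls[OF \<Phi> hs] A.act_closed a)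
        (use B.\<delta>_keys A.D_keys h' b in blast)+
    show "multilin_on B sB m (\<lambda>w. T u v w)" for u v
      unfolding T_def
      by (intro multilin_on_fs2 multilin_on_mult_left multilin_on_mult_right multilin_pr_prod_snoc h)
        (auto dest: B.\<delta>_keys[OF _ b] B.D_keys)
  qed
  also have "\<dots> = fs2 (sw_list DB ls) (\<lambda>p q. swsum \<delta>N b (\<lambda>b0 b1. fs2 (sw_list DB p) (\<lambda>p1 p2. swsum DA h' (\<lambda>x y.
       pr (B.prod p1) x * (pr (B.prod (q @ [b1])) h * \<Phi> hs (actM y a) p2 b0)))))"
    unfolding T_def
    by (intro B.sw_list_cong[OF ls], subst fs2_commute[of "sw (DA h')"]) (rule fs2_commute)
  also have "\<dots> = fs2 (sw_list DB ls) (\<lambda>p q. swsum \<delta>N b (\<lambda>b0 b1. pr (B.prod (q @ [b1])) h *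
       fs2 (sw_list DB p) (\<lambda>p1 p2. swsum DA h' (\<lambda>x y. pr (B.prod p1) x * \<Phi> hs (actM y a) p2 b0))))"
    by (simp add: push_in mult.left_commute)
  also have "(- 1) ^ n * \<dots> = - tr_Hpi (tr_piH \<Phi>) (h # hs @ [h']) a ls b"
    by (simp add: tr_Hpi_Cons tr_piH_snoc len mult.left_commute[of "pr u v" "(- 1) ^ n" for u v] fs2_mult_left fs2_uminus)
  finally show ?thesis by simp
qed

lemma multilin_add: "multilin n m F \<Longrightarrow> multilin n m G \<Longrightarrow> multilin n m (\<lambda>hs a ls b. F hs a ls b + G hs a ls b)"
  by (simp add: multilin_def multilin_on_add lin_on_add)

lemma multilin_mult: "multilin n m F \<Longrightarrow> multilin n m (\<lambda>hs a ls b. c * F hs a ls b)"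
  by (simp add: multilin_def multilin_on_mult_left lin_on_mult_left)

lemma multilin_zero_hs:
  assumes "\<And>a ls b. F [] a ls b = 0"
  shows "multilin 0 m F"
proof -
  have "lists_on A 0 = {[]}" by (auto simp: lists_on_def)
  then show ?thesis
    using assms by (simp add: multilin_def multilin_on_def lin_on_def)
qed

text \<open>The four cases of the theorem correspond to \<open>s, t \<in> {0, 1}\<close>. Idempotence of
  \<open>s\<close> and \<open>t\<close> lets the squares of \<open>\<pi>^H\<close> and
  \<open>{}^H\<pi>\<close> cancel against terms that are linear in them.\<close>

definition tr_d where
  "tr_d s t \<Phi> hs a ls b = tr_bar \<Phi> hs a ls b + s * tr_piH \<Phi> hs a ls b + t * tr_Hpi \<Phi> hs a ls b"

lemma tr_bar_add: "tr_bar (\<lambda>hs a ls b. F hs a ls b + G hs a ls b) hs a ls b = tr_bar F hs a ls b + tr_bar G hs a ls b"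
  and tr_bar_mult: "tr_bar (\<lambda>hs a ls b. c * F hs a ls b) hs a ls b = c * tr_bar F hs a ls b"
  by (simp_all add: tr_bar_def bar_add bar_mult)

lemma tr_piH_add: "tr_piH (\<lambda>hs a ls b. F hs a ls b + G hs a ls b) hs a ls b = tr_piH F hs a ls b + tr_piH G hs a ls b"
  and tr_piH_mult: "tr_piH (\<lambda>hs a ls b. c * F hs a ls b) hs a ls b = c * tr_piH F hs a ls b"
  by (simp_all add: tr_piH_def distrib_left fs2_add mult.left_commute[of _ c] fs2_mult_left)

lemma tr_Hpi_add: "tr_Hpi (\<lambda>hs a ls b. F hs a ls b + G hs a ls b) hs a ls b = tr_Hpi F hs a ls b + tr_Hpi G hs a ls b"
  and tr_Hpi_mult: "tr_Hpi (\<lambda>hs a ls b. c * F hs a ls b) hs a ls b = c * tr_Hpi F hs a ls b"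
  by (simp_all add: tr_Hpi_def distrib_left fs2_add mult.left_commute[of _ c] fs2_mult_left)

lemmas tr_linear = tr_bar_add tr_bar_mult tr_piH_add tr_piH_mult tr_Hpi_add tr_Hpi_mult

lemma tr_d_Nil [simp]: "tr_d s t \<Phi> [] a ls b = 0"
  by (simp add: tr_d_def tr_bar_def)

lemma tr_d_tr_d_short: "length hs < 2 \<Longrightarrow> tr_d s t (tr_d s t \<Phi>) hs a ls b = 0"
  by (cases hs) (auto simp: tr_d_def[of s t "tr_d s t \<Phi>"] tr_bar_def tr_piH_def tr_Hpi_def)

lemma tr_d_tr_d:
  assumes \<Phi>: "multilin n m \<Phi>" and hs: "hs \<in> lists_on A (Suc (Suc n))"
    and a: "a \<in> M" and ls: "ls \<in> lists_on B m" and b: "b \<in> N"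
    and st: "s * s = s" "t * t = t"
  shows "tr_d s t (tr_d s t \<Phi>) hs a ls b = 0"
proof -
  have d: "tr_d s t \<Phi> = (\<lambda>hs a ls b. tr_bar \<Phi> hs a ls b + s * tr_piH \<Phi> hs a ls b + t * tr_Hpi \<Phi> hs a ls b)"
    by (intro ext) (rule tr_d_def)
  have bb: "tr_bar (tr_bar \<Phi>) hs a ls b = 0"
    using A.bar_bar[of hs "\<lambda>xs. \<Phi> xs a ls b"] hs by (auto simp: tr_bar_def lists_on_def)
  obtain us h h' where "hs = us @ [h, h']" "us \<in> lists_on A n" "h \<in> A" "h' \<in> A"
    using hs by (elim lists_on_SucE) auto
  then have piH_piH: "tr_piH (tr_piH \<Phi>) hs a ls b + tr_piH (tr_bar \<Phi>) hs a ls b + tr_bar (tr_piH \<Phi>) hs a ls b = 0"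
    using piH_piH[OF \<Phi> _ _ _ a ls b] by simp
  obtain us h h' where "hs = h # h' # us" "us \<in> lists_on A n" "h \<in> A" "h' \<in> A"
    using hs by (elim lists_on_Suc_ConsE) auto
  then have Hpi_Hpi: "tr_Hpi (tr_Hpi \<Phi>) hs a ls b + tr_Hpi (tr_bar \<Phi>) hs a ls b + tr_bar (tr_Hpi \<Phi>) hs a ls b = 0"
    using Hpi_Hpi[OF \<Phi> _ _ _ a ls b] by simp
  obtain us h h' where "hs = h # us @ [h']" "us \<in> lists_on A n" "h \<in> A" "h' \<in> A"
    using hs by (elim lists_on_Suc_ConsE lists_on_SucE) auto
  then have piH_Hpi: "tr_piH (tr_Hpi \<Phi>) hs a ls b + tr_Hpi (tr_piH \<Phi>) hs a ls b = 0"
    using piH_Hpi[OF \<Phi> _ _ _ a ls b] by simp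
  \<comment> \<open>The nine products are grouped so that every group vanishes; the squares of s and t produce
    the last two summands.\<close>
  have "tr_d s t (tr_d s t \<Phi>) hs a ls b
    = tr_bar (tr_bar \<Phi>) hs a ls b
      + s * (tr_piH (tr_piH \<Phi>) hs a ls b + tr_piH (tr_bar \<Phi>) hs a ls b + tr_bar (tr_piH \<Phi>) hs a ls b)
      + t * (tr_Hpi (tr_Hpi \<Phi>) hs a ls b + tr_Hpi (tr_bar \<Phi>) hs a ls b + tr_bar (tr_Hpi \<Phi>) hs a ls b)
      + s * t * (tr_piH (tr_Hpi \<Phi>) hs a ls b + tr_Hpi (tr_piH \<Phi>) hs a ls b)
      + (s * s - s) * tr_piH (tr_piH \<Phi>) hs a ls b + (t * t - t) * tr_Hpi (tr_Hpi \<Phi>) hs a ls b"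
    unfolding tr_d_def[of s t "tr_d s t \<Phi>"] unfolding d tr_linear
    by (simp add: algebra_simps)
  then show ?thesis by (simp add: bb piH_piH Hpi_Hpi piH_Hpi st)
qed

lemma multilin_tr_d:
  assumes "\<And>n m. n + m = k \<Longrightarrow> multilin n m \<Phi>" "n + m = Suc k"
  shows "multilin n m (tr_d s t \<Phi>)"
proof (cases n)
  case 0 then show ?thesis by (auto intro: multilin_zero_hs)
next
  case (Suc n')
  then have "multilin n' m \<Phi>" using assms by simp
  then have "multilin (Suc n') m (\<lambda>hs a ls b. tr_bar \<Phi> hs a ls b + s * tr_piH \<Phi> hs a ls b + t * tr_Hpi \<Phi> hs a ls b)"
    by (intro multilin_add multilin_mult multilin_tr_bar multilin_tr_piH multilin_tr_Hpi)
  then show ?thesis by (simp add: Suc tr_d_def[abs_def])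
qed

lemma tr_d_cong:
  assumes eq: "\<And>hs a ls b. hs \<in> lists_on A n \<Longrightarrow> a \<in> M \<Longrightarrow> ls \<in> lists_on B m \<Longrightarrow> b \<in> N \<Longrightarrow> \<Phi> hs a ls b = \<Psi> hs a ls b"
    and hs: "hs \<in> lists_on A (Suc n)" and a: "a \<in> M" and ls: "ls \<in> lists_on B m" and b: "b \<in> N"
  shows "tr_d s t \<Phi> hs a ls b = tr_d s t \<Psi> hs a ls b"
proof -
  obtain h us where hh: "hs = h # us" "us \<in> lists_on A n" "h \<in> A"
    using hs by (elim lists_on_Suc_ConsE) auto
  obtain h' us' where ht: "hs = us' @ [h']" "us' \<in> lists_on A n" "h' \<in> A"
    using hs by (elim lists_on_SucE) auto
  have "tr_bar \<Phi> hs a ls b = tr_bar \<Psi> hs a ls b"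
    unfolding tr_bar_def by (rule A.bar_cong_on[OF _ hs]) (auto intro: eq a ls b)
  moreover have "tr_piH \<Phi> hs a ls b = tr_piH \<Psi> hs a ls b"
    unfolding ht(1) tr_piH_snoc
    by (intro arg_cong2[where f = "(*)"] refl B.sw_list_cong[OF ls] A.swD_cong[OF ht(3)])
      (auto intro!: eq ht(2) a b A.act_closed)
  moreover have "tr_Hpi \<Phi> hs a ls b = tr_Hpi \<Psi> hs a ls b"
    unfolding hh(1) tr_Hpi_Cons
    by (intro B.sw_list_cong[OF ls] B.sw\<delta>_cong[OF b]) (auto intro!: eq hh(2) a)
  ultimately show ?thesis by (simp add: tr_d_def)
qed

lemma tr_d_mult: "tr_d s t (\<lambda>hs a ls b. c * \<Phi> hs a ls b) hs a ls b = c * tr_d s t \<Phi> hs a ls b"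
  by (simp add: tr_d_def tr_linear algebra_simps)

text \<open>The first differential shortens \<open>hs\<close> by one, so it changes the sign
  \<open>(-1)^n\<close> that accompanies the second differential. This is why the two
  anticommute although their unsigned versions commute.\<close>

lemma tr_d_sign:
  assumes hs: "hs \<in> lists_on A (Suc n)" and a: "a \<in> M" and ls: "ls \<in> lists_on B m" and b: "b \<in> N"
  shows "tr_d s t (\<lambda>hs a ls b. (- 1) ^ length hs * \<Phi> hs a ls b) hs a ls b = (- 1) ^ n * tr_d s t \<Phi> hs a ls b"
proof -
  have "tr_d s t (\<lambda>hs a ls b. (- 1) ^ length hs * \<Phi> hs a ls b) hs a ls b
    = tr_d s t (\<lambda>hs a ls b. (- 1) ^ n * \<Phi> hs a ls b) hs a ls b"
    by (rule tr_d_cong[OF _ hs a ls b]) (simp add: lists_on_def)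
  then show ?thesis by (simp add: tr_d_mult)
qed

end

section \<open>The two differentials commute\<close>

context yd_pair
begin

interpretation flip: yd_pair B sB mulB oneB DB N sN actN \<delta>N A sA mulA oneA DA M sM actM \<delta>M "\<lambda>h l. pr l h"
  by (rule flip)

text \<open>The remaining three maps are the mirror images of the first three. In particular
  \<open>tr_piHd\<close> carries the sign \<open>(-1)^m\<close>.\<close>

definition tr_cob where "tr_cob \<Phi> hs a ls b = flip.tr_bar (\<lambda>ls b hs a. \<Phi> hs a ls b) ls b hs a"
definition tr_piHd where "tr_piHd \<Phi> hs a ls b = flip.tr_piH (\<lambda>ls b hs a. \<Phi> hs a ls b) ls b hs a"
definition tr_Hdpi where "tr_Hdpi \<Phi> hs a ls b = flip.tr_Hpi (\<lambda>ls b hs a. \<Phi> hs a ls b) ls b hs a"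

lemma tr_cob_eq: "tr_cob \<Phi> hs a ls b = bar mulB (\<lambda>ys. \<Phi> hs a ys b) ls"
  by (simp add: tr_cob_def flip.tr_bar_def)

lemma tr_piHd_snoc: "tr_piHd \<Phi> hs a (ls @ [l]) b = (- 1) ^ Suc (length ls) *
     fs2 (sw_list DA hs) (\<lambda>u v. swsum DB l (\<lambda>x y. pr x (A.prod u) * \<Phi> v a ls (actN y b)))"
  by (simp add: tr_piHd_def flip.tr_piH_snoc)

lemma tr_Hdpi_Cons: "tr_Hdpi \<Phi> hs a (l # ls) b =
     fs2 (sw_list DA hs) (\<lambda>u v. swsum \<delta>M a (\<lambda>a0 a1. pr l (A.prod (v @ [a1])) * \<Phi> u a0 ls b))"
  by (simp add: tr_Hdpi_def flip.tr_Hpi_Cons)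

lemma bar_cob: "tr_bar (tr_cob \<Phi>) hs a ls b = tr_cob (tr_bar \<Phi>) hs a ls b"
  unfolding tr_bar_def tr_cob_eq by (rule bar_commute)

text \<open>The map \<open>{}^{H*}\<pi>\<close> sees the second legs of the entries of \<open>hs\<close>
  only through their product, which does not change when adjacent entries are multiplied.\<close>

lemma bar_Hdpi:
  assumes \<Phi>: "multilin n m \<Phi>" and hs: "hs \<in> lists_on A (Suc n)"
    and a: "a \<in> M" and ls: "ls \<in> lists_on B m" and l: "l \<in> B" and b: "b \<in> N"
  shows "tr_bar (tr_Hdpi \<Phi>) hs a (l # ls) b = tr_Hdpi (tr_bar \<Phi>) hs a (l # ls) b"
proof -
  define G where "G u p = swsum \<delta>M a (\<lambda>a0 a1. pr l (mulA p a1) * \<Phi> u a0 ls b)" for u p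
  have G: "swsum \<delta>M a (\<lambda>a0 a1. pr l (A.prod (v @ [a1])) * F a0) = swsum \<delta>M a (\<lambda>a0 a1. pr l (mulA (A.prod v) a1) * F a0)"
    if "set v \<subseteq> A" for v F
    by (rule A.sw\<delta>_cong[OF a]) (simp add: A.prod_snoc that)
  have "tr_bar (tr_Hdpi \<Phi>) hs a (l # ls) b = bar mulA (\<lambda>xs. fs2 (sw_list DA xs) (\<lambda>u v. G u (A.prod v))) hs"
    unfolding tr_bar_def tr_Hdpi_Cons G_def
    by (rule A.bar_cong_on[OF _ hs], rule A.sw_list_cong, assumption) (simp add: G lists_on_def)
  also have "\<dots> = fs2 (sw_list DA hs) (bar2 mulA (\<lambda>u v. G u (A.prod v)))"
  proof (rule A.bar_sw_list[OF hs])
    show "multilin_on A sA n (\<lambda>u. G u (A.prod v))" for v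
      unfolding G_def
      by (intro multilin_on_fs2 multilin_on_mult_left multilin_hs[OF \<Phi> _ ls b]) (auto dest: A.\<delta>_keys[OF _ a])
    show "multilin_on A sA n (\<lambda>v. G u (A.prod v))" for u
      unfolding G_def
      by (rule A.multilin_prod, rule A.lin_sw\<delta>[OF a], rule lin_on_mult_right, rule A.lin_mul_left[OF pr_lin_A[OF l]])
  qed
  also have "\<dots> = fs2 (sw_list DA hs) (\<lambda>u v. bar mulA (\<lambda>u. G u (A.prod v)) u)"
    by (rule A.sw_list_cong[OF hs], rule A.bar2_prod_right) (auto simp: lists_on_def)
  also have "\<dots> = tr_Hdpi (tr_bar \<Phi>) hs a (l # ls) b"
    unfolding tr_Hdpi_Cons tr_bar_def G_def
    by (rule A.sw_list_cong[OF hs]) (simp add: G lists_on_def bar_fs2 bar_mult)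
  finally show ?thesis .
qed

text \<open>The same argument with the first legs.\<close>

lemma bar_piHd:
  assumes \<Phi>: "multilin n m \<Phi>" and hs: "hs \<in> lists_on A (Suc n)"
    and a: "a \<in> M" and ls: "ls \<in> lists_on B m" and l: "l \<in> B" and b: "b \<in> N"
  shows "tr_bar (tr_piHd \<Phi>) hs a (ls @ [l]) b = tr_piHd (tr_bar \<Phi>) hs a (ls @ [l]) b"
proof -
  define G where "G p v = swsum DB l (\<lambda>x y. pr x p * \<Phi> v a ls (actN y b))" for p v
  have "tr_bar (tr_piHd \<Phi>) hs a (ls @ [l]) b
    = (- 1) ^ Suc (length ls) * bar mulA (\<lambda>xs. fs2 (sw_list DA xs) (\<lambda>u v. G (A.prod u) v)) hs"
    unfolding tr_bar_def tr_piHd_snoc G_def bar_mult ..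
  also have "bar mulA (\<lambda>xs. fs2 (sw_list DA xs) (\<lambda>u v. G (A.prod u) v)) hs
    = fs2 (sw_list DA hs) (bar2 mulA (\<lambda>u v. G (A.prod u) v))"
  proof (rule A.bar_sw_list[OF hs])
    show "multilin_on A sA n (\<lambda>v. G (A.prod u) v)" for u
      unfolding G_def
      by (intro multilin_on_fs2 multilin_on_mult_left multilin_hs[OF \<Phi> a ls] B.act_closed b)
        (auto dest: B.D_keys[OF _ l])
    show "multilin_on A sA n (\<lambda>u. G (A.prod u) v)" for v
      unfolding G_def
      by (rule A.multilin_prod, rule B.lin_swD[OF l], rule lin_pr_mult)
  qed
  also have "\<dots> = fs2 (sw_list DA hs) (\<lambda>u v. bar mulA (\<lambda>v. G (A.prod u) v) v)"
    by (rule A.sw_list_cong[OF hs], rule A.bar2_prod_left) (auto simp: lists_on_def)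
  also have "(- 1) ^ Suc (length ls) * \<dots> = tr_piHd (tr_bar \<Phi>) hs a (ls @ [l]) b"
    unfolding tr_piHd_snoc tr_bar_def G_def by (simp add: bar_fs2 bar_mult)
  finally show ?thesis .
qed

text \<open>Both composites are the same sum, once \<open>\<langle>l l', h\<rangle>\<close> and
  \<open>\<langle>l, h h'\<rangle>\<close> are expanded by duality.\<close>

lemma Hpi_Hdpi:
  assumes hs: "hs \<in> lists_on A n" and h: "h \<in> A"
    and a: "a \<in> M" and ls: "ls \<in> lists_on B m" and l: "l \<in> B" and b: "b \<in> N"
  shows "tr_Hpi (tr_Hdpi \<Phi>) (h # hs) a (l # ls) b = tr_Hdpi (tr_Hpi \<Phi>) (h # hs) a (l # ls) b"
proof -
  have "tr_Hpi (tr_Hdpi \<Phi>) (h # hs) a (l # ls) b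
    = swsum DB l (\<lambda>l1 l2. fs2 (sw_list DB ls) (\<lambda>p q. swsum \<delta>N b (\<lambda>b0 b1.
        swsum DA h (\<lambda>h1 h2. pr l2 h2 * pr (B.prod (q @ [b1])) h1) *
        fs2 (sw_list DA hs) (\<lambda>u v. swsum \<delta>M a (\<lambda>a0 a1. pr l1 (A.prod (v @ [a1])) * \<Phi> u a0 p b0)))))"
    unfolding tr_Hpi_Cons fs2_sw_list_Cons tr_Hdpi_Cons
  proof (intro B.swD_cong[OF l] B.sw_list_cong[OF ls] B.sw\<delta>_cong[OF b])
    fix l1 l2 p q b0 b1 assume "l2 \<in> B" "q \<in> lists_on B m" "b1 \<in> B"
    then show "pr (B.prod ((l2 # q) @ [b1])) h * fs2 (sw_list DA hs) (\<lambda>u v. swsum \<delta>M a (\<lambda>a0 a1. pr l1 (A.prod (v @ [a1])) * \<Phi> u a0 p b0))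
      = swsum DA h (\<lambda>h1 h2. pr l2 h2 * pr (B.prod (q @ [b1])) h1) *
        fs2 (sw_list DA hs) (\<lambda>u v. swsum \<delta>M a (\<lambda>a0 a1. pr l1 (A.prod (v @ [a1])) * \<Phi> u a0 p b0))"
      using B.prod_lists_on[of "q @ [b1]" "Suc m"] by (simp add: pr_mul_B h)
  qed
  also have "\<dots> = swsum DA h (\<lambda>h1 h2. fs2 (sw_list DA hs) (\<lambda>u v. swsum \<delta>M a (\<lambda>a0 a1.
        swsum DB l (\<lambda>l1 l2. pr l1 (A.prod (v @ [a1])) * pr l2 h2) *
        fs2 (sw_list DB ls) (\<lambda>p q. swsum \<delta>N b (\<lambda>b0 b1. pr (B.prod (q @ [b1])) h1 * \<Phi> u a0 p b0)))))"
    by (rule fs2_interchange[where \<alpha> = pr and \<beta> = "\<lambda>q b1 h1. pr (B.prod (q @ [b1])) h1"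
        and \<gamma> = "\<lambda>l1 v a1. pr l1 (A.prod (v @ [a1]))"])
  also have "\<dots> = tr_Hdpi (tr_Hpi \<Phi>) (h # hs) a (l # ls) b"
    unfolding tr_Hdpi_Cons fs2_sw_list_Cons tr_Hpi_Cons
  proof (intro A.swD_cong[OF h] A.sw_list_cong[OF hs] A.sw\<delta>_cong[OF a])
    fix h1 h2 u v a0 a1 assume "h2 \<in> A" "v \<in> lists_on A n" "a1 \<in> A"
    then show "swsum DB l (\<lambda>l1 l2. pr l1 (A.prod (v @ [a1])) * pr l2 h2) *
        fs2 (sw_list DB ls) (\<lambda>p q. swsum \<delta>N b (\<lambda>b0 b1. pr (B.prod (q @ [b1])) h1 * \<Phi> u a0 p b0))
       = pr l (A.prod ((h2 # v) @ [a1])) * fs2 (sw_list DB ls) (\<lambda>p q. swsum \<delta>N b (\<lambda>b0 b1. pr (B.prod (q @ [b1])) h1 * \<Phi> u a0 p b0))"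
      using A.prod_lists_on[of "v @ [a1]" "Suc n"] by (simp add: pr_mul_A l)
  qed
  finally show ?thesis .
qed

text \<open>After expanding \<open>\<langle>l1 l', h\<rangle>\<close> and recombining the two legs of
  \<open>l\<close> into a pairing with a product, the two composites differ exactly by the two
  sides of the Yetter-Drinfeld condition on \<open>M\<close>.\<close>

lemma piH_Hdpi:
  assumes \<Phi>: "multilin n m \<Phi>" and hs: "hs \<in> lists_on A n" and h: "h \<in> A"
    and a: "a \<in> M" and ls: "ls \<in> lists_on B m" and l: "l \<in> B" and b: "b \<in> N"
  shows "tr_piH (tr_Hdpi \<Phi>) (hs @ [h]) a (l # ls) b = tr_Hdpi (tr_piH \<Phi>) (hs @ [h]) a (l # ls) b"
proof -
  have "tr_Hdpi (tr_piH \<Phi>) (hs @ [h]) a (l # ls) b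
    = fs2 (sw_list DA hs) (\<lambda>u v. swsum DA h (\<lambda>h1 h2. swsum \<delta>M a (\<lambda>a0 a1. (- 1) ^ Suc n *
        fs2 (sw_list DB ls) (\<lambda>p q. swsum DA h1 (\<lambda>x y. pr (B.prod p) x *
          (pr l (mulA (A.prod v) (mulA h2 a1)) * \<Phi> u (actM y a0) q b))))))"
    unfolding tr_Hdpi_Cons fs2_sw_list_append fs2_sw_list_Cons fs2_sw_list_Nil
  proof (intro A.swD_cong[OF h] A.sw_list_cong[OF hs] A.sw\<delta>_cong[OF a])
    fix u v h1 h2 a0 a1 assume *: "u \<in> lists_on A n" "v \<in> lists_on A n" "h2 \<in> A" "a1 \<in> A"
    then have "A.prod ((v @ [h2]) @ [a1]) = mulA (A.prod v) (mulA h2 a1)"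
      by (simp add: A.prod_append A.mul_one lists_on_def)
    moreover have "length u = n" using * by (simp add: lists_on_def)
    ultimately show "pr l (A.prod ((v @ [h2]) @ [a1])) * tr_piH \<Phi> (u @ [h1]) a0 ls b = (- 1) ^ Suc n *
        fs2 (sw_list DB ls) (\<lambda>p q. swsum DA h1 (\<lambda>x y. pr (B.prod p) x *
          (pr l (mulA (A.prod v) (mulA h2 a1)) * \<Phi> u (actM y a0) q b)))"
      by (simp add: tr_piH_snoc push_in mult.left_commute)
  qed
  also have "\<dots> = (- 1) ^ Suc n * fs2 (sw_list DA hs) (\<lambda>u v. fs2 (sw_list DB ls) (\<lambda>p q.
      swsum DA h (\<lambda>h1 h2. swsum \<delta>M a (\<lambda>a0 a1. swsum DA h1 (\<lambda>x y. pr (B.prod p) x *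
          (pr l (mulA (A.prod v) (mulA h2 a1)) * \<Phi> u (actM y a0) q b))))))"
    by (simp only: fs2_mult_left fs2_commute[of "sw (\<delta>M a)" "sw_list DB ls"] fs2_commute[of "sw (DA h)" "sw_list DB ls"])
  also have "\<dots> = (- 1) ^ Suc n * fs2 (sw_list DA hs) (\<lambda>u v. fs2 (sw_list DB ls) (\<lambda>p q.
      swsum DA h (\<lambda>x y. swsum DA x (\<lambda>x1 x2. swsum \<delta>M (actM y a) (\<lambda>m0 m1. pr (B.prod p) x1 *
          (pr l (mulA (A.prod v) (mulA m1 x2)) * \<Phi> u m0 q b))))))"
  proof (intro arg_cong[where f = "(*) ((- 1) ^ Suc n)"] A.sw_list_cong[OF hs] B.sw_list_cong[OF ls])
    fix u v p q assume *: "u \<in> lists_on A n" "v \<in> lists_on A n" "p \<in> lists_on B m" "q \<in> lists_on B m"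
    \<comment> \<open>The Yetter-Drinfeld condition on M, for fixed decompositions of the other entries.\<close>
    show "swsum DA h (\<lambda>h1 h2. swsum \<delta>M a (\<lambda>a0 a1. swsum DA h1 (\<lambda>x y. pr (B.prod p) x *
          (pr l (mulA (A.prod v) (mulA h2 a1)) * \<Phi> u (actM y a0) q b))))
      = swsum DA h (\<lambda>x y. swsum DA x (\<lambda>x1 x2. swsum \<delta>M (actM y a) (\<lambda>m0 m1. pr (B.prod p) x1 *
          (pr l (mulA (A.prod v) (mulA m1 x2)) * \<Phi> u m0 q b))))"
      by (rule A.yd_core[where f = "\<lambda>z. pr l (mulA (A.prod v) z)"])
        (intro A.lin_mul_right pr_lin_A l A.prod_lists_on[OF *(2)] B.prod_lists_on[OF *(3)]
          multilin_a[OF \<Phi> *(1,4) b] h a)+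
  qed
  also have "\<dots> = (- 1) ^ Suc n * fs2 (sw_list DA hs) (\<lambda>u v. fs2 (sw_list DB ls) (\<lambda>p q.
      swsum DA h (\<lambda>x y. swsum DB l (\<lambda>l1 l2. pr (mulB l1 (B.prod p)) x *
        swsum \<delta>M (actM y a) (\<lambda>m0 m1. pr l2 (A.prod (v @ [m1])) * \<Phi> u m0 q b)))))"
  proof (intro arg_cong[where f = "(*) ((- 1) ^ Suc n)"] A.sw_list_cong[OF hs] B.sw_list_cong[OF ls] A.swD_cong[OF h])
    fix u v p q x y assume *: "u \<in> lists_on A n" "v \<in> lists_on A n" "p \<in> lists_on B m" "q \<in> lists_on B m"
      and x: "x \<in> A" and y: "y \<in> A"
    have ya: "actM y a \<in> M" by (rule A.act_closed[OF y a])
    have "swsum DB l (\<lambda>l1 l2. pr (mulB l1 (B.prod p)) x *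
        swsum \<delta>M (actM y a) (\<lambda>m0 m1. pr l2 (A.prod (v @ [m1])) * \<Phi> u m0 q b))
      = swsum DB l (\<lambda>l1 l2. swsum DA x (\<lambda>x1 x2. swsum \<delta>M (actM y a) (\<lambda>m0 m1.
          pr l1 x2 * pr l2 (mulA (A.prod v) m1) * (pr (B.prod p) x1 * \<Phi> u m0 q b))))"
    proof (intro B.swD_cong[OF l])
      fix l1 l2 assume "l1 \<in> B" "l2 \<in> B"
      have "swsum \<delta>M (actM y a) (\<lambda>m0 m1. pr l2 (A.prod (v @ [m1])) * \<Phi> u m0 q b)
        = swsum \<delta>M (actM y a) (\<lambda>m0 m1. pr l2 (mulA (A.prod v) m1) * \<Phi> u m0 q b)"
        using * by (intro A.sw\<delta>_cong ya) (simp add: A.prod_snoc lists_on_def)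
      then show "pr (mulB l1 (B.prod p)) x * swsum \<delta>M (actM y a) (\<lambda>m0 m1. pr l2 (A.prod (v @ [m1])) * \<Phi> u m0 q b)
        = swsum DA x (\<lambda>x1 x2. swsum \<delta>M (actM y a) (\<lambda>m0 m1.
          pr l1 x2 * pr l2 (mulA (A.prod v) m1) * (pr (B.prod p) x1 * \<Phi> u m0 q b)))"
        using \<open>l1 \<in> B\<close> x B.prod_lists_on[OF *(3)]
        by (simp add: pr_mul_B fs2_mult_right[symmetric]) (simp add: fs2_mult_left[symmetric] mult_ac)
    qed
    also have "\<dots> = swsum DA x (\<lambda>x1 x2. swsum \<delta>M (actM y a) (\<lambda>m0 m1. swsum DB l (\<lambda>l1 l2.
          pr l1 x2 * pr l2 (mulA (A.prod v) m1) * (pr (B.prod p) x1 * \<Phi> u m0 q b))))"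
      by (simp only: fs2_commute[of "sw (DB l)" "sw (DA x)"] fs2_commute[of "sw (DB l)" "sw (\<delta>M (actM y a))"])
    also have "\<dots> = swsum DA x (\<lambda>x1 x2. swsum \<delta>M (actM y a) (\<lambda>m0 m1. pr (B.prod p) x1 *
          (pr l (mulA (A.prod v) (mulA m1 x2)) * \<Phi> u m0 q b)))"
    proof (intro A.swD_cong[OF x] A.sw\<delta>_cong[OF ya])
      fix x1 x2 m0 m1 assume "x2 \<in> A" "m1 \<in> A"
      then have "swsum DB l (\<lambda>l1 l2. pr l1 x2 * pr l2 (mulA (A.prod v) m1)) = pr l (mulA (A.prod v) (mulA m1 x2))"
        using A.prod_lists_on[OF *(2)] by (simp add: pr_mul_A[OF l, symmetric] A.mul_closed A.mul_assoc)
      then show "swsum DB l (\<lambda>l1 l2. pr l1 x2 * pr l2 (mulA (A.prod v) m1) * (pr (B.prod p) x1 * \<Phi> u m0 q b))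
        = pr (B.prod p) x1 * (pr l (mulA (A.prod v) (mulA m1 x2)) * \<Phi> u m0 q b)"
        by (simp add: fs2_mult_right)
    qed
    finally show "swsum DA x (\<lambda>x1 x2. swsum \<delta>M (actM y a) (\<lambda>m0 m1. pr (B.prod p) x1 *
          (pr l (mulA (A.prod v) (mulA m1 x2)) * \<Phi> u m0 q b)))
      = swsum DB l (\<lambda>l1 l2. pr (mulB l1 (B.prod p)) x *
        swsum \<delta>M (actM y a) (\<lambda>m0 m1. pr l2 (A.prod (v @ [m1])) * \<Phi> u m0 q b))" ..
  qed
  also have "\<dots> = (- 1) ^ Suc n * swsum DB l (\<lambda>l1 l2. fs2 (sw_list DB ls) (\<lambda>p q. swsum DA h (\<lambda>x y.
      fs2 (sw_list DA hs) (\<lambda>u v. pr (mulB l1 (B.prod p)) x *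
        swsum \<delta>M (actM y a) (\<lambda>m0 m1. pr l2 (A.prod (v @ [m1])) * \<Phi> u m0 q b)))))"
    by (simp only: fs2_commute[of "sw_list DA hs" "sw_list DB ls"] fs2_commute[of "sw_list DA hs" "sw (DA h)"]
       fs2_commute[of "sw_list DA hs" "sw (DB l)"] fs2_commute[of "sw (DA h)" "sw (DB l)"] fs2_commute[of "sw_list DB ls" "sw (DB l)"])
  also have "\<dots> = tr_piH (tr_Hdpi \<Phi>) (hs @ [h]) a (l # ls) b"
    using hs unfolding tr_piH_snoc tr_Hdpi_Cons fs2_sw_list_Cons fs2_mult_left B.prod_Cons by (simp add: lists_on_def)
  finally show ?thesis ..
qed

text \<open>Both sides contain \<open>\<langle>l_(1), h_(1)\<rangle>\<close>, which comes from
  coassociativity in \<open>l\<close> on the left hand side and from coassociativity in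
  \<open>h\<close> on the right hand side; what remains are independent sums.\<close>

lemma piH_piHd_core:
  assumes c: "lin_on A sA c" and e: "lin_on B sB e" and h: "h \<in> A" and l: "l \<in> B"
    and \<phi>: "\<And>y. y \<in> N \<Longrightarrow> lin_on M sM (\<lambda>x. \<phi> x y)" "\<And>x. x \<in> M \<Longrightarrow> lin_on N sN (\<lambda>y. \<phi> x y)"
    and a: "a \<in> M" and b: "b \<in> N"
  shows "swsum DA h (\<lambda>h1 h2. swsum DB l (\<lambda>l1 l2. swsum DB l1 (\<lambda>x' y'. pr x' h1 * e y') *
      swsum DA h2 (\<lambda>x y. c x * \<phi> (actM y a) (actN l2 b))))
    = swsum DA h (\<lambda>h1 h2. swsum DB l (\<lambda>l1 l2. swsum DA h1 (\<lambda>x y. c y * pr l1 x) *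
      swsum DB l2 (\<lambda>k1 k2. e k1 * \<phi> (actM h2 a) (actN k2 b))))"
proof -
  have "swsum DA h (\<lambda>h1 h2. swsum DB l (\<lambda>l1 l2. swsum DB l1 (\<lambda>x' y'. pr x' h1 * e y') *
      swsum DA h2 (\<lambda>x y. c x * \<phi> (actM y a) (actN l2 b))))
    = swsum DA h (\<lambda>h1 h2. swsum DB l (\<lambda>l1 l2. swsum DB l1 (\<lambda>x' y'. pr x' h1 * (e y' *
      swsum DA h2 (\<lambda>x y. c x * \<phi> (actM y a) (actN l2 b))))))"
    by (simp only: fs2_mult_right[symmetric] mult.assoc)
  also have "\<dots> = swsum DA h (\<lambda>h1 h2. swsum DB l (\<lambda>l1 l2. swsum DB l2 (\<lambda>k1 k2. pr l1 h1 * (e k1 *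
      swsum DA h2 (\<lambda>x y. c x * \<phi> (actM y a) (actN k2 b))))))"
  proof (intro A.swD_cong[OF h] B.D_coassoc[OF trilin_onI l])
    fix h1 h2 assume h12: "h1 \<in> A" "h2 \<in> A"
    show "lin_on B sB (\<lambda>l1. pr l1 h1 * (e k1 * swsum DA h2 (\<lambda>x y. c x * \<phi> (actM y a) (actN k2 b))))" for k1 k2
      by (intro lin_on_mult_right pr_lin_B h12)
    show "lin_on B sB (\<lambda>k1. pr l1 h1 * (e k1 * swsum DA h2 (\<lambda>x y. c x * \<phi> (actM y a) (actN k2 b))))" for l1 k2
      by (intro lin_on_mult_left lin_on_mult_right e)
    show "lin_on B sB (\<lambda>k2. pr l1 h1 * (e k1 * swsum DA h2 (\<lambda>x y. c x * \<phi> (actM y a) (actN k2 b))))" for l1 k1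
      by (intro lin_on_mult_left A.lin_swD[OF h12(2)] B.lin_act_left[OF \<phi>(2) b] A.act_closed a)
  qed
  also have "\<dots> = swsum DB l (\<lambda>l1 l2. swsum DA h (\<lambda>h1 h2. swsum DA h2 (\<lambda>x y. pr l1 h1 * (c x *
      swsum DB l2 (\<lambda>k1 k2. e k1 * \<phi> (actM y a) (actN k2 b))))))"
  proof (subst fs2_commute, intro B.swD_cong[OF l] A.swD_cong[OF h])
    fix l1 l2 h1 h2
    show "swsum DB l2 (\<lambda>k1 k2. pr l1 h1 * (e k1 * swsum DA h2 (\<lambda>x y. c x * \<phi> (actM y a) (actN k2 b))))
      = swsum DA h2 (\<lambda>x y. pr l1 h1 * (c x * swsum DB l2 (\<lambda>k1 k2. e k1 * \<phi> (actM y a) (actN k2 b))))"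
      unfolding fs2_mult_left[symmetric]
      by (subst fs2_commute) (simp only: mult.left_commute)
  qed
  also have "\<dots> = swsum DB l (\<lambda>l1 l2. swsum DA h (\<lambda>h1 h2. swsum DA h1 (\<lambda>x y. pr l1 x * (c y *
      swsum DB l2 (\<lambda>k1 k2. e k1 * \<phi> (actM h2 a) (actN k2 b))))))"
  proof (intro B.swD_cong[OF l] A.D_coassoc[OF trilin_onI h, symmetric])
    fix l1 l2 assume l12: "l1 \<in> B" "l2 \<in> B"
    show "lin_on A sA (\<lambda>x. pr l1 x * (c y * swsum DB l2 (\<lambda>k1 k2. e k1 * \<phi> (actM h2 a) (actN k2 b))))" for y h2
      by (intro lin_on_mult_right pr_lin_A l12)
    show "lin_on A sA (\<lambda>y. pr l1 x * (c y * swsum DB l2 (\<lambda>k1 k2. e k1 * \<phi> (actM h2 a) (actN k2 b))))" for x h2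
      by (intro lin_on_mult_left lin_on_mult_right c)
    show "lin_on A sA (\<lambda>h2. pr l1 x * (c y * swsum DB l2 (\<lambda>k1 k2. e k1 * \<phi> (actM h2 a) (actN k2 b))))" for x y
      by (intro lin_on_mult_left B.lin_swD[OF l12(2)] A.lin_act_left[OF \<phi>(1) a] B.act_closed b)
  qed
  also have "\<dots> = swsum DA h (\<lambda>h1 h2. swsum DB l (\<lambda>l1 l2. swsum DA h1 (\<lambda>x y. c y * pr l1 x) *
      swsum DB l2 (\<lambda>k1 k2. e k1 * \<phi> (actM h2 a) (actN k2 b))))"
    by (subst fs2_commute) (simp only: fs2_mult_right[symmetric] mult.assoc mult.left_commute)
  finally show ?thesis .
qed

text \<open>Only the last entries \<open>h\<close> and \<open>l\<close> are decomposed twice, so everything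
  reduces to the preceding lemma, summed over the decompositions of the other entries.\<close>

lemma piH_piHd:
  assumes \<Phi>: "multilin n m \<Phi>" and hs: "hs \<in> lists_on A n" and h: "h \<in> A"
    and a: "a \<in> M" and ls: "ls \<in> lists_on B m" and l: "l \<in> B" and b: "b \<in> N"
  shows "tr_piH (tr_piHd \<Phi>) (hs @ [h]) a (ls @ [l]) b = tr_piHd (tr_piH \<Phi>) (hs @ [h]) a (ls @ [l]) b"
proof -
  have len: "length hs = n" "length ls = m" using hs ls by (auto simp: lists_on_def)
  have "tr_piHd (tr_piH \<Phi>) (hs @ [h]) a (ls @ [l]) b
    = (- 1) ^ Suc m * fs2 (sw_list DA hs) (\<lambda>u v. swsum DA h (\<lambda>h1 h2. swsum DB l (\<lambda>l1 l2. (- 1) ^ Suc n *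
        fs2 (sw_list DB ls) (\<lambda>p q. swsum DB l1 (\<lambda>x' y'. pr x' h1 * pr y' (A.prod u)) *
          swsum DA h2 (\<lambda>x y. pr (B.prod p) x * \<Phi> v (actM y a) q (actN l2 b))))))"
    unfolding tr_piHd_snoc fs2_sw_list_append fs2_sw_list_Cons fs2_sw_list_Nil len
  proof (intro arg_cong[where f = "(*) ((- 1) ^ Suc m)"] A.sw_list_cong[OF hs] A.swD_cong[OF h] B.swD_cong[OF l])
    fix u v h1 h2 l1 l2 assume *: "u \<in> lists_on A n" "v \<in> lists_on A n" "h1 \<in> A" "l1 \<in> B"
    then have "pr l1 (A.prod (u @ [h1])) = swsum DB l1 (\<lambda>x' y'. pr x' h1 * pr y' (A.prod u))"
      using A.prod_lists_on[OF *(1)] by (simp add: A.prod_snoc pr_mul_A lists_on_def)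
    then show "pr l1 (A.prod (u @ [h1])) * tr_piH \<Phi> (v @ [h2]) a ls (actN l2 b) = (- 1) ^ Suc n *
        fs2 (sw_list DB ls) (\<lambda>p q. swsum DB l1 (\<lambda>x' y'. pr x' h1 * pr y' (A.prod u)) *
          swsum DA h2 (\<lambda>x y. pr (B.prod p) x * \<Phi> v (actM y a) q (actN l2 b)))"
      using * by (simp add: tr_piH_snoc fs2_mult_left lists_on_def)
  qed
  also have "\<dots> = (- 1) ^ Suc m * ((- 1) ^ Suc n * fs2 (sw_list DA hs) (\<lambda>u v. fs2 (sw_list DB ls) (\<lambda>p q.
      swsum DA h (\<lambda>h1 h2. swsum DB l (\<lambda>l1 l2. swsum DB l1 (\<lambda>x' y'. pr x' h1 * pr y' (A.prod u)) *
          swsum DA h2 (\<lambda>x y. pr (B.prod p) x * \<Phi> v (actM y a) q (actN l2 b)))))))"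
    unfolding fs2_mult_left[of _ "(- 1) ^ Suc n"]
    by (simp only: fs2_commute[of "sw (DB l)" "sw_list DB ls"] fs2_commute[of "sw (DA h)" "sw_list DB ls"])
  also have "\<dots> = (- 1) ^ Suc m * ((- 1) ^ Suc n * fs2 (sw_list DA hs) (\<lambda>u v. fs2 (sw_list DB ls) (\<lambda>p q.
      swsum DA h (\<lambda>h1 h2. swsum DB l (\<lambda>l1 l2. swsum DA h1 (\<lambda>x y. pr (B.prod p) y * pr l1 x) *
          swsum DB l2 (\<lambda>k1 k2. pr k1 (A.prod u) * \<Phi> v (actM h2 a) q (actN k2 b)))))))"
  proof (intro arg_cong[where f = "(*) ((- 1) ^ Suc k)" for k] A.sw_list_cong[OF hs] B.sw_list_cong[OF ls])
    fix u v p q assume *: "u \<in> lists_on A n" "v \<in> lists_on A n" "p \<in> lists_on B m" "q \<in> lists_on B m"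
    show "swsum DA h (\<lambda>h1 h2. swsum DB l (\<lambda>l1 l2. swsum DB l1 (\<lambda>x' y'. pr x' h1 * pr y' (A.prod u)) *
          swsum DA h2 (\<lambda>x y. pr (B.prod p) x * \<Phi> v (actM y a) q (actN l2 b))))
      = swsum DA h (\<lambda>h1 h2. swsum DB l (\<lambda>l1 l2. swsum DA h1 (\<lambda>x y. pr (B.prod p) y * pr l1 x) *
          swsum DB l2 (\<lambda>k1 k2. pr k1 (A.prod u) * \<Phi> v (actM h2 a) q (actN k2 b))))"
      by (rule piH_piHd_core[where \<phi> = "\<lambda>x y. \<Phi> v x q y"])
        (auto intro!: pr_lin_A pr_lin_B A.prod_lists_on[OF *(1)] B.prod_lists_on[OF *(3)] h l a b
          multilin_a[OF \<Phi> *(2,4)] multilin_b[OF \<Phi> *(2) _ *(4)])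
  qed
  also have "\<dots> = (- 1) ^ Suc n * fs2 (sw_list DB ls) (\<lambda>p q. swsum DB l (\<lambda>l1 l2. swsum DA h (\<lambda>h1 h2. (- 1) ^ Suc m *
      fs2 (sw_list DA hs) (\<lambda>u v. swsum DA h1 (\<lambda>x y. pr (B.prod p) y * pr l1 x) *
          swsum DB l2 (\<lambda>k1 k2. pr k1 (A.prod u) * \<Phi> v (actM h2 a) q (actN k2 b))))))"
    unfolding fs2_mult_left[of _ "(- 1) ^ Suc m"] mult.left_commute[of "(- 1) ^ Suc n" "(- 1) ^ Suc m"]
    by (simp only: fs2_commute[of "sw_list DA hs" "sw_list DB ls"] fs2_commute[of "sw_list DA hs" "sw (DA h)"]
        fs2_commute[of "sw_list DA hs" "sw (DB l)"] fs2_commute[of "sw (DA h)" "sw (DB l)"])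
  also have "\<dots> = tr_piH (tr_piHd \<Phi>) (hs @ [h]) a (ls @ [l]) b"
    unfolding tr_piH_snoc fs2_sw_list_append fs2_sw_list_Cons fs2_sw_list_Nil len
  proof (intro arg_cong[where f = "(*) ((- 1) ^ Suc n)"] B.sw_list_cong[OF ls] A.swD_cong[OF h] B.swD_cong[OF l])
    fix p q h1 h2 l1 l2 assume *: "p \<in> lists_on B m" "q \<in> lists_on B m" "h1 \<in> A" "l1 \<in> B"
    then have "pr (B.prod (p @ [l1])) h1 = swsum DA h1 (\<lambda>x y. pr (B.prod p) y * pr l1 x)"
      using B.prod_lists_on[OF *(1)] by (simp add: B.prod_snoc pr_mul_B lists_on_def)
    then show "(- 1) ^ Suc m * fs2 (sw_list DA hs) (\<lambda>u v. swsum DA h1 (\<lambda>x y. pr (B.prod p) y * pr l1 x) *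
          swsum DB l2 (\<lambda>k1 k2. pr k1 (A.prod u) * \<Phi> v (actM h2 a) q (actN k2 b)))
      = pr (B.prod (p @ [l1])) h1 * tr_piHd \<Phi> hs (actM h2 a) (q @ [l2]) b"
      using * by (simp add: tr_piHd_snoc fs2_mult_left lists_on_def)
  qed
  finally show ?thesis ..
qed

end

section \<open>The bidifferential on functionals\<close>

context yd_pair
begin

interpretation flip: yd_pair B sB mulB oneB DB N sN actN \<delta>N A sA mulA oneA DA M sM actM \<delta>M "\<lambda>h l. pr l h"
  by (rule flip)

text \<open>With the mirror image of the whole theory available, the relations not yet proved follow from
  their mirror images: \<open>piH_cob\<close> from \<open>bar_piHd\<close>,
  \<open>Hpi_cob\<close> from \<open>bar_Hdpi\<close>, and \<open>Hpi_piHd\<close> from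
  \<open>piH_Hdpi\<close>.\<close>

lemma flip_multilin: "flip.multilin m n (\<lambda>ls b hs a. \<Phi> hs a ls b) \<longleftrightarrow> multilin n m \<Phi>"
  by (auto simp: multilin_def flip.multilin_def)

text \<open>The second differential without its sign \<open>(-1)^n\<close>. The roles of \<open>s\<close>
  and \<open>t\<close> are exchanged because the mirror image of \<open>\<pi>^H\<close> is
  \<open>\<pi>^{H*}\<close>, which occurs together with \<open>{}^H\<pi>\<close>.\<close>

definition tr_d' where "tr_d' s t \<Phi> hs a ls b = flip.tr_d t s (\<lambda>ls b hs a. \<Phi> hs a ls b) ls b hs a"

lemma tr_d'_eq: "tr_d' s t \<Phi> hs a ls b = tr_cob \<Phi> hs a ls b + s * tr_Hdpi \<Phi> hs a ls b + t * tr_piHd \<Phi> hs a ls b"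
  by (simp add: tr_d'_def flip.tr_d_def tr_cob_def tr_Hdpi_def tr_piHd_def)

lemma tr_d'_Nil [simp]: "tr_d' s t \<Phi> hs a [] b = 0"
  by (simp add: tr_d'_def)

lemma tr_d'_tr_d'_short: "length ls < 2 \<Longrightarrow> tr_d' s t (tr_d' s t \<Phi>) hs a ls b = 0"
  by (simp add: tr_d'_def[abs_def] flip.tr_d_tr_d_short)

lemma tr_d'_tr_d':
  assumes "multilin n m \<Phi>" "hs \<in> lists_on A n" "a \<in> M" "ls \<in> lists_on B (Suc (Suc m))" "b \<in> N"
    and "s * s = s" "t * t = t"
  shows "tr_d' s t (tr_d' s t \<Phi>) hs a ls b = 0"
  using assms by (simp add: tr_d'_def[abs_def] flip.tr_d_tr_d[of m n] flip_multilin)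

lemma multilin_tr_d':
  assumes "\<And>n m. n + m = k \<Longrightarrow> multilin n m \<Phi>" "n + m = Suc k"
  shows "multilin n m (tr_d' s t \<Phi>)"
proof -
  have "flip.multilin m n (flip.tr_d t s (\<lambda>ls b hs a. \<Phi> hs a ls b))"
    by (rule flip.multilin_tr_d[of k]) (use assms in \<open>auto simp: flip_multilin\<close>)
  then show ?thesis
    unfolding tr_d'_def[abs_def] by (subst flip_multilin[symmetric]) simp
qed

lemma flip_tr_piHd: "flip.tr_piHd \<Phi> ls b hs a = tr_piH (\<lambda>hs a ls b. \<Phi> ls b hs a) hs a ls b"
  and flip_tr_Hdpi: "flip.tr_Hdpi \<Phi> ls b hs a = tr_Hpi (\<lambda>hs a ls b. \<Phi> ls b hs a) hs a ls b"
  by (simp_all add: flip.tr_piHd_def flip.tr_Hdpi_def)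

lemma piH_cob:
  assumes "multilin n m \<Phi>" "hs \<in> lists_on A n" "h \<in> A" "a \<in> M" "ls \<in> lists_on B (Suc m)" "b \<in> N"
  shows "tr_cob (tr_piH \<Phi>) (hs @ [h]) a ls b = tr_piH (tr_cob \<Phi>) (hs @ [h]) a ls b"
  using flip.bar_piHd[of m n "\<lambda>ls b hs a. \<Phi> hs a ls b" ls b hs h a] assms
  by (simp add: flip_multilin flip_tr_piHd tr_cob_def flip_tr_piHd[abs_def] tr_cob_def[abs_def])

lemma Hpi_cob:
  assumes "multilin n m \<Phi>" "hs \<in> lists_on A n" "h \<in> A" "a \<in> M" "ls \<in> lists_on B (Suc m)" "b \<in> N"
  shows "tr_cob (tr_Hpi \<Phi>) (h # hs) a ls b = tr_Hpi (tr_cob \<Phi>) (h # hs) a ls b"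
  using flip.bar_Hdpi[of m n "\<lambda>ls b hs a. \<Phi> hs a ls b" ls b hs h a] assms
  by (simp add: flip_multilin flip_tr_Hdpi tr_cob_def flip_tr_Hdpi[abs_def] tr_cob_def[abs_def])

lemma Hpi_piHd:
  assumes "multilin n m \<Phi>" "hs \<in> lists_on A n" "h \<in> A" "a \<in> M" "ls \<in> lists_on B m" "l \<in> B" "b \<in> N"
  shows "tr_piHd (tr_Hpi \<Phi>) (h # hs) a (ls @ [l]) b = tr_Hpi (tr_piHd \<Phi>) (h # hs) a (ls @ [l]) b"
  using flip.piH_Hdpi[of m n "\<lambda>ls b hs a. \<Phi> hs a ls b" ls l b hs h a] assms
  by (simp add: flip_multilin flip_tr_Hdpi tr_piHd_def flip_tr_Hdpi[abs_def] tr_piHd_def[abs_def])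

text \<open>Nine commutation relations, one for each pair of summands.\<close>

lemma tr_d_tr_d':
  assumes \<Phi>: "multilin n m \<Phi>" and hs: "hs \<in> lists_on A (Suc n)"
    and a: "a \<in> M" and ls: "ls \<in> lists_on B (Suc m)" and b: "b \<in> N"
  shows "tr_d s t (tr_d' s t \<Phi>) hs a ls b = tr_d' s t (tr_d s t \<Phi>) hs a ls b"
proof -
  obtain h us where hh: "hs = h # us" "us \<in> lists_on A n" "h \<in> A"
    using hs by (elim lists_on_Suc_ConsE) auto
  obtain h' us' where ht: "hs = us' @ [h']" "us' \<in> lists_on A n" "h' \<in> A"
    using hs by (elim lists_on_SucE) auto
  obtain l vs where lh: "ls = l # vs" "vs \<in> lists_on B m" "l \<in> B"
    using ls by (elim lists_on_Suc_ConsE) auto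
  obtain l' vs' where lt: "ls = vs' @ [l']" "vs' \<in> lists_on B m" "l' \<in> B"
    using ls by (elim lists_on_SucE) auto
  note 1 = bar_cob[of \<Phi> hs a ls b]
  have 2: "tr_bar (tr_Hdpi \<Phi>) hs a ls b = tr_Hdpi (tr_bar \<Phi>) hs a ls b"
    unfolding lh(1) by (rule bar_Hdpi[OF \<Phi> hs a lh(2,3) b])
  have 3: "tr_bar (tr_piHd \<Phi>) hs a ls b = tr_piHd (tr_bar \<Phi>) hs a ls b"
    unfolding lt(1) by (rule bar_piHd[OF \<Phi> hs a lt(2,3) b])
  have 4: "tr_piH (tr_cob \<Phi>) hs a ls b = tr_cob (tr_piH \<Phi>) hs a ls b"
    unfolding ht(1) by (rule piH_cob[OF \<Phi> ht(2,3) a ls b, symmetric])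
  have 5: "tr_piH (tr_Hdpi \<Phi>) hs a ls b = tr_Hdpi (tr_piH \<Phi>) hs a ls b"
    unfolding ht(1) lh(1) by (rule piH_Hdpi[OF \<Phi> ht(2,3) a lh(2,3) b])
  have 6: "tr_piH (tr_piHd \<Phi>) hs a ls b = tr_piHd (tr_piH \<Phi>) hs a ls b"
    unfolding ht(1) lt(1) by (rule piH_piHd[OF \<Phi> ht(2,3) a lt(2,3) b])
  have 7: "tr_Hpi (tr_cob \<Phi>) hs a ls b = tr_cob (tr_Hpi \<Phi>) hs a ls b"
    unfolding hh(1) by (rule Hpi_cob[OF \<Phi> hh(2,3) a ls b, symmetric])
  have 8: "tr_Hpi (tr_Hdpi \<Phi>) hs a ls b = tr_Hdpi (tr_Hpi \<Phi>) hs a ls b"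
    unfolding hh(1) lh(1) by (rule Hpi_Hdpi[OF hh(2,3) a lh(2,3) b])
  have 9: "tr_Hpi (tr_piHd \<Phi>) hs a ls b = tr_piHd (tr_Hpi \<Phi>) hs a ls b"
    unfolding hh(1) lt(1) by (rule Hpi_piHd[OF \<Phi> hh(2,3) a lt(2,3) b, symmetric])
  have d: "tr_d s t \<Phi> = (\<lambda>hs a ls b. tr_bar \<Phi> hs a ls b + s * tr_piH \<Phi> hs a ls b + t * tr_Hpi \<Phi> hs a ls b)"
    by (intro ext) (rule tr_d_def)
  have e: "tr_d' s t \<Phi> = (\<lambda>hs a ls b. tr_cob \<Phi> hs a ls b + s * tr_Hdpi \<Phi> hs a ls b + t * tr_piHd \<Phi> hs a ls b)"
    by (intro ext) (rule tr_d'_eq)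
  have lin: "tr_cob (\<lambda>hs a ls b. F hs a ls b + G hs a ls b) hs a ls b = tr_cob F hs a ls b + tr_cob G hs a ls b"
    "tr_cob (\<lambda>hs a ls b. c * F hs a ls b) hs a ls b = c * tr_cob F hs a ls b"
    "tr_Hdpi (\<lambda>hs a ls b. F hs a ls b + G hs a ls b) hs a ls b = tr_Hdpi F hs a ls b + tr_Hdpi G hs a ls b"
    "tr_Hdpi (\<lambda>hs a ls b. c * F hs a ls b) hs a ls b = c * tr_Hdpi F hs a ls b"
    "tr_piHd (\<lambda>hs a ls b. F hs a ls b + G hs a ls b) hs a ls b = tr_piHd F hs a ls b + tr_piHd G hs a ls b"
    "tr_piHd (\<lambda>hs a ls b. c * F hs a ls b) hs a ls b = c * tr_piHd F hs a ls b" for F G c hs a ls b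
    by (simp_all add: tr_cob_def tr_Hdpi_def tr_piHd_def flip.tr_linear)
  show ?thesis
    unfolding tr_d_def[of s t "tr_d' s t \<Phi>"] tr_d'_eq[of s t "tr_d s t \<Phi>"]
    unfolding d e tr_linear lin 1 2 3 4 5 6 7 8 9
    by (simp add: algebra_simps)
qed

lemma tr_d'_tr_d_Nil: "tr_d' s t (tr_d s t \<Phi>) [] a ls b = 0"
  by (simp add: tr_d'_eq tr_cob_eq tr_Hdpi_def tr_piHd_def flip.tr_Hpi_def flip.tr_piH_def)

lemma tr_d_tr_d'_Nil: "tr_d s t (tr_d' s t \<Phi>) hs a [] b = 0"
  by (simp add: tr_d_def tr_bar_def tr_piH_def tr_Hpi_def)

text \<open>The case distinctions deal with short lists, on which the maps vanish by convention.\<close>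

lemma bidifferential_on_functionals:
  assumes \<Phi>: "\<And>n m. n + m = k \<Longrightarrow> multilin n m \<Phi>"
    and hs: "set hs \<subseteq> A" and a: "a \<in> M" and ls: "set ls \<subseteq> B" and b: "b \<in> N"
    and len: "length hs + length ls = Suc (Suc k)"
    and st: "s * s = s" "t * t = t"
  shows "tr_d s t (tr_d s t \<Phi>) hs a ls b = 0"
    and "tr_d' s t (tr_d' s t \<Phi>) hs a ls b = 0"
    and "tr_d s t (tr_d' s t \<Phi>) hs a ls b = tr_d' s t (tr_d s t \<Phi>) hs a ls b"
proof -
  have L: "hs \<in> lists_on A (length hs)" "ls \<in> lists_on B (length ls)"
    using hs ls by (auto simp: lists_on_def)
  show "tr_d s t (tr_d s t \<Phi>) hs a ls b = 0"
  proof (cases "length hs < 2")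
    case False
    then obtain n where n: "length hs = Suc (Suc n)" by (metis less_2_cases_iff not0_implies_Suc One_nat_def)
    show ?thesis
      by (rule tr_d_tr_d[OF \<Phi>[of n] _ a L(2) b st]) (use n len L in auto)
  qed (rule tr_d_tr_d_short)
  show "tr_d' s t (tr_d' s t \<Phi>) hs a ls b = 0"
  proof (cases "length ls < 2")
    case False
    then obtain n where n: "length ls = Suc (Suc n)" by (metis less_2_cases_iff not0_implies_Suc One_nat_def)
    show ?thesis
      by (rule tr_d'_tr_d'[OF \<Phi>[of _ n] L(1) a _ b st]) (use n len L in auto)
  qed (rule tr_d'_tr_d'_short)
  show "tr_d s t (tr_d' s t \<Phi>) hs a ls b = tr_d' s t (tr_d s t \<Phi>) hs a ls b"
  proof (cases "hs = [] \<or> ls = []")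
    case True then show ?thesis by (auto simp: tr_d'_tr_d_Nil tr_d_tr_d'_Nil)
  next
    case False
    then obtain n m where "length hs = Suc n" "length ls = Suc m" by (cases hs; cases ls) auto
    then show ?thesis
      using L len by (intro tr_d_tr_d'[OF \<Phi>[of n m] _ a _ b]) auto
  qed
qed

lemma tr_d'_sign:
  assumes hs: "hs \<in> lists_on A n" and a: "a \<in> M" and ls: "ls \<in> lists_on B m" and b: "b \<in> N"
  shows "tr_d' s t (\<lambda>hs a ls b. (- 1) ^ length hs * \<Phi> hs a ls b) hs a ls b = (- 1) ^ n * tr_d' s t \<Phi> hs a ls b"
proof (cases m)
  case 0 then show ?thesis using ls by (simp add: lists_on_def)
next
  case (Suc k)
  have "flip.tr_d t s (\<lambda>ls b hs a. (- 1) ^ length hs * \<Phi> hs a ls b) ls b hs a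
    = flip.tr_d t s (\<lambda>ls b hs a. (- 1) ^ n * \<Phi> hs a ls b) ls b hs a"
    by (rule flip.tr_d_cong[OF _ ls[unfolded Suc] b hs a]) (simp add: lists_on_def)
  then show ?thesis by (simp add: tr_d'_def flip.tr_d_mult)
qed

lemma multilin_sign:
  assumes "multilin n m \<Phi>"
  shows "multilin n m (\<lambda>hs a ls b. (- 1) ^ length hs * \<Phi> hs a ls b)"
proof -
  have "lin_on X s (\<lambda>x. (- 1) ^ length (us @ x # vs) * F (us @ x # vs))"
    if "lin_on X s (\<lambda>x. F (us @ x # vs))" for X and s :: "'k \<Rightarrow> 'a \<Rightarrow> 'a" and us vs F
    using lin_on_mult_left[OF that, of "(- 1) ^ (length us + Suc (length vs))"] by simp
  with assms show ?thesis
    by (simp add: multilin_def multilin_on_def lin_on_mult_left)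
qed

end

section \<open>Presented quotients\<close>

lemma annihilates_Un: "annihilates (R \<union> R') \<Phi> \<longleftrightarrow> annihilates R \<Phi> \<and> annihilates R' \<Phi>"
  by (auto simp: annihilates_def)

text \<open>Slot by slot, this identifies the functionals on a tensor product with the multilinear
  functionals.\<close>

lemma annihilates_slot_rels:
  "annihilates (slot_rels G A s U) \<Phi> \<longleftrightarrow> (\<forall>u\<in>U. u ` A \<subseteq> G \<longrightarrow> lin_on A s (\<lambda>x. \<Phi> (u x)))"
proof
  assume ann: "annihilates (slot_rels G A s U) \<Phi>"
  show "\<forall>u\<in>U. u ` A \<subseteq> G \<longrightarrow> lin_on A s (\<lambda>x. \<Phi> (u x))"
  proof (intro ballI impI lin_onI)
    fix u x y c assume u: "u \<in> U" "u ` A \<subseteq> G" and x: "x \<in> A"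
    have "fgen (u (s c x)) - fscale c (fgen (u x)) \<in> slot_rels G A s U"
      unfolding slot_rels_def
      by (rule UnI2, rule CollectI, rule exI[of _ u], rule exI[of _ c], rule exI[of _ x]) (use u x in simp)
    then have "fsum (fgen (u (s c x)) - fscale c (fgen (u x))) \<Phi> = 0"
      using ann unfolding annihilates_def by blast
    then show "\<Phi> (u (s c x)) = c * \<Phi> (u x)"
      by (simp add: fsum_diff fsum_fscale)
    assume y: "y \<in> A"
    have "fgen (u (x + y)) - fgen (u x) - fgen (u y) \<in> slot_rels G A s U"
      unfolding slot_rels_def
      by (rule UnI1, rule CollectI, rule exI[of _ u], rule exI[of _ x], rule exI[of _ y]) (use u x y in simp)
    then have "fsum (fgen (u (x + y)) - fgen (u x) - fgen (u y)) \<Phi> = 0"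
      using ann unfolding annihilates_def by blast
    then show "\<Phi> (u (x + y)) = \<Phi> (u x) + \<Phi> (u y)"
      by (simp add: fsum_diff fsum_add diff_diff_eq)
  qed
next
  assume "\<forall>u\<in>U. u ` A \<subseteq> G \<longrightarrow> lin_on A s (\<lambda>x. \<Phi> (u x))"
  note lin = this[rule_format, unfolded lin_on_def]
  show "annihilates (slot_rels G A s U) \<Phi>"
    unfolding annihilates_def slot_rels_def
  proof (safe, goal_cases)
    case (1 _ u x y) then show ?case using lin[of u] by (simp add: fsum_diff)
  next
    case (2 _ u c x) then show ?case using lin[of u] by (simp add: fsum_diff fsum_fscale)
  qed
qed

lemma presented_keys:
  "(p, q) \<in> presented G R \<Longrightarrow> Poly_Mapping.keys p \<subseteq> G \<and> Poly_Mapping.keys q \<subseteq> G"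
  by (simp add: presented_def)

lemma presented_refl: "Poly_Mapping.keys p \<subseteq> G \<Longrightarrow> (p, p) \<in> presented G R"
  by (simp add: presented_iff)

lemma presented_sym: "(p, q) \<in> presented G R \<Longrightarrow> (q, p) \<in> presented G R"
  by (simp add: presented_iff)

lemma presented_trans: "(p, q) \<in> presented G R \<Longrightarrow> (q, r) \<in> presented G R \<Longrightarrow> (p, r) \<in> presented G R"
  by (simp add: presented_iff)

lemma presented_class_eq: "(p, q) \<in> presented G R \<Longrightarrow> presented G R `` {p} = presented G R `` {q}"
  using presented_sym[of _ _ G R] presented_trans[of _ _ G R] by blast

lemma qcarrierE:
  assumes "t \<in> qcarrier (presented G R)"
  obtains p where "Poly_Mapping.keys p \<subseteq> G" "t = presented G R `` {p}"
  using assms by (auto simp: qcarrier_def quotient_def presented_def)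

lemma qcarrierI: "Poly_Mapping.keys p \<subseteq> G \<Longrightarrow> presented G R `` {p} \<in> qcarrier (presented G R)"
  using presented_refl[of p G R] by (auto simp: qcarrier_def quotient_def)

lemma sw_class:
  assumes "Poly_Mapping.keys p \<subseteq> G"
  shows "(p, sw (presented G R `` {p})) \<in> presented G R"
proof -
  have "p \<in> presented G R `` {p}" using presented_refl[OF assms] by simp
  then have "sw (presented G R `` {p}) \<in> presented G R `` {p}" unfolding sw_def by (rule someI)
  then show ?thesis by simp
qed

lemma sw_keys:
  assumes "t \<in> qcarrier (presented G R)"
  shows "Poly_Mapping.keys (sw t) \<subseteq> G"
proof -
  from assms obtain p where "Poly_Mapping.keys p \<subseteq> G" "t = presented G R `` {p}" by (rule qcarrierE)
  then show ?thesis using presented_keys[OF sw_class[of p G R]] by simp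
qed

lemma class_sw:
  assumes "t \<in> qcarrier (presented G R)"
  shows "presented G R `` {sw t} = t"
proof -
  from assms obtain p where "Poly_Mapping.keys p \<subseteq> G" "t = presented G R `` {p}" by (rule qcarrierE)
  then show ?thesis using presented_class_eq[OF sw_class[of p G R]] by simp
qed

lemma presented_add:
  "(p, p') \<in> presented G R \<Longrightarrow> (q, q') \<in> presented G R \<Longrightarrow> (p + q, p' + q') \<in> presented G R"
  using keys_add[of p q] keys_add[of p' q'] by (auto simp: presented_iff fsum_add)

lemma presented_fscale: "(p, p') \<in> presented G R \<Longrightarrow> (fscale c p, fscale c p') \<in> presented G R"
  using keys_fscale[of c p] keys_fscale[of c p'] by (auto simp: presented_iff fsum_fscale)

lemma qadd_class:
  assumes "Poly_Mapping.keys p \<subseteq> G" "Poly_Mapping.keys q \<subseteq> G"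
  shows "qadd (presented G R) (presented G R `` {p}) (presented G R `` {q}) = presented G R `` {p + q}"
proof -
  have "presented G R `` {p' + q'} = presented G R `` {p + q}"
    if "(p, p') \<in> presented G R" "(q, q') \<in> presented G R" for p' q'
    using presented_add[OF that] by (rule presented_class_eq[symmetric])
  then show ?thesis
    unfolding qadd_def using presented_refl[OF assms(1), of R] presented_refl[OF assms(2), of R] by blast
qed

lemma qscale_class:
  assumes "Poly_Mapping.keys p \<subseteq> G"
  shows "qscale (presented G R) c (presented G R `` {p}) = presented G R `` {fscale c p}"
proof -
  have "presented G R `` {fscale c p'} = presented G R `` {fscale c p}" if "(p, p') \<in> presented G R" for p'
    using presented_fscale[OF that] by (rule presented_class_eq[symmetric])
  then show ?thesis
    unfolding qscale_def using presented_refl[OF assms(1), of R] by blast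
qed

text \<open>A linear map into a quotient, composed with a functional on the quotient, is a linear form,
  whatever representatives \<open>sw\<close> chooses.\<close>

lemma linear_into_fsum:
  assumes f: "linear_into s (presented G R) f" and \<Phi>: "annihilates R \<Phi>"
  shows "lin_on UNIV s (\<lambda>x. fsum (sw (f x)) \<Phi>)"
proof (rule lin_onI)
  have q: "f x \<in> qcarrier (presented G R)" for x using f by (simp add: linear_into_def)
  note k = sw_keys[OF q]
  have cl: "f x = presented G R `` {sw (f x)}" for x using class_sw[OF q] by simp
  have eq: "fsum (sw (presented G R `` {p})) \<Phi> = fsum p \<Phi>" if "Poly_Mapping.keys p \<subseteq> G" for p
    using sw_class[OF that, of R] \<Phi> by (auto simp: presented_iff)
  fix x y c
  have "f (x + y) = qadd (presented G R) (f x) (f y)" using f by (simp add: linear_into_def)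
  also have "\<dots> = presented G R `` {sw (f x) + sw (f y)}"
    by (subst (1 2) cl) (rule qadd_class[OF k k])
  finally have add: "f (x + y) = presented G R `` {sw (f x) + sw (f y)}" .
  show "fsum (sw (f (x + y))) \<Phi> = fsum (sw (f x)) \<Phi> + fsum (sw (f y)) \<Phi>"
    using k[of x] k[of y] keys_add[of "sw (f x)" "sw (f y)"] by (subst add, subst eq) (auto simp: fsum_add)
  have "f (s c x) = qscale (presented G R) c (f x)" using f by (simp add: linear_into_def)
  also have "\<dots> = presented G R `` {fscale c (sw (f x))}"
    by (subst cl) (rule qscale_class[OF k])
  finally have scale: "f (s c x) = presented G R `` {fscale c (sw (f x))}" .
  show "fsum (sw (f (s c x))) \<Phi> = c * fsum (sw (f x)) \<Phi>"
    using k[of x] keys_fscale[of c "sw (f x)"] by (subst scale, subst eq) (auto simp: fsum_fscale)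
qed

lemma annihilates_tensor2:
  "annihilates (slot_rels (A \<times> B) A sA {\<lambda>x. (x, y) | y. True} \<union>
      slot_rels (A \<times> B) B sB {\<lambda>y. (x, y) | x. True}) \<Phi> \<longleftrightarrow> bilin_on A sA B sB (\<lambda>x y. \<Phi> (x, y))"
proof (cases "A = {} \<or> B = {}")
  \<comment> \<open>With an empty factor every condition is vacuous.\<close>
  case True
  then show ?thesis
    unfolding annihilates_Un annihilates_slot_rels bilin_on_def by (auto simp: lin_on_def[of "{}"] image_subset_iff)
next
  case False
  then obtain x0 y0 where ne: "x0 \<in> A" "y0 \<in> B" by blast
  show ?thesis
    unfolding annihilates_Un annihilates_slot_rels bilin_on_def
  proof (intro conj_cong iffI ballI impI)
    fix y assume "\<forall>u\<in>{\<lambda>x. (x, y) | y. True}. u ` A \<subseteq> A \<times> B \<longrightarrow> lin_on A sA (\<lambda>x. \<Phi> (u x))" "y \<in> B"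
    then show "lin_on A sA (\<lambda>x. \<Phi> (x, y))" by (auto simp: image_subset_iff dest!: bspec[of _ _ "\<lambda>x. (x, y)"])
  next
    fix u assume lin: "\<forall>y\<in>B. lin_on A sA (\<lambda>x. \<Phi> (x, y))"
      and u: "u \<in> {\<lambda>x. (x, y) | y. True}" "u ` A \<subseteq> A \<times> B"
    then obtain y where "u = (\<lambda>x. (x, y))" by blast
    then show "lin_on A sA (\<lambda>x. \<Phi> (u x))" using lin u(2) ne(1) by auto
  next
    fix x assume "\<forall>u\<in>{\<lambda>y. (x, y) | x. True}. u ` B \<subseteq> A \<times> B \<longrightarrow> lin_on B sB (\<lambda>x. \<Phi> (u x))" "x \<in> A"
    then show "lin_on B sB (\<lambda>y. \<Phi> (x, y))" by (auto simp: image_subset_iff dest!: bspec[of _ _ "\<lambda>y. (x, y)"])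
  next
    fix u assume lin: "\<forall>x\<in>A. lin_on B sB (\<lambda>y. \<Phi> (x, y))"
      and u: "u \<in> {\<lambda>y. (x, y) | x. True}" "u ` B \<subseteq> A \<times> B"
    then obtain x where "u = (\<lambda>y. (x, y))" by blast
    then show "lin_on B sB (\<lambda>y. \<Phi> (u y))" using lin u(2) ne(2) by auto
  qed
qed

lemma annihilates_tensor3:
  assumes "trilin_on A sA B sB C sC (\<lambda>x y z. \<Phi> (x, y, z))"
  shows "annihilates (slot_rels (A \<times> B \<times> C) A sA {\<lambda>x. (x, y, z) | y z. True} \<union>
      slot_rels (A \<times> B \<times> C) B sB {\<lambda>y. (x, y, z) | x z. True} \<union>
      slot_rels (A \<times> B \<times> C) C sC {\<lambda>z. (x, y, z) | x y. True}) \<Phi>"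
  unfolding annihilates_Un annihilates_slot_rels
proof (intro conjI ballI impI)
  fix u assume u: "u \<in> {\<lambda>x. (x, y, z) | y z. True}" "u ` A \<subseteq> A \<times> B \<times> C"
  then obtain y z where "u = (\<lambda>x. (x, y, z))" by blast
  with u(2) assms show "lin_on A sA (\<lambda>x. \<Phi> (u x))"
    by (cases "A = {}") (auto simp: trilin_on_def lin_on_def[of "{}"] image_subset_iff)
next
  fix u assume u: "u \<in> {\<lambda>y. (x, y, z) | x z. True}" "u ` B \<subseteq> A \<times> B \<times> C"
  then obtain x z where "u = (\<lambda>y. (x, y, z))" by blast
  with u(2) assms show "lin_on B sB (\<lambda>x. \<Phi> (u x))"
    by (cases "B = {}") (auto simp: trilin_on_def lin_on_def[of "{}"] image_subset_iff)
next
  fix u assume u: "u \<in> {\<lambda>z. (x, y, z) | x y. True}" "u ` C \<subseteq> A \<times> B \<times> C"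
  then obtain x y where "u = (\<lambda>z. (x, y, z))" by blast
  with u(2) assms show "lin_on C sC (\<lambda>x. \<Phi> (u x))"
    by (cases "C = {}") (auto simp: trilin_on_def lin_on_def[of "{}"] image_subset_iff)
qed

lemma tensor2_fs2:
  assumes "(p, q) \<in> tensor2 A sA B sB" "bilin_on A sA B sB \<beta>"
  shows "fs2 p \<beta> = fs2 q \<beta>"
proof -
  have "bilin_on A sA B sB (\<lambda>x y. case (x, y) of (x, y) \<Rightarrow> \<beta> x y)" using assms(2) by simp
  then show ?thesis
    using assms(1) unfolding tensor2_def presented_iff annihilates_tensor2 fs2_def by blast
qed

lemma tensor2I:
  assumes "Poly_Mapping.keys p \<subseteq> A \<times> B" "Poly_Mapping.keys q \<subseteq> A \<times> B"
    and "\<And>\<beta>. bilin_on A sA B sB \<beta> \<Longrightarrow> fs2 p \<beta> = fs2 q \<beta>"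
  shows "(p, q) \<in> tensor2 A sA B sB"
  unfolding tensor2_def presented_iff annihilates_tensor2
proof (intro conjI allI impI assms(1,2))
  fix \<Phi> assume "bilin_on A sA B sB (\<lambda>x y. \<Phi> (x, y))"
  from assms(3)[OF this] show "fsum p \<Phi> = fsum q \<Phi>" by (simp add: fs2_def)
qed

lemma tensor3_fsum:
  assumes "(p, q) \<in> tensor3 A sA B sB C sC" "trilin_on A sA B sB C sC \<tau>"
  shows "fsum p (\<lambda>(x, y, z). \<tau> x y z) = fsum q (\<lambda>(x, y, z). \<tau> x y z)"
proof -
  have "trilin_on A sA B sB C sC (\<lambda>x y z. case (x, y, z) of (x, y, z) \<Rightarrow> \<tau> x y z)" using assms(2) by simp
  from annihilates_tensor3[OF this] show ?thesis
    using assms(1) unfolding tensor3_def presented_iff by blast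
qed

lemma linear_into_fs2:
  assumes "linear_into s (tensor2 A sA B sB) f" "bilin_on A sA B sB \<beta>"
  shows "lin_on UNIV s (\<lambda>x. fs2 (sw (f x)) \<beta>)"
  unfolding fs2_def
  by (rule linear_into_fsum[OF assms(1)[unfolded tensor2_def]])
    (rule annihilates_tensor2[THEN iffD2], simp add: assms(2))

section \<open>Yetter-Drinfeld modules in terms of functionals\<close>

lemma fsum_sw2:
  "fsum (fbind (sw t) (\<lambda>(x, y). fbind (sw (f x y)) (\<lambda>(u, v). fgen (F x y u v)))) \<Phi>
     = fs2 (sw t) (\<lambda>x y. fs2 (sw (f x y)) (\<lambda>u v. \<Phi> (F x y u v)))"
  unfolding fs2_def fsum_fbind by (intro fsum_cong) (auto simp: fsum_fbind split_def)

lemma fs2_sw2: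
  "fs2 (fbind (sw t) (\<lambda>(x, y). fbind (sw (f x y)) (\<lambda>(u, v). fgen (F x y u v, G x y u v)))) \<beta>
     = fs2 (sw t) (\<lambda>x y. fs2 (sw (f x y)) (\<lambda>u v. \<beta> (F x y u v) (G x y u v)))"
  by (simp add: fs2_def[of "fbind p g" for p g] fsum_sw2)

text \<open>Each axiom stated as an equality of tensors is evaluated on a multilinear functional.\<close>

lemma yetter_drinfeld_yd_on:
  assumes "yetter_drinfeld sH \<Delta> \<epsilon> sM act \<delta>"
  shows "yd_on UNIV sH (*) 1 \<Delta> UNIV sM act \<delta>"
proof -
  interpret yetter_drinfeld sH \<Delta> \<epsilon> sM act \<delta> by fact
  show ?thesis
  proof (rule yd_on.intro, goal_cases)
    case (10 f y) then show ?case by (simp add: lin_on_def distrib_right scale_mult_left)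
  next
    case (11 f x) then show ?case by (simp add: lin_on_def distrib_left scale_mult_right)
  next
    case (12 g a) then show ?case by (simp add: lin_on_def act_add_left act_scale_left)
  next
    case (13 g x) then show ?case by (simp add: lin_on_def act_add_right act_scale_right)
  next
    case (14 \<beta>) then show ?case by (rule linear_into_fs2[OF comult_linear])
  next
    case (15 \<gamma>) then show ?case by (rule linear_into_fs2[OF coact_linear])
  next
    case (16 \<tau> x)
    from tensor3_fsum[OF coassoc 16(1), of x] show ?case by (simp only: fsum_sw2 prod.case)
  next
    case (17 \<beta> x y)
    from tensor2_fs2[OF comult_mult 17(1), of x y] show ?case by (simp only: fs2_sw2)
  next
    case (18 \<beta>)
    have "\<Delta> 1 \<in> qcarrier (tensor2 UNIV sH UNIV sH)" using comult_linear by (simp add: linear_into_def)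
    then have "(sw (\<Delta> 1), fgen (1, 1)) \<in> tensor2 UNIV sH UNIV sH"
      using comult_one class_sw unfolding tensor2_def by blast
    from tensor2_fs2[OF this 18] show ?case by simp
  next
    case (19 \<sigma> a)
    from tensor3_fsum[OF coact_coassoc 19(1), of a] show ?case by (simp only: fsum_sw2 prod.case)
  next
    case (20 \<gamma> x a)
    from tensor2_fs2[OF yd_compat 20(1), of x a] show ?case by (simp only: fs2_sw2)
  qed (simp_all add: mult.assoc act_mult)
qed

section \<open>Differentials on presented quotients\<close>

text \<open>A map on generators induces a well-defined map of quotients as soon as its transpose sends
  functionals on the target to functionals on the source.\<close>

lemma induced_class:
  assumes keys: "\<And>g. g \<in> G \<Longrightarrow> Poly_Mapping.keys (F g) \<subseteq> G'"
    and ann: "\<And>\<Phi>. annihilates R' \<Phi> \<Longrightarrow> annihilates R (\<lambda>g. fsum (F g) \<Phi>)"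
    and p: "Poly_Mapping.keys p \<subseteq> G"
  shows "induced (presented G' R') F (presented G R `` {p}) = presented G' R' `` {fbind p F}"
proof -
  have "presented G' R' `` {fbind q F} = presented G' R' `` {fbind p F}" if "(p, q) \<in> presented G R" for q
  proof (rule presented_class_eq)
    have "Poly_Mapping.keys (fbind p F) \<subseteq> G'" "Poly_Mapping.keys (fbind q F) \<subseteq> G'"
      using presented_keys[OF that] keys by (auto intro!: keys_fbind)
    then show "(fbind q F, fbind p F) \<in> presented G' R'"
      using that ann by (simp add: presented_iff fsum_fbind)
  qed
  then show ?thesis
    unfolding induced_def using presented_refl[OF p, of R] by blast
qed

text \<open>The defining relations of a bidifferential need only be checked on generators, and there only
  after evaluation on functionals.\<close>

lemma bidifferential_family:
  fixes G :: "nat \<Rightarrow> 'g set" and R :: "nat \<Rightarrow> ('g \<Rightarrow>\<^sub>0 'k::field) set"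
  assumes X: "\<And>k. X k = presented (G k) (R k)"
    and keysF: "\<And>k g. g \<in> G (Suc k) \<Longrightarrow> Poly_Mapping.keys (F g) \<subseteq> G k"
    and keysF': "\<And>k g. g \<in> G (Suc k) \<Longrightarrow> Poly_Mapping.keys (F' g) \<subseteq> G k"
    and annF: "\<And>k \<Phi>. annihilates (R k) \<Phi> \<Longrightarrow> annihilates (R (Suc k)) (\<lambda>g. fsum (F g) \<Phi>)"
    and annF': "\<And>k \<Phi>. annihilates (R k) \<Phi> \<Longrightarrow> annihilates (R (Suc k)) (\<lambda>g. fsum (F' g) \<Phi>)"
    and FF: "\<And>k \<Phi> g. annihilates (R k) \<Phi> \<Longrightarrow> g \<in> G (Suc (Suc k)) \<Longrightarrow> fsum (F g) (\<lambda>g'. fsum (F g') \<Phi>) = 0"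
    and F'F': "\<And>k \<Phi> g. annihilates (R k) \<Phi> \<Longrightarrow> g \<in> G (Suc (Suc k)) \<Longrightarrow> fsum (F' g) (\<lambda>g'. fsum (F' g') \<Phi>) = 0"
    and FF': "\<And>k \<Phi> g. annihilates (R k) \<Phi> \<Longrightarrow> g \<in> G (Suc (Suc k)) \<Longrightarrow>
        fsum (F g) (\<lambda>g'. fsum (F' g') \<Phi>) + fsum (F' g) (\<lambda>g'. fsum (F g') \<Phi>) = 0"
  shows "bidifferential X (family X F) (family X F')"
proof -
  have fam: "family X F (Suc k) (X (Suc k) `` {p}) = X k `` {fbind p F}"
    "family X F' (Suc k) (X (Suc k) `` {p}) = X k `` {fbind p F'}"
    if "Poly_Mapping.keys p \<subseteq> G (Suc k)" for k p
    by (simp_all only: family_def X diff_Suc_1 induced_class[OF keysF annF that]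
        induced_class[OF keysF' annF' that])
  have zero: "X k `` {p} = qzero (X k)"
    if "Poly_Mapping.keys p \<subseteq> G k" "\<And>\<Phi>. annihilates (R k) \<Phi> \<Longrightarrow> fsum p \<Phi> = 0" for k p
    unfolding qzero_def X by (rule presented_class_eq) (simp add: presented_iff that)
  have keys2: "Poly_Mapping.keys (fbind p F) \<subseteq> G k" "Poly_Mapping.keys (fbind p F') \<subseteq> G k"
    if "Poly_Mapping.keys p \<subseteq> G (Suc k)" for k p
    by (rule keys_fbind, rule keysF, use that in blast)
      (rule keys_fbind, rule keysF', use that in blast)
  have lin: "qlinear (X (Suc k)) (X k) (family X F (Suc k)) \<and> qlinear (X (Suc k)) (X k) (family X F' (Suc k))" for k
  proof -
    have *: "qlinear (X (Suc k)) (X k) d"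
      if d: "\<And>p. Poly_Mapping.keys p \<subseteq> G (Suc k) \<Longrightarrow> d (X (Suc k) `` {p}) = X k `` {fbind p H}"
        and H: "\<And>p. Poly_Mapping.keys p \<subseteq> G (Suc k) \<Longrightarrow> Poly_Mapping.keys (fbind p H) \<subseteq> G k" for d H
      unfolding qlinear_def
    proof (intro conjI ballI allI)
      fix A assume "A \<in> qcarrier (X (Suc k))"
      then obtain p where p: "Poly_Mapping.keys p \<subseteq> G (Suc k)" "A = X (Suc k) `` {p}"
        unfolding X by (rule qcarrierE)
      show "d A \<in> qcarrier (X k)"
        unfolding p(2) d[OF p(1)] unfolding X by (rule qcarrierI[OF H[OF p(1)]])
      fix c
      have fp: "Poly_Mapping.keys (fscale c p) \<subseteq> G (Suc k)"
        by (rule subset_trans[OF keys_fscale p(1)])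
      show "d (qscale (X (Suc k)) c A) = qscale (X k) c (d A)"
        unfolding p(2) d[OF p(1)] qscale_class[OF p(1), of "R (Suc k)", folded X] qscale_class[OF H[OF p(1)], of "R k", folded X]
          d[OF fp] fbind_fscale ..
    next
      fix A B assume "A \<in> qcarrier (X (Suc k))" "B \<in> qcarrier (X (Suc k))"
      then obtain p q where p: "Poly_Mapping.keys p \<subseteq> G (Suc k)" "A = X (Suc k) `` {p}"
        and q: "Poly_Mapping.keys q \<subseteq> G (Suc k)" "B = X (Suc k) `` {q}"
        unfolding X by (elim qcarrierE)
      have fpq: "Poly_Mapping.keys (p + q) \<subseteq> G (Suc k)"
        using p(1) q(1) keys_add[of p q] by auto
      show "d (qadd (X (Suc k)) A B) = qadd (X k) (d A) (d B)"
        unfolding p(2) q(2) d[OF p(1)] d[OF q(1)] qadd_class[OF p(1) q(1), of "R (Suc k)", folded X]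
          qadd_class[OF H[OF p(1)] H[OF q(1)], of "R k", folded X] d[OF fpq] fbind_add ..
    qed
    show ?thesis
      by (rule conjI; rule *, erule fam, erule keys2)
  qed
  show ?thesis
    unfolding bidifferential_def
  proof (intro conjI allI impI ballI)
    fix k :: nat assume "k > 0"
    then obtain j where "k = Suc j" by (cases k) auto
    then show "qlinear (X k) (X (k - 1)) (family X F k)" "qlinear (X k) (X (k - 1)) (family X F' k)"
      using lin[of j] by auto
  next
    fix k :: nat and x assume k: "k > 1" and x: "x \<in> qcarrier (X k)"
    obtain j where j: "k = Suc (Suc j)" using k less_imp_Suc_add[of 1 k] by auto
    from x obtain p where p: "Poly_Mapping.keys p \<subseteq> G k" "x = X k `` {p}"
      unfolding X by (rule qcarrierE)
    note p' = p(1)[unfolded j]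
    have eval: "fsum (fbind (fbind p H) H') \<Phi> = fsum p (\<lambda>g. fsum (H g) (\<lambda>g'. fsum (H' g') \<Phi>))" for H H' \<Phi>
      by (simp add: fsum_fbind)
    have 0: "fsum p h = 0" if "\<And>g. g \<in> G k \<Longrightarrow> h g = 0" for h
    proof -
      have "fsum p h = fsum p (\<lambda>_. 0)" by (rule fsum_cong) (use p(1) that in blast)
      then show ?thesis by (simp add: linext_def)
    qed
    note k2 = keys2(1)[OF keys2(1)[OF p']] keys2(2)[OF keys2(2)[OF p']] keys2(2)[OF keys2(1)[OF p']] keys2(1)[OF keys2(2)[OF p']]
    show "family X F (k - 1) (family X F k x) = qzero (X (k - 2))"
      unfolding j p(2) diff_Suc_1 fam(1)[OF p'] fam(1)[OF keys2(1)[OF p']]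
      unfolding numeral_2_eq_2 diff_Suc_Suc diff_zero
      by (rule zero[OF k2(1)]) (simp only: eval, rule 0, rule FF, assumption, simp only: j)
    show "family X F' (k - 1) (family X F' k x) = qzero (X (k - 2))"
      unfolding j p(2) diff_Suc_1 fam(2)[OF p'] fam(2)[OF keys2(2)[OF p']]
      unfolding numeral_2_eq_2 diff_Suc_Suc diff_zero
      by (rule zero[OF k2(2)]) (simp only: eval, rule 0, rule F'F', assumption, simp only: j)
    have "Poly_Mapping.keys (fbind (fbind p F) F' + fbind (fbind p F') F) \<subseteq> G j"
      using k2 keys_add[of "fbind (fbind p F) F'" "fbind (fbind p F') F"] by blast
    moreover have "fsum (fbind (fbind p F) F' + fbind (fbind p F') F) \<Phi> = 0" if "annihilates (R j) \<Phi>" for \<Phi>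
    proof -
      have "fsum (fbind (fbind p F) F' + fbind (fbind p F') F) \<Phi>
        = fsum p (\<lambda>g. fsum (F g) (\<lambda>g'. fsum (F' g') \<Phi>) + fsum (F' g) (\<lambda>g'. fsum (F g') \<Phi>))"
        by (simp add: fsum_add eval) (simp add: linext_def distrib_left sum.distrib)
      also have "\<dots> = 0" using FF'[OF that] by (intro 0) (simp add: j)
      finally show ?thesis .
    qed
    ultimately have "X j `` {fbind (fbind p F) F' + fbind (fbind p F') F} = qzero (X j)"
      by (rule zero)
    then show "qadd (X (k - 2)) (family X F' (k - 1) (family X F k x)) (family X F (k - 1) (family X F' k x)) = qzero (X (k - 2))"
      unfolding j p(2) diff_Suc_1 fam[OF p'] fam(2)[OF keys2(1)[OF p']] fam(1)[OF keys2(2)[OF p']]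
      by (simp add: X qadd_class[OF k2(3,4)])
  qed
qed

section \<open>Duals of finite-dimensional modules\<close>

lemma dual_iff_lin_on: "vector_space s \<Longrightarrow> f \<in> dual s \<longleftrightarrow> lin_on UNIV s f"
proof -
  assume s: "vector_space s"
  have "vector_space ((*) :: 'a \<Rightarrow> 'a \<Rightarrow> 'a)"
    by unfold_locales (auto simp: algebra_simps)
  with s show "f \<in> dual s \<longleftrightarrow> lin_on UNIV s f"
    by (simp add: dual_def lin_on_def module_hom_iff_linear[symmetric] module_hom_iff module_iff_vector_space)
qed

lemma dual_add: "vector_space s \<Longrightarrow> f \<in> dual s \<Longrightarrow> g \<in> dual s \<Longrightarrow> f + g \<in> dual s"
  by (simp add: dual_iff_lin_on lin_on_def algebra_simps)

lemma dual_dscale: "vector_space s \<Longrightarrow> f \<in> dual s \<Longrightarrow> dscale c f \<in> dual s"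
  by (simp add: dual_iff_lin_on lin_on_def dscale_def algebra_simps)

text \<open>The coordinate functionals of a basis, which is here the index set itself.\<close>

lemma dual_basis:
  assumes "finite_dimensional_vector_space s E"
  obtains e where "finite E" "\<And>i. i \<in> E \<Longrightarrow> e i \<in> dual s"
    and "\<And>f x. f \<in> dual s \<Longrightarrow> f x = (\<Sum>i\<in>E. f i * e i x)"
proof -
  interpret finite_dimensional_vector_space s E by fact
  interpret k: vector_space "(*) :: 'a \<Rightarrow> 'a \<Rightarrow> 'a"
    by unfold_locales (auto simp: algebra_simps)
  interpret vector_space_pair s "(*) :: 'a \<Rightarrow> 'a \<Rightarrow> 'a" ..
  define e where "e i x = representation E x i" for i x
  have "e i \<in> dual s" for i
    unfolding dual_def e_def[abs_def] using linear_representation[OF independent_Basis span_Basis] by simp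
  moreover have "f x = (\<Sum>i\<in>E. f i * e i x)" if "f \<in> dual s" for f x
  proof -
    have f: "Vector_Spaces.linear s (*) f" using that by (simp add: dual_def)
    have "f x = f (\<Sum>i\<in>E. s (representation E x i) i)"
      using sum_representation_eq[OF independent_Basis _ finite_Basis subset_refl, of x] by (simp add: span_Basis)
    then show ?thesis
      by (simp add: e_def linear_sum[OF f] linear_scale[OF f] mult.commute)
  qed
  ultimately show ?thesis using that finite_Basis by blast
qed

text \<open>A linear form \<open>\<phi>\<close> on the dual is determined by its values on the coordinate
  functionals. The induction over subsets of \<open>E\<close> is needed because
  \<open>\<phi>\<close> is linear on the dual only, so that the partial sums have to be shown to
  lie in it.\<close>

lemma lin_on_dual_expand:
  assumes s: "vector_space s" and "finite E" and e: "\<And>i. i \<in> E \<Longrightarrow> e i \<in> dual s"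
    and exp: "\<And>x. f x = (\<Sum>i\<in>E. f i * e i x)" and \<phi>: "lin_on (dual s) dscale \<phi>"
  shows "\<phi> f = (\<Sum>i\<in>E. f i * \<phi> (e i))"
proof -
  have 0: "(\<lambda>x. 0) \<in> dual s" by (simp add: dual_iff_lin_on[OF s] lin_on_zero)
  have \<phi>0: "\<phi> (\<lambda>x. 0) = 0"
  proof -
    have "\<phi> (dscale 0 (\<lambda>x. 0)) = 0 * \<phi> (\<lambda>x. 0)" using \<phi> 0 by (simp only: lin_on_def)
    then show ?thesis by (simp add: dscale_def)
  qed
  have "finite I \<Longrightarrow> I \<subseteq> E \<Longrightarrow> (\<lambda>x. \<Sum>i\<in>I. f i * e i x) \<in> dual s \<and>
      \<phi> (\<lambda>x. \<Sum>i\<in>I. f i * e i x) = (\<Sum>i\<in>I. f i * \<phi> (e i))" for I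
  proof (induction I rule: finite_induct)
    case empty then show ?case by (simp add: 0 \<phi>0)
  next
    case (insert i I)
    have eq: "(\<lambda>x. \<Sum>i\<in>insert i I. f i * e i x) = dscale (f i) (e i) + (\<lambda>x. \<Sum>i\<in>I. f i * e i x)"
      using insert by (auto simp: dscale_def)
    have "dscale (f i) (e i) \<in> dual s" using e insert by (auto intro: dual_dscale s)
    then show ?case
      using insert e \<phi> unfolding eq by (auto simp: lin_on_def intro: dual_add s)
  qed
  from this[OF assms(2) subset_refl] show ?thesis using exp[abs_def] by simp
qed

text \<open>A finite family \<open>e\<close> in a space \<open>U\<close> of functions, with points
  \<open>i\<close> such that every \<open>u\<close> in \<open>U\<close> has the coordinates
  \<open>u i\<close>, expressed by its effect on linear forms.\<close>

definition spanned_by :: "('v \<Rightarrow> 'k::field) set \<Rightarrow> 'v set \<Rightarrow> ('v \<Rightarrow> 'v \<Rightarrow> 'k) \<Rightarrow> bool" where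
  "spanned_by U I e \<longleftrightarrow> finite I \<and> (\<forall>i\<in>I. e i \<in> U) \<and>
     (\<forall>\<phi> u. lin_on U dscale \<phi> \<longrightarrow> u \<in> U \<longrightarrow> \<phi> u = (\<Sum>i\<in>I. u i * \<phi> (e i)))"

lemma spanned_by_mem: "spanned_by U I e \<Longrightarrow> i \<in> I \<Longrightarrow> e i \<in> U"
  by (simp add: spanned_by_def)

lemma spanned_by_lin:
  "spanned_by U I e \<Longrightarrow> lin_on U dscale \<phi> \<Longrightarrow> u \<in> U \<Longrightarrow> \<phi> u = (\<Sum>i\<in>I. u i * \<phi> (e i))"
  by (simp add: spanned_by_def)

lemma spanned_by_dual:
  assumes "finite_dimensional_vector_space s B"
  obtains e where "spanned_by (dual s) B e"
proof -
  interpret finite_dimensional_vector_space s B by fact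
  obtain e where e: "finite B" "\<And>i. i \<in> B \<Longrightarrow> e i \<in> dual s"
    "\<And>f x. f \<in> dual s \<Longrightarrow> f x = (\<Sum>i\<in>B. f i * e i x)"
    by (rule dual_basis[OF assms]) blast
  have "spanned_by (dual s) B e"
    unfolding spanned_by_def using e(1,2)
    by (intro conjI allI impI ballI lin_on_dual_expand[OF vector_space_axioms e(1,2) e(3)])
  then show ?thesis by (rule that)
qed

lemma bilin_on_expand:
  assumes U: "spanned_by U I e" and V: "spanned_by V J f"
    and \<beta>: "bilin_on U dscale V dscale \<beta>" and u: "u \<in> U" and v: "v \<in> V"
  shows "\<beta> u v = (\<Sum>i\<in>I. \<Sum>j\<in>J. u i * v j * \<beta> (e i) (f j))"
proof -
  have "\<beta> u v = (\<Sum>i\<in>I. u i * \<beta> (e i) v)"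
    using \<beta> v by (intro spanned_by_lin[OF U _ u]) (auto simp: bilin_on_def)
  also have "\<dots> = (\<Sum>i\<in>I. u i * (\<Sum>j\<in>J. v j * \<beta> (e i) (f j)))"
    using \<beta> spanned_by_mem[OF U]
    by (intro sum.cong refl arg_cong2[where f = "(*)"] spanned_by_lin[OF V _ v]) (auto simp: bilin_on_def)
  finally show ?thesis by (simp add: sum_distrib_left mult.assoc)
qed

text \<open>The formal sum \<open>p\<close> is a tensor in \<open>U \<otimes> V\<close> that, regarded as a
  function of two variables, is \<open>c\<close>.\<close>

definition represents ::
  "(('v \<Rightarrow> 'k) \<times> ('w \<Rightarrow> 'k) \<Rightarrow>\<^sub>0 'k::field) \<Rightarrow> ('v \<Rightarrow> 'k) set \<Rightarrow> ('w \<Rightarrow> 'k) set \<Rightarrow> ('v \<Rightarrow> 'w \<Rightarrow> 'k) \<Rightarrow> bool" where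
  "represents p U V c \<longleftrightarrow> Poly_Mapping.keys p \<subseteq> U \<times> V \<and> (\<forall>x y. fs2 p (\<lambda>u v. u x * v y) = c x y)"

lemma represents_cong:
  assumes "represents p U V c" "\<And>u v. u \<in> U \<Longrightarrow> v \<in> V \<Longrightarrow> P u v = Q u v"
  shows "fs2 p P = fs2 p Q"
  using assms by (intro fs2_cong) (auto simp: represents_def)

text \<open>A tensor of functionals is determined by its values as a function: expanding
  \<open>\<beta>\<close> in the coordinate functionals leaves only values of \<open>c\<close>.\<close>

lemma represents_bilin:
  assumes p: "represents p U V c" and U: "spanned_by U I e" and V: "spanned_by V J f"
    and \<beta>: "bilin_on U dscale V dscale \<beta>"
  shows "fs2 p \<beta> = (\<Sum>i\<in>I. \<Sum>j\<in>J. c i j * \<beta> (e i) (f j))"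
proof -
  have "fs2 p \<beta> = fs2 p (\<lambda>u v. \<Sum>i\<in>I. \<Sum>j\<in>J. u i * v j * \<beta> (e i) (f j))"
    by (rule represents_cong[OF p]) (rule bilin_on_expand[OF U V \<beta>])
  then show ?thesis using p by (simp add: represents_def fs2_sum fs2_mult_right)
qed

lemma represents_right:
  assumes p: "represents p U V c" and V: "spanned_by V J f" and \<phi>: "lin_on V dscale \<phi>"
  shows "fs2 p (\<lambda>u v. u x * \<phi> v) = (\<Sum>j\<in>J. c x j * \<phi> (f j))"
proof -
  have "fs2 p (\<lambda>u v. u x * \<phi> v) = fs2 p (\<lambda>u v. \<Sum>j\<in>J. u x * v j * \<phi> (f j))"
    by (rule represents_cong[OF p]) (simp add: spanned_by_lin[OF V \<phi>] sum_distrib_left mult.assoc)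
  then show ?thesis using p by (simp add: represents_def fs2_sum fs2_mult_right)
qed

lemma represents_left:
  assumes p: "represents p U V c" and U: "spanned_by U I e" and \<phi>: "lin_on U dscale \<phi>"
  shows "fs2 p (\<lambda>u v. v y * \<phi> u) = (\<Sum>i\<in>I. c i y * \<phi> (e i))"
proof -
  have "fs2 p (\<lambda>u v. v y * \<phi> u) = fs2 p (\<lambda>u v. \<Sum>i\<in>I. u i * v y * \<phi> (e i))"
    by (rule represents_cong[OF p]) (simp add: spanned_by_lin[OF U \<phi>] sum_distrib_left ac_simps)
  then show ?thesis using p by (simp add: represents_def fs2_sum fs2_mult_right)
qed

lemma lin_on_eval: "lin_on W dscale (\<lambda>u. u x)"
  by (simp add: lin_on_def dscale_def)

text \<open>Existence and uniqueness of a tensor with prescribed values. For existence, \<open>c x y\<close>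
  is expanded in \<open>x\<close>, which exhibits it as the value of the tensor \<open>\<Sum>i.
  e i \<otimes> c i\<close>; uniqueness is the separation of tensors by evaluation. It applies
  to both the coproduct and the coaction that the dual inherits.\<close>

lemma the_tensor_represents:
  fixes U :: "('v \<Rightarrow> 'k::field) set" and V :: "('w \<Rightarrow> 'k) set"
  assumes U: "spanned_by U I e" and V: "spanned_by V J f"
    and cU: "\<And>y. (\<lambda>x. c x y) \<in> U" and cV: "\<And>x. (\<lambda>y. c x y) \<in> V"
    and t: "t = (THE t. t \<in> qcarrier (tensor2 U dscale V dscale) \<and>
      (\<forall>y x. c x y = fsum (sw t) (\<lambda>(u, v). u x * v y)))"
  shows "represents (sw t) U V c"
proof -
  let ?T = "tensor2 U dscale V dscale"
  define P where "P t \<longleftrightarrow> t \<in> qcarrier ?T \<and> (\<forall>y x. c x y = fsum (sw t) (\<lambda>(u, v). u x * v y))" for t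
  have rep: "represents (sw t) U V c" if "P t" for t
    using that[unfolded P_def, THEN conjunct1] that[unfolded P_def, THEN conjunct2, rule_format]
    unfolding represents_def tensor2_def fs2_def by (simp only: sw_keys simp_thms)
  define p :: "('v \<Rightarrow> 'k) \<times> ('w \<Rightarrow> 'k) \<Rightarrow>\<^sub>0 'k" where "p = (\<Sum>i\<in>I. fgen (e i, \<lambda>y. c i y))"
  have pk: "Poly_Mapping.keys p \<subseteq> U \<times> V"
    unfolding p_def using spanned_by_mem[OF U] cV
    by (intro subset_trans[OF keys_sum_subset] UN_least) auto
  have p: "fs2 p (\<lambda>u v. u x * v y) = c x y" for x y
    using spanned_by_lin[OF U lin_on_eval cU, of x y] by (simp add: p_def fs2_def fsum_sum mult.commute)
  have "(p, sw (?T `` {p})) \<in> ?T" using pk unfolding tensor2_def by (rule sw_class)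
  moreover have "bilin_on U dscale V dscale (\<lambda>u v. u x * v y)" for x y
    by (intro bilin_onI lin_on_mult_left lin_on_mult_right lin_on_eval)
  ultimately have swp: "fs2 (sw (?T `` {p})) (\<lambda>u v. u x * v y) = c x y" for x y
    by (simp only: p tensor2_fs2[symmetric])
  have ex: "P (?T `` {p})"
    unfolding P_def
  proof (intro conjI allI)
    show "?T `` {p} \<in> qcarrier ?T" unfolding tensor2_def by (rule qcarrierI[OF pk])
  qed (simp only: swp[symmetric] fs2_def)
  have unique: "t = t'" if "P t" "P t'" for t t'
  proof -
    have q: "t \<in> qcarrier ?T" "t' \<in> qcarrier ?T" using that by (auto simp: P_def)
    note r = rep[OF that(1)] rep[OF that(2)]
    have "(sw t, sw t') \<in> ?T"
      by (rule tensor2I)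
        (use r in \<open>simp_all only: represents_bilin[OF r(1) U V] represents_bilin[OF r(2) U V] represents_def\<close>)
    then have "?T `` {sw t} = ?T `` {sw t'}" unfolding tensor2_def by (rule presented_class_eq)
    then show ?thesis
      using class_sw[OF q(1)[unfolded tensor2_def]] class_sw[OF q(2)[unfolded tensor2_def]]
      unfolding tensor2_def by (simp only:)
  qed
  have "P (THE t. P t)" by (rule theI[of P, OF ex unique[OF _ ex]])
  then have "P t" unfolding P_def[abs_def] t .
  then show ?thesis by (rule rep)
qed

text \<open>The Yetter-Drinfeld module to be dualized, together with coordinate functionals for
  \<open>H\<close> and \<open>N\<close>.\<close>

locale fin_dim_yd =
  H: yd_on UNIV sH "(*)" 1 \<Delta> UNIV sN act \<delta> + bialgebra sH \<Delta> \<epsilon> + N: vector_space sN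
  for sH :: "'k::field \<Rightarrow> 'h::ring_1 \<Rightarrow> 'h" and \<Delta> \<epsilon>
    and sN :: "'k \<Rightarrow> 'n::ab_group_add \<Rightarrow> 'n" and act \<delta> +
  fixes E :: "'h set" and e :: "'h \<Rightarrow> 'h \<Rightarrow> 'k" and F :: "'n set" and f :: "'n \<Rightarrow> 'n \<Rightarrow> 'k"
  assumes spanH: "spanned_by (dual sH) E e" and spanN: "spanned_by (dual sN) F f"
begin

abbreviation "H' \<equiv> dual sH"
abbreviation "N' \<equiv> dual sN"
abbreviation "mul' \<equiv> dual_mult \<Delta>"
abbreviation "D' \<equiv> dual_comult sH"
abbreviation "act' \<equiv> dual_act \<delta>"
abbreviation "\<delta>' \<equiv> dual_coact sH sN act"

lemma vsH: "vector_space sH" and vsN: "vector_space sN"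
  by unfold_locales

lemmas memH = dual_iff_lin_on[OF vsH] and memN = dual_iff_lin_on[OF vsN]
  and addH = dual_add[OF vsH] and scaleH = dual_dscale[OF vsH]
  and addN = dual_add[OF vsN] and scaleN = dual_dscale[OF vsN]
  and eE = spanned_by_mem[OF spanH] and fF = spanned_by_mem[OF spanN]

lemma linHD: "l \<in> H' \<Longrightarrow> lin_on UNIV sH l" and linND: "b \<in> N' \<Longrightarrow> lin_on UNIV sN b"
  by (simp_all add: memH memN)

lemma D'_represents: "l \<in> H' \<Longrightarrow> represents (sw (D' l)) H' H' (\<lambda>x y. l (y * x))"
  by (rule the_tensor_represents[OF spanH spanH _ _ dual_comult_def])
    (simp_all add: memH H.lin_mul_left H.lin_mul_right)

lemma \<delta>'_represents: "b \<in> N' \<Longrightarrow> represents (sw (\<delta>' b)) N' H' (\<lambda>x h. b (act h x))"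
  by (rule the_tensor_represents[OF spanN spanH _ _ dual_coact_def])
    (simp_all add: memH memN H.lin_act_left H.lin_act_right)

lemma dual_comult_eval: "l \<in> H' \<Longrightarrow> swsum D' l (\<lambda>u v. u x * v y) = l (y * x)"
  using D'_represents by (simp add: represents_def)

lemma dual_coact_eval: "b \<in> N' \<Longrightarrow> swsum \<delta>' b (\<lambda>u v. u x * v h) = b (act h x)"
  using \<delta>'_represents by (simp add: represents_def)

lemmas swD'_cong = represents_cong[OF D'_represents] and sw\<delta>'_cong = represents_cong[OF \<delta>'_represents]
  and swD'_expand = represents_bilin[OF D'_represents spanH spanH]
  and sw\<delta>'_expand = represents_bilin[OF \<delta>'_represents spanN spanH]
  and swD'_expand_right = represents_right[OF D'_represents spanH]
  and sw\<delta>'_expand_right = represents_right[OF \<delta>'_represents spanH]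
  and swD'_expand_left = represents_left[OF D'_represents spanH]
  and sw\<delta>'_expand_left = represents_left[OF \<delta>'_represents spanN]
  and bilin_expandHH = bilin_on_expand[OF spanH spanH] and bilin_expandNH = bilin_on_expand[OF spanN spanH]

lemma D'_keys: "l \<in> H' \<Longrightarrow> Poly_Mapping.keys (sw (D' l)) \<subseteq> H' \<times> H'"
  using D'_represents by (simp add: represents_def)

lemma \<delta>'_keys: "b \<in> N' \<Longrightarrow> Poly_Mapping.keys (sw (\<delta>' b)) \<subseteq> N' \<times> H'"
  using \<delta>'_represents by (simp add: represents_def)

end

section \<open>The dual Yetter-Drinfeld module\<close>

lemma sum_rotate: "(\<Sum>j\<in>J. \<Sum>k\<in>K. \<Sum>i\<in>I. g i j k) = (\<Sum>i\<in>I. \<Sum>j\<in>J. \<Sum>k\<in>K. g i j k)"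
proof -
  have "(\<Sum>j\<in>J. \<Sum>k\<in>K. \<Sum>i\<in>I. g i j k) = (\<Sum>j\<in>J. \<Sum>i\<in>I. \<Sum>k\<in>K. g i j k)"
    by (intro sum.cong refl sum.swap)
  also have "\<dots> = (\<Sum>i\<in>I. \<Sum>j\<in>J. \<Sum>k\<in>K. g i j k)" by (rule sum.swap)
  finally show ?thesis .
qed

context fin_dim_yd
begin

lemma mul'_eq: "mul' l l' h = swsum \<Delta> h (\<lambda>h1 h2. l h2 * l' h1)"
  by (simp add: dual_mult_def fs2_def)

lemma act'_eq: "act' l b x = swsum \<delta> x (\<lambda>x0 x1. b x0 * l x1)"
  by (simp add: dual_act_def fs2_def)

lemma mul'_closed: "l \<in> H' \<Longrightarrow> l' \<in> H' \<Longrightarrow> mul' l l' \<in> H'"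
  unfolding memH mul'_eq[abs_def] by (intro H.lin_D bilin_onI lin_on_mult_left lin_on_mult_right)

lemma act'_closed: "l \<in> H' \<Longrightarrow> b \<in> N' \<Longrightarrow> act' l b \<in> N'"
  unfolding memH memN act'_eq[abs_def] by (intro H.lin_\<delta> bilin_onI lin_on_mult_left lin_on_mult_right)

lemma \<epsilon>_closed: "\<epsilon> \<in> H'"
  using counit_linear by (simp add: dual_def)

lemma counitL: "lin_on UNIV sH g \<Longrightarrow> swsum \<Delta> h (\<lambda>h1 h2. \<epsilon> h1 * g h2) = g h"
  and counitR: "lin_on UNIV sH g \<Longrightarrow> swsum \<Delta> h (\<lambda>h1 h2. \<epsilon> h2 * g h1) = g h"
proof -
  assume g: "lin_on UNIV sH g"
  have "g 0 = 0" using g unfolding lin_on_def by (metis UNIV_I add_cancel_right_right)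
  then have sum: "g (sum F S) = (\<Sum>x\<in>S. g (F x))" for F and S :: "('h \<times> 'h) set"
    using g by (induction S rule: infinite_finite_induct) (auto simp: lin_on_def)
  have scale: "g (sH c x) = c * g x" for c x using g by (simp add: lin_on_def)
  have "g h = g (linext sH (sw (\<Delta> h)) (\<lambda>(h1, h2). sH (\<epsilon> h1) h2))" by (simp add: counit_left)
  then show "swsum \<Delta> h (\<lambda>h1 h2. \<epsilon> h1 * g h2) = g h"
    by (simp add: linext_def[of sH] sum scale fs2_sum_keys case_prod_beta mult.assoc)
  have "g h = g (linext sH (sw (\<Delta> h)) (\<lambda>(h1, h2). sH (\<epsilon> h2) h1))" by (simp add: counit_right)
  then show "swsum \<Delta> h (\<lambda>h1 h2. \<epsilon> h2 * g h1) = g h"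
    by (simp add: linext_def[of sH] sum scale fs2_sum_keys case_prod_beta mult.assoc)
qed

text \<open>The product on the dual is compatible with the coproduct on the dual because the product and the
  coproduct of \<open>H\<close> are.\<close>

lemma mul'_comult:
  assumes l: "l \<in> H'" and l': "l' \<in> H'"
  shows "swsum D' l (\<lambda>l1 l2. swsum D' l' (\<lambda>k1 k2. mul' l1 k1 x * mul' l2 k2 y)) = mul' l l' (y * x)"
proof -
  have "mul' l l' (y * x) = swsum \<Delta> y (\<lambda>y1 y2. swsum \<Delta> x (\<lambda>x1 x2. l (y2 * x2) * l' (y1 * x1)))"
    unfolding mul'_eq
    by (rule H.D_mul) (auto intro!: bilin_onI lin_on_mult_left lin_on_mult_right linHD[OF l] linHD[OF l'])
  also have "\<dots> = swsum \<Delta> y (\<lambda>y1 y2. swsum \<Delta> x (\<lambda>x1 x2.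
      swsum D' l (\<lambda>l1 l2. l1 x2 * l2 y2) * swsum D' l' (\<lambda>k1 k2. k1 x1 * k2 y1)))"
    by (simp only: dual_comult_eval[OF l] dual_comult_eval[OF l'])
  also have "\<dots> = swsum \<Delta> y (\<lambda>y1 y2. swsum \<Delta> x (\<lambda>x1 x2.
      swsum D' l (\<lambda>l1 l2. swsum D' l' (\<lambda>k1 k2. (l1 x2 * l2 y2) * (k1 x1 * k2 y1)))))"
    by (simp only: fs2_mult_left fs2_mult_right)
  also have "\<dots> = swsum D' l (\<lambda>l1 l2. swsum D' l' (\<lambda>k1 k2. swsum \<Delta> x (\<lambda>x1 x2. swsum \<Delta> y (\<lambda>y1 y2.
      (l1 x2 * l2 y2) * (k1 x1 * k2 y1)))))"
    by (simp only: fs2_commute[of "sw (\<Delta> x)" "sw (D' l)"] fs2_commute[of "sw (\<Delta> y)" "sw (D' l)"]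
        fs2_commute[of "sw (\<Delta> x)" "sw (D' l')"] fs2_commute[of "sw (\<Delta> y)" "sw (D' l')"]
        fs2_commute[of "sw (\<Delta> y)" "sw (\<Delta> x)"])
  also have "\<dots> = swsum D' l (\<lambda>l1 l2. swsum D' l' (\<lambda>k1 k2. swsum \<Delta> x (\<lambda>x1 x2. swsum \<Delta> y (\<lambda>y1 y2.
      (l1 x2 * k1 x1) * (l2 y2 * k2 y1)))))"
    by (simp only: ac_simps)
  also have "\<dots> = swsum D' l (\<lambda>l1 l2. swsum D' l' (\<lambda>k1 k2. mul' l1 k1 x * mul' l2 k2 y))"
    by (simp only: mul'_eq fs2_mult_left fs2_mult_right)
  finally show ?thesis ..
qed

text \<open>The Yetter-Drinfeld condition on the dual, evaluated at \<open>(x, h)\<close>, is the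
  Yetter-Drinfeld condition on \<open>N\<close> for \<open>h\<close> and \<open>x\<close>,
  evaluated on the functional \<open>b \<otimes> l\<close>.\<close>

lemma act'_coact:
  assumes l: "l \<in> H'" and b: "b \<in> N'"
  shows "swsum D' l (\<lambda>l1 l2. swsum \<delta>' (act' l2 b) (\<lambda>y0 y1. y0 x * mul' y1 l1 h))
       = swsum D' l (\<lambda>l1 l2. swsum \<delta>' b (\<lambda>b0 b1. act' l1 b0 x * mul' l2 b1 h))"
proof -
  have "swsum D' l (\<lambda>l1 l2. swsum \<delta>' (act' l2 b) (\<lambda>y0 y1. y0 x * mul' y1 l1 h))
    = swsum D' l (\<lambda>l1 l2. swsum \<Delta> h (\<lambda>h1 h2. swsum \<delta>' (act' l2 b) (\<lambda>y0 y1. y0 x * y1 h2) * l1 h1))"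
    unfolding mul'_eq fs2_mult_left[symmetric] fs2_mult_right[symmetric]
    by (subst (2) fs2_commute) (simp only: mult.assoc)
  also have "\<dots> = swsum D' l (\<lambda>l1 l2. swsum \<Delta> h (\<lambda>h1 h2. swsum \<delta> (act h2 x) (\<lambda>z0 z1. b z0 * l2 z1) * l1 h1))"
    by (intro swD'_cong[OF l]) (simp add: dual_coact_eval[OF act'_closed[OF _ b]] act'_eq)
  also have "\<dots> = swsum D' l (\<lambda>l1 l2. swsum \<Delta> h (\<lambda>h1 h2. swsum \<delta> (act h2 x) (\<lambda>z0 z1. b z0 * (l1 h1 * l2 z1))))"
    by (simp only: fs2_mult_right[symmetric]) (simp only: ac_simps)
  also have "\<dots> = swsum \<Delta> h (\<lambda>h1 h2. swsum \<delta> (act h2 x) (\<lambda>z0 z1. b z0 * swsum D' l (\<lambda>l1 l2. l1 h1 * l2 z1)))"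
    by (subst fs2_commute, subst fs2_commute[of "sw (D' l)"]) (simp only: fs2_mult_left)
  also have "\<dots> = swsum \<Delta> h (\<lambda>h1 h2. swsum \<delta> (act h2 x) (\<lambda>z0 z1. b z0 * l (z1 * h1)))"
    by (simp only: dual_comult_eval[OF l])
  also have "\<dots> = swsum \<Delta> h (\<lambda>h1 h2. swsum \<delta> x (\<lambda>x0 x1. b (act h1 x0) * l (h2 * x1)))"
    by (rule H.yd) (auto intro!: bilin_onI lin_on_mult_left lin_on_mult_right linHD[OF l] linND[OF b])
  also have "\<dots> = swsum \<Delta> h (\<lambda>h1 h2. swsum \<delta> x (\<lambda>x0 x1.
      swsum \<delta>' b (\<lambda>b0 b1. b0 x0 * b1 h1) * swsum D' l (\<lambda>l1 l2. l1 x1 * l2 h2)))"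
    by (simp only: dual_comult_eval[OF l] dual_coact_eval[OF b])
  also have "\<dots> = swsum \<Delta> h (\<lambda>h1 h2. swsum \<delta> x (\<lambda>x0 x1. swsum D' l (\<lambda>l1 l2.
      swsum \<delta>' b (\<lambda>b0 b1. (b0 x0 * b1 h1) * (l1 x1 * l2 h2)))))"
    by (simp only: fs2_mult_left fs2_mult_right)
  also have "\<dots> = swsum D' l (\<lambda>l1 l2. swsum \<delta>' b (\<lambda>b0 b1. swsum \<delta> x (\<lambda>x0 x1. swsum \<Delta> h (\<lambda>h1 h2.
      (b0 x0 * b1 h1) * (l1 x1 * l2 h2)))))"
    by (simp only: fs2_commute[of "sw (\<delta> x)" "sw (D' l)"] fs2_commute[of "sw (\<Delta> h)" "sw (D' l)"]
        fs2_commute[of "sw (\<delta> x)" "sw (\<delta>' b)"] fs2_commute[of "sw (\<Delta> h)" "sw (\<delta>' b)"]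
        fs2_commute[of "sw (\<Delta> h)" "sw (\<delta> x)"])
  also have "\<dots> = swsum D' l (\<lambda>l1 l2. swsum \<delta>' b (\<lambda>b0 b1. swsum \<delta> x (\<lambda>x0 x1. swsum \<Delta> h (\<lambda>h1 h2.
      (b0 x0 * l1 x1) * (l2 h2 * b1 h1)))))"
    by (simp only: ac_simps)
  also have "\<dots> = swsum D' l (\<lambda>l1 l2. swsum \<delta>' b (\<lambda>b0 b1. act' l1 b0 x * mul' l2 b1 h))"
    by (simp only: mul'_eq act'_eq fs2_mult_left fs2_mult_right)
  finally show ?thesis .
qed

text \<open>The dual is again a Yetter-Drinfeld module over the dual bialgebra. Identities between
  functionals are checked pointwise; identities between tensors of functionals are reduced to
  their values by expanding the test functional in coordinates.\<close>

lemma yd_on_dual: "yd_on H' dscale mul' \<epsilon> D' N' dscale act' \<delta>'"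
proof (rule yd_on.intro, goal_cases)
  case 1 then show ?case by (rule mul'_closed)
next
  case 2 then show ?case by (rule \<epsilon>_closed)
next
  case 3 then show ?case by (rule act'_closed)
next
  case 4 then show ?case by (rule D'_keys)
next
  case 5 then show ?case by (rule \<delta>'_keys)
next
  case (6 x y z)
  show ?case
  proof
    fix h
    have "swsum \<Delta> h (\<lambda>h1 h2. swsum \<Delta> h1 (\<lambda>h11 h12. x h2 * (y h12 * z h11)))
      = swsum \<Delta> h (\<lambda>h1 h2. swsum \<Delta> h2 (\<lambda>h21 h22. x h22 * (y h21 * z h1)))"
      by (rule H.D_coassoc[OF trilin_onI])
        (auto intro!: lin_on_mult_left lin_on_mult_right linHD[OF 6(1)] linHD[OF 6(2)] linHD[OF 6(3)])
    then show "mul' (mul' x y) z h = mul' x (mul' y z) h"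
      by (simp add: mul'_eq flip: fs2_mult_left fs2_mult_right) (simp add: mult.assoc)
  qed
next
  case (7 x) then show ?case by (auto simp: mul'_eq counitR linHD)
next
  case (8 x) then show ?case by (auto simp: mul'_eq mult.commute[of _ "\<epsilon> y" for y] counitL linHD)
next
  case (9 x y b)
  show ?case
  proof
    fix m
    have "swsum \<delta> m (\<lambda>m0 m1. swsum \<delta> m0 (\<lambda>m00 m01. b m00 * (y m01 * x m1)))
      = swsum \<delta> m (\<lambda>m0 m1. swsum \<Delta> m1 (\<lambda>m11 m12. b m0 * (y m11 * x m12)))"
      by (rule H.\<delta>_coassoc[OF trilin_onI])
        (auto intro!: lin_on_mult_left lin_on_mult_right linHD[OF 9(1)] linHD[OF 9(2)] linND[OF 9(3)])
    then show "act' (mul' x y) b m = act' x (act' y b) m"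
      by (simp add: mul'_eq act'_eq flip: fs2_mult_left fs2_mult_right) (simp add: ac_simps)
  qed
next
  case (10 g y)
  have "mul' (u + v) y = mul' u y + mul' v y" "mul' (dscale c u) y = dscale c (mul' u y)" for u v c
    by (auto simp: mul'_eq dscale_def distrib_right fs2_add mult.assoc fs2_mult_left)
  then show ?case using 10 mul'_closed by (simp add: lin_on_def)
next
  case (11 g x)
  have "mul' x (u + v) = mul' x u + mul' x v" "mul' x (dscale c u) = dscale c (mul' x u)" for u v c
    by (auto simp: mul'_eq dscale_def distrib_left fs2_add mult.left_commute fs2_mult_left)
  then show ?case using 11 mul'_closed by (simp add: lin_on_def)
next
  case (12 g a)
  have "act' (u + v) a = act' u a + act' v a" "act' (dscale c u) a = dscale c (act' u a)" for u v c
    by (auto simp: act'_eq dscale_def distrib_left fs2_add mult.left_commute fs2_mult_left)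
  then show ?case using 12 act'_closed by (simp add: lin_on_def)
next
  case (13 g x)
  have "act' x (u + v) = act' x u + act' x v" "act' x (dscale c u) = dscale c (act' x u)" for u v c
    by (auto simp: act'_eq dscale_def distrib_right fs2_add mult.assoc fs2_mult_left)
  then show ?case using 13 act'_closed by (simp add: lin_on_def)
next
  case (14 \<beta>)
  show ?case
    by (rule lin_onI)
      (simp_all add: swD'_expand[OF _ 14] addH scaleH, simp_all add: dscale_def algebra_simps sum.distrib sum_distrib_left)
next
  case (15 \<gamma>)
  show ?case
    by (rule lin_onI)
      (simp_all add: sw\<delta>'_expand[OF _ 15] addN scaleN, simp_all add: dscale_def algebra_simps sum.distrib sum_distrib_left)
next
  case (16 \<tau> x)
  note \<tau> = 16(1)[unfolded trilin_on_def]
  \<comment> \<open>Both sides become sums of values of x at triple products, and so coassociativity of the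
    dual is associativity of H.\<close>
  have "swsum D' x (\<lambda>x1 x2. swsum D' x1 (\<lambda>x11 x12. \<tau> x11 x12 x2))
    = swsum D' x (\<lambda>x1 x2. \<Sum>i\<in>E. \<Sum>j\<in>E. x1 (j * i) * \<tau> (e i) (e j) x2)"
    by (intro swD'_cong[OF 16(2)] swD'_expand) (use \<tau> in \<open>auto simp: bilin_on_def\<close>)
  also have "\<dots> = (\<Sum>i\<in>E. \<Sum>j\<in>E. \<Sum>k\<in>E. x (k * (j * i)) * \<tau> (e i) (e j) (e k))"
    unfolding fs2_sum by (intro sum.cong refl swD'_expand_right[OF 16(2)]) (use \<tau> eE in auto)
  also have "\<dots> = (\<Sum>j\<in>E. \<Sum>k\<in>E. \<Sum>i\<in>E. x ((k * j) * i) * \<tau> (e i) (e j) (e k))"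
    by (subst sum_rotate) (simp add: mult.assoc)
  also have "\<dots> = swsum D' x (\<lambda>x1 x2. \<Sum>j\<in>E. \<Sum>k\<in>E. x2 (k * j) * \<tau> x1 (e j) (e k))"
    unfolding fs2_sum by (intro sum.cong refl swD'_expand_left[OF 16(2), symmetric]) (use \<tau> eE in auto)
  also have "\<dots> = swsum D' x (\<lambda>x1 x2. swsum D' x2 (\<lambda>x21 x22. \<tau> x1 x21 x22))"
    by (intro swD'_cong[OF 16(2)] swD'_expand[symmetric]) (use \<tau> in \<open>auto simp: bilin_on_def\<close>)
  finally show ?case .
next
  case (17 \<beta> x y)
  have "swsum D' x (\<lambda>x1 x2. swsum D' y (\<lambda>y1 y2. \<beta> (mul' x1 y1) (mul' x2 y2)))
    = swsum D' x (\<lambda>x1 x2. swsum D' y (\<lambda>y1 y2. \<Sum>i\<in>E. \<Sum>j\<in>E. mul' x1 y1 i * mul' x2 y2 j * \<beta> (e i) (e j)))"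
    by (intro swD'_cong[OF 17(2)] swD'_cong[OF 17(3)] bilin_expandHH[OF 17(1)] mul'_closed)
  also have "\<dots> = swsum D' (mul' x y) \<beta>"
    by (simp only: fs2_sum fs2_mult_right mul'_comult[OF 17(2,3)] swD'_expand[OF mul'_closed[OF 17(2,3)] 17(1)])
  finally show ?case ..
next
  case (18 \<beta>)
  then show ?case
    using \<epsilon>_closed by (simp add: swD'_expand bilin_expandHH[of \<beta> \<epsilon> \<epsilon>] counit_mult mult.commute)
next
  case (19 \<tau> x)
  note \<tau> = 19(1)[unfolded trilin_on_def]
  have "swsum \<delta>' x (\<lambda>x1 x2. swsum \<delta>' x1 (\<lambda>x11 x12. \<tau> x11 x12 x2))
    = swsum \<delta>' x (\<lambda>x1 x2. \<Sum>i\<in>F. \<Sum>j\<in>E. x1 (act j i) * \<tau> (f i) (e j) x2)"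
    by (intro sw\<delta>'_cong[OF 19(2)] sw\<delta>'_expand) (use \<tau> in \<open>auto simp: bilin_on_def\<close>)
  also have "\<dots> = (\<Sum>i\<in>F. \<Sum>j\<in>E. \<Sum>k\<in>E. x (act k (act j i)) * \<tau> (f i) (e j) (e k))"
    unfolding fs2_sum by (intro sum.cong refl sw\<delta>'_expand_right[OF 19(2)]) (use \<tau> eE fF in auto)
  also have "\<dots> = (\<Sum>j\<in>E. \<Sum>k\<in>E. \<Sum>i\<in>F. x (act (k * j) i) * \<tau> (f i) (e j) (e k))"
    by (subst sum_rotate) (simp add: H.act_mul)
  also have "\<dots> = swsum \<delta>' x (\<lambda>x1 x2. \<Sum>j\<in>E. \<Sum>k\<in>E. x2 (k * j) * \<tau> x1 (e j) (e k))"
    unfolding fs2_sum by (intro sum.cong refl sw\<delta>'_expand_left[OF 19(2), symmetric]) (use \<tau> eE in auto)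
  also have "\<dots> = swsum \<delta>' x (\<lambda>x1 x2. swsum D' x2 (\<lambda>x21 x22. \<tau> x1 x21 x22))"
    by (intro sw\<delta>'_cong[OF 19(2)] swD'_expand[symmetric]) (use \<tau> in \<open>auto simp: bilin_on_def\<close>)
  finally show ?case .
next
  case (20 \<gamma> l b)
  have "swsum D' l (\<lambda>l1 l2. swsum \<delta>' (act' l2 b) (\<lambda>y0 y1. \<gamma> y0 (mul' y1 l1)))
    = swsum D' l (\<lambda>l1 l2. swsum \<delta>' (act' l2 b) (\<lambda>y0 y1. \<Sum>i\<in>F. \<Sum>j\<in>E. y0 i * mul' y1 l1 j * \<gamma> (f i) (e j)))"
    by (intro swD'_cong[OF 20(2)] sw\<delta>'_cong bilin_expandNH[OF 20(1)] mul'_closed act'_closed 20(3))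
  also have "\<dots> = swsum D' l (\<lambda>l1 l2. swsum \<delta>' b (\<lambda>b0 b1. \<Sum>i\<in>F. \<Sum>j\<in>E. act' l1 b0 i * mul' l2 b1 j * \<gamma> (f i) (e j)))"
    by (simp only: fs2_sum fs2_mult_right act'_coact[OF 20(2,3)])
  also have "\<dots> = swsum D' l (\<lambda>l1 l2. swsum \<delta>' b (\<lambda>b0 b1. \<gamma> (act' l1 b0) (mul' l2 b1)))"
    by (intro swD'_cong[OF 20(2)] sw\<delta>'_cong[OF 20(3)] bilin_expandNH[OF 20(1), symmetric] mul'_closed act'_closed)
  finally show ?case .
qed

end

section \<open>The complex\<close>

text \<open>This connects the recursion with the positions in \<open>d_bar\<close> and \<open>d_cob\<close>:
  the summand for \<open>i = 1\<close> is the first term of the recursion, and the other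
  summands are those of the tail, shifted by one.\<close>

lemma bar_closed_form:
  "(\<Sum>i\<in>{1..<length hs}. (- 1) ^ i * \<phi> (take (i - 1) hs @ m (hs ! (i - 1)) (hs ! i) # drop (i + 1) hs))
     = bar m \<phi> hs"
proof (induction m \<phi> hs rule: bar.induct)
  case (1 m \<phi> x y zs)
  let ?t = "\<lambda>\<phi> hs i. (- 1) ^ i * \<phi> (take (i - 1) hs @ m (hs ! (i - 1)) (hs ! i) # drop (i + 1) hs)"
  have "(\<Sum>i\<in>{1..<length (x # y # zs)}. ?t \<phi> (x # y # zs) i)
    = ?t \<phi> (x # y # zs) 1 + (\<Sum>i\<in>{Suc 1..<Suc (length (y # zs))}. ?t \<phi> (x # y # zs) i)"
    by (subst sum.atLeast_Suc_lessThan) auto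
  also have "(\<Sum>i\<in>{Suc 1..<Suc (length (y # zs))}. ?t \<phi> (x # y # zs) i)
    = (\<Sum>i\<in>{1..<length (y # zs)}. ?t \<phi> (x # y # zs) (Suc i))"
    by (rule sum.shift_bounds_Suc_ivl)
  also have "\<dots> = (\<Sum>i\<in>{1..<length (y # zs)}. - ?t (\<lambda>ws. \<phi> (x # ws)) (y # zs) i)"
  proof (rule sum.cong[OF refl])
    fix i assume "i \<in> {1..<length (y # zs)}"
    then obtain j where "i = Suc j" by (cases i) auto
    then show "?t \<phi> (x # y # zs) (Suc i) = - ?t (\<lambda>ws. \<phi> (x # ws)) (y # zs) i" by simp
  qed
  finally show ?case using 1 by (simp add: sum_negf)
qed simp_all

lemma keys_fscale_fgen: "g \<in> G \<Longrightarrow> Poly_Mapping.keys (fscale c (fgen g)) \<subseteq> G"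
  using keys_fscale[of c "fgen g"] by auto

lemma keys_fbind_case:
  assumes "\<And>x y. (x, y) \<in> Poly_Mapping.keys p \<Longrightarrow> Poly_Mapping.keys (H x y) \<subseteq> G"
  shows "Poly_Mapping.keys (fbind p (\<lambda>(x, y). H x y)) \<subseteq> G"
  by (rule keys_fbind) (use assms in auto)

lemma keys_sign_n: "Poly_Mapping.keys (sign_n D1 g) \<subseteq> Poly_Mapping.keys (D1 g)"
  by (cases g) (simp add: sign_n_def keys_fscale)

lemma keys_sign_nm: "Poly_Mapping.keys (sign_nm D1 g) \<subseteq> Poly_Mapping.keys (D1 g)"
  by (cases g) (simp add: sign_nm_def keys_fscale)

lemma keys_add_subset: "Poly_Mapping.keys p \<subseteq> G \<Longrightarrow> Poly_Mapping.keys q \<subseteq> G \<Longrightarrow> Poly_Mapping.keys (p + q) \<subseteq> G"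
  using keys_add[of p q] by auto

lemma fsum_fbind_case: "fsum (fbind p (\<lambda>(x, y). G x y)) \<Phi> = fs2 p (\<lambda>x y. fsum (G x y) \<Phi>)"
  unfolding fs2_def fsum_fbind by (intro fsum_cong) auto

lemma fsum_sign_n: "fsum (sign_n D1 (hs, a, ls, b)) \<Phi> = (- 1) ^ length hs * fsum (D1 (hs, a, ls, b)) \<Phi>"
  by (simp add: sign_n_def fsum_fscale)

lemma fsum_sign_nm:
  "fsum (sign_nm D1 (hs, a, ls, b)) \<Phi> = (- 1) ^ length hs * ((- 1) ^ length ls * fsum (D1 (hs, a, ls, b)) \<Phi>)"
  by (simp add: sign_nm_def fsum_fscale power_add mult.assoc)

text \<open>The setting of the theorem, in which \<open>N\<close> is dualized and \<open>M\<close> is not.\<close>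

locale yd_dual_pair =
  fin_dim_yd sH \<Delta> \<epsilon> sN actN \<delta>N E e F f + M: yd_on UNIV sH "(*)" 1 \<Delta> UNIV sM actM \<delta>M
  for sH :: "'k::field \<Rightarrow> 'h::ring_1 \<Rightarrow> 'h" and \<Delta> \<epsilon>
    and sN :: "'k \<Rightarrow> 'n::ab_group_add \<Rightarrow> 'n" and actN \<delta>N
    and E :: "'h set" and e :: "'h \<Rightarrow> 'h \<Rightarrow> 'k" and F :: "'n set" and f :: "'n \<Rightarrow> 'n \<Rightarrow> 'k"
    and sM :: "'k \<Rightarrow> 'm::ab_group_add \<Rightarrow> 'm" and actM \<delta>M
begin

lemma yd_pair_dual: "yd_pair UNIV sH (*) 1 \<Delta> UNIV sM actM \<delta>M
    (dual sH) dscale (dual_mult \<Delta>) \<epsilon> (dual_comult sH) (dual sN) dscale (dual_act \<delta>N) (dual_coact sH sN actN) (\<lambda>l h. l h)"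
proof (intro yd_pair.intro yd_pair_axioms.intro M.yd_on_axioms yd_on_dual)
  show "lin_on UNIV sH (\<lambda>h. l h)" if "l \<in> dual sH" for l using linHD[OF that] .
  show "lin_on (dual sH) dscale (\<lambda>l. l h)" for h by (simp add: lin_on_def dscale_def)
  show "dual_mult \<Delta> l l' h = swsum \<Delta> h (\<lambda>h1 h2. l h2 * l' h1)" for l l' h by (rule mul'_eq)
  show "l (h * h') = swsum (dual_comult sH) l (\<lambda>l1 l2. l1 h' * l2 h)" if "l \<in> dual sH" for l h h'
    by (rule dual_comult_eval[OF that, symmetric])
qed

end

sublocale yd_dual_pair \<subseteq> pair: yd_pair UNIV sH "(*)" 1 \<Delta> UNIV sM actM \<delta>M
    "dual sH" dscale "dual_mult \<Delta>" \<epsilon> "dual_comult sH" "dual sN" dscale "dual_act \<delta>N" "dual_coact sH sN actN"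
    "\<lambda>l h. l h"
  by (rule yd_pair_dual)

context yd_dual_pair
begin

abbreviation curried :: "('h list \<times> 'm \<times> ('h \<Rightarrow> 'k) list \<times> ('n \<Rightarrow> 'k) \<Rightarrow> 'k) \<Rightarrow> _" where
  "curried \<Phi> \<equiv> (\<lambda>hs a ls b. \<Phi> (hs, a, ls, b))"

lemma zero_mem_dual: "(\<lambda>_. 0) \<in> dual sH" "(\<lambda>_. 0) \<in> dual sN"
  by (simp_all add: memH memN lin_on_zero)

definition X_rels where
  "X_rels k = slot_rels (gens sH sN k) UNIV sH {\<lambda>h. (hs @ h # hs', a, ls, b) | hs hs' a ls b. True} \<union>
      slot_rels (gens sH sN k) UNIV sM {\<lambda>a. (hs, a, ls, b) | hs ls b. True} \<union>
      slot_rels (gens sH sN k) (dual sH) dscale {\<lambda>l. (hs, a, ls @ l # ls', b) | hs a ls ls' b. True} \<union>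
      slot_rels (gens sH sN k) (dual sN) dscale {\<lambda>b. (hs, a, ls, b) | hs a ls. True}"

lemma X_space_eq: "X_space sH sM sN k = presented (gens sH sN k) (X_rels k)"
  unfolding X_space_def X_rels_def ..

lemma gens_iff [simp]:
  "(hs, a, ls, b) \<in> gens sH sN k \<longleftrightarrow> length hs + length ls = k \<and> set ls \<subseteq> dual sH \<and> b \<in> dual sN"
  by (simp add: gens_def)

text \<open>The linearity relations are imposed in each bidegree separately, so that a functional on the
  quotient is a family of multilinear functionals, one for every \<open>n + m = k\<close>. To
  see that a slot relation belongs to a bidegree, the zero vector is inserted into the slot.\<close>

lemma annihilates_X_rels:
  "annihilates (X_rels k) \<Phi> \<longleftrightarrow> (\<forall>n m. n + m = k \<longrightarrow> pair.multilin n m (curried \<Phi>))"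
proof
  assume "annihilates (X_rels k) \<Phi>"
  then have ann: "\<And>u. u \<in> {\<lambda>h. (hs @ h # hs', a, ls, b) | hs hs' a ls b. True} \<Longrightarrow>
        u ` UNIV \<subseteq> gens sH sN k \<Longrightarrow> lin_on UNIV sH (\<lambda>x. \<Phi> (u x))"
    "\<And>u. u \<in> {\<lambda>a. (hs, a, ls, b) | hs ls b. True} \<Longrightarrow>
        u ` UNIV \<subseteq> gens sH sN k \<Longrightarrow> lin_on UNIV sM (\<lambda>x. \<Phi> (u x))"
    "\<And>u. u \<in> {\<lambda>l. (hs, a, ls @ l # ls', b) | hs a ls ls' b. True} \<Longrightarrow>
        u ` dual sH \<subseteq> gens sH sN k \<Longrightarrow> lin_on (dual sH) dscale (\<lambda>x. \<Phi> (u x))"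
    "\<And>u. u \<in> {\<lambda>b. (hs, a, ls, b) | hs a ls. True} \<Longrightarrow>
        u ` dual sN \<subseteq> gens sH sN k \<Longrightarrow> lin_on (dual sN) dscale (\<lambda>x. \<Phi> (u x))"
    unfolding X_rels_def annihilates_Un annihilates_slot_rels by blast+
  show "\<forall>n m. n + m = k \<longrightarrow> pair.multilin n m (curried \<Phi>)"
    unfolding pair.multilin_def
  proof (intro allI impI conjI ballI multilin_onI)
    fix n m ls b and a :: 'm and us vs :: "'h list"
    assume "n + m = k" "ls \<in> lists_on (dual sH) m" "b \<in> dual sN" "length us + length vs + 1 = n"
    then show "lin_on UNIV sH (\<lambda>x. \<Phi> (us @ x # vs, a, ls, b))"
      by (intro ann(1)[of "\<lambda>h. (us @ h # vs, a, ls, b)"]) (blast, auto simp: lists_on_def)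
  next
    fix n m ls b and hs :: "'h list"
    assume "n + m = k" "hs \<in> lists_on UNIV n" "ls \<in> lists_on (dual sH) m" "b \<in> dual sN"
    then show "lin_on UNIV sM (\<lambda>a. \<Phi> (hs, a, ls, b))"
      by (intro ann(2)[of "\<lambda>a. (hs, a, ls, b)"]) (blast, auto simp: lists_on_def)
  next
    fix n m us vs b and hs :: "'h list" and a :: 'm
    assume "n + m = k" "hs \<in> lists_on UNIV n" "b \<in> dual sN" "set us \<subseteq> dual sH" "set vs \<subseteq> dual sH"
      "length us + length vs + 1 = m"
    then show "lin_on (dual sH) dscale (\<lambda>x. \<Phi> (hs, a, us @ x # vs, b))"
      by (intro ann(3)[of "\<lambda>l. (hs, a, us @ l # vs, b)"]) (blast, auto simp: lists_on_def)
  next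
    fix n m ls and hs :: "'h list" and a :: 'm
    assume "n + m = k" "hs \<in> lists_on UNIV n" "ls \<in> lists_on (dual sH) m"
    then show "lin_on (dual sN) dscale (\<lambda>b. \<Phi> (hs, a, ls, b))"
      by (intro ann(4)[of "\<lambda>b. (hs, a, ls, b)"]) (blast, auto simp: lists_on_def)
  qed
next
  assume multilin: "\<forall>n m. n + m = k \<longrightarrow> pair.multilin n m (curried \<Phi>)"
  show "annihilates (X_rels k) \<Phi>"
    unfolding X_rels_def annihilates_Un annihilates_slot_rels
  proof (intro conjI ballI impI)
    fix u :: "'h \<Rightarrow> ('h, 'm, 'n, 'k) gen" assume "u \<in> {\<lambda>h. (hs @ h # hs', a, ls, b) | hs hs' a ls b. True}"
    then obtain hs hs' a ls b where u: "u = (\<lambda>h. (hs @ h # hs', a, ls, b))" by blast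
    assume "u ` UNIV \<subseteq> gens sH sN k"
    then have "u 0 \<in> gens sH sN k" by auto
    then have g: "length hs + length hs' + 1 + length ls = k" "ls \<in> lists_on (dual sH) (length ls)" "b \<in> dual sN"
      by (auto simp: u lists_on_def)
    from multilin_onD[OF pair.multilin_hs[OF multilin[rule_format, OF g(1)] _ g(2,3)], of a hs hs']
    show "lin_on UNIV sH (\<lambda>x. \<Phi> (u x))" by (simp add: u)
  next
    fix u :: "'m \<Rightarrow> ('h, 'm, 'n, 'k) gen" assume "u \<in> {\<lambda>a. (hs, a, ls, b) | hs ls b. True}"
    then obtain hs ls b where u: "u = (\<lambda>a. (hs, a, ls, b))" by blast
    assume "u ` UNIV \<subseteq> gens sH sN k"
    then have "u 0 \<in> gens sH sN k" by auto
    then have g: "length hs + length ls = k" "ls \<in> lists_on (dual sH) (length ls)" "b \<in> dual sN"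
      by (auto simp: u lists_on_def)
    from pair.multilin_a[OF multilin[rule_format, OF g(1)] _ g(2,3), of hs]
    show "lin_on UNIV sM (\<lambda>x. \<Phi> (u x))" by (simp add: u lists_on_def)
  next
    fix u :: "('h \<Rightarrow> 'k) \<Rightarrow> ('h, 'm, 'n, 'k) gen" assume "u \<in> {\<lambda>l. (hs, a, ls @ l # ls', b) | hs a ls ls' b. True}"
    then obtain hs a ls ls' b where u: "u = (\<lambda>l. (hs, a, ls @ l # ls', b))" by blast
    assume "u ` dual sH \<subseteq> gens sH sN k"
    then have "u (\<lambda>_. 0) \<in> gens sH sN k" using zero_mem_dual by blast
    then have g: "length hs + (length ls + length ls' + 1) = k" "set ls \<subseteq> dual sH" "set ls' \<subseteq> dual sH" "b \<in> dual sN"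
      by (auto simp: u)
    from multilin_onD[OF pair.multilin_ls[OF multilin[rule_format, OF g(1)] _ _ g(4)] g(2,3), of hs a]
    show "lin_on (dual sH) dscale (\<lambda>x. \<Phi> (u x))" by (simp add: u lists_on_def)
  next
    fix u :: "('n \<Rightarrow> 'k) \<Rightarrow> ('h, 'm, 'n, 'k) gen" assume "u \<in> {\<lambda>b. (hs, a, ls, b) | hs a ls. True}"
    then obtain hs a ls where u: "u = (\<lambda>b. (hs, a, ls, b))" by blast
    assume "u ` dual sN \<subseteq> gens sH sN k"
    then have "u (\<lambda>_. 0) \<in> gens sH sN k" using zero_mem_dual by blast
    then have g: "length hs + length ls = k" "ls \<in> lists_on (dual sH) (length ls)"
      by (auto simp: u lists_on_def)
    from pair.multilin_b[OF multilin[rule_format, OF g(1)] _ _ g(2), of hs a]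
    show "lin_on (dual sN) dscale (\<lambda>x. \<Phi> (u x))" by (simp add: u lists_on_def)
  qed
qed

lemma fsum_d_bar: "fsum (d_bar (hs, a, ls, b)) \<Phi> = pair.tr_bar (curried \<Phi>) hs a ls b"
  unfolding pair.tr_bar_def bar_closed_form[symmetric]
  by (simp add: d_bar_def fsum_sum fsum_fscale)

lemma fsum_d_cob: "fsum (d_cob \<Delta> (hs, a, ls, b)) \<Phi> = pair.tr_cob (curried \<Phi>) hs a ls b"
  unfolding pair.tr_cob_eq bar_closed_form[symmetric]
  by (simp add: d_cob_def fsum_sum fsum_fscale)

lemma prod_dual: "pair.B.prod ls = dual_prod \<Delta> \<epsilon> ls"
  by (simp add: pair.B.prod_def dual_prod_def)

lemma prod_H: "M.prod hs = prod_list hs"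
  by (simp add: M.prod_def prod_list.eq_foldr)

lemma fsum_pi_H_right:
  "(- 1) ^ length hs * fsum (pi_H_right sH \<Delta> \<epsilon> actM (hs, a, ls, b)) \<Phi> = pair.tr_piH (curried \<Phi>) hs a ls b"
  by (simp add: pi_H_right_def pair.tr_piH_def fsum_fbind_case fsum_fscale prod_dual)

lemma fsum_pi_H_left: "fsum (pi_H_left sH \<Delta> \<epsilon> sN actN (hs, a, ls, b)) \<Phi> = pair.tr_Hpi (curried \<Phi>) hs a ls b"
  by (simp add: pi_H_left_def pair.tr_Hpi_def fsum_fbind_case fsum_fscale prod_dual)

lemma fsum_pi_Hdual_left: "fsum (pi_Hdual_left \<Delta> \<delta>M (hs, a, ls, b)) \<Phi> = pair.tr_Hdpi (curried \<Phi>) hs a ls b"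
proof (cases ls)
  case Nil then show ?thesis
    by (simp add: pi_Hdual_left_def pair.tr_Hdpi_def yd_pair.tr_Hpi_Nil[OF pair.flip])
next
  case (Cons l ls')
  then show ?thesis
    by (simp add: pi_Hdual_left_def pair.tr_Hdpi_Cons fsum_fbind_case fsum_fscale prod_H)
qed

lemma fsum_pi_Hdual_right:
  "(- 1) ^ length ls * fsum (pi_Hdual_right sH \<Delta> \<delta>N (hs, a, ls, b)) \<Phi> = pair.tr_piHd (curried \<Phi>) hs a ls b"
proof (cases ls rule: rev_cases)
  case Nil then show ?thesis
    by (simp add: pi_Hdual_right_def pair.tr_piHd_def yd_pair.tr_piH_Nil[OF pair.flip])
next
  case (snoc ls' l)
  then show ?thesis
    by (simp add: pi_Hdual_right_def pair.tr_piHd_snoc fsum_fbind_case fsum_fscale prod_H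
        fs2_commute[of "sw (dual_comult sH l)"])
qed

text \<open>Any two maps of degree \<open>-1\<close> on generators whose transposes are \<open>tr_d s
  t\<close> and \<open>(-1)^n tr_d' s t\<close> form a bidifferential. The squares need no care
  with signs, as \<open>(-1)^n\<close> is constant along the second differential; the mixed
  relation acquires its sign from \<open>tr_d_sign\<close>.\<close>

lemma bidifferential_X_space:
  assumes keysF: "\<And>k g. g \<in> gens sH sN (Suc k) \<Longrightarrow> Poly_Mapping.keys (D1 g) \<subseteq> gens sH sN k"
    and keysF': "\<And>k g. g \<in> gens sH sN (Suc k) \<Longrightarrow> Poly_Mapping.keys (D2 g) \<subseteq> gens sH sN k"
    and F: "\<And>\<Phi> hs a ls b. fsum (D1 (hs, a, ls, b)) \<Phi> = pair.tr_d s t (curried \<Phi>) hs a ls b"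
    and F': "\<And>\<Phi> hs a ls b. fsum (D2 (hs, a, ls, b)) \<Phi> = (- 1) ^ length hs * pair.tr_d' s t (curried \<Phi>) hs a ls b"
    and st: "s * s = s" "t * t = t"
  shows "bidifferential (X_space sH sM sN) (family (X_space sH sM sN) D1) (family (X_space sH sM sN) D2)"
proof (rule bidifferential_family[OF X_space_eq keysF keysF'])
  fix k \<Phi> assume "annihilates (X_rels k) \<Phi>"
  then have multilin: "\<And>n m. n + m = k \<Longrightarrow> pair.multilin n m (curried \<Phi>)"
    unfolding annihilates_X_rels by blast
  show "annihilates (X_rels (Suc k)) (\<lambda>g. fsum (D1 g) \<Phi>)"
    unfolding annihilates_X_rels F using pair.multilin_tr_d[OF multilin] by blast
  show "annihilates (X_rels (Suc k)) (\<lambda>g. fsum (D2 g) \<Phi>)"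
    unfolding annihilates_X_rels F' using pair.multilin_sign[OF pair.multilin_tr_d'[OF multilin]] by blast
  fix g :: "('h, 'm, 'n, 'k) gen" assume g: "g \<in> gens sH sN (Suc (Suc k))"
  obtain hs a ls b where g_eq: "g = (hs, a, ls, b)" by (cases g) auto
  have len: "length hs + length ls = Suc (Suc k)" and ls: "set ls \<subseteq> dual sH" and b: "b \<in> dual sN"
    using g by (auto simp: g_eq)
  have L: "hs \<in> lists_on UNIV (length hs)" "ls \<in> lists_on (dual sH) (length ls)"
    using ls by (auto simp: lists_on_def)
  note sq = pair.bidifferential_on_functionals[OF multilin subset_UNIV UNIV_I ls b len st, where a = a]
  show "fsum (D1 g) (\<lambda>g'. fsum (D1 g') \<Phi>) = 0"
    unfolding g_eq F by (rule sq(1))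
  show "fsum (D2 g) (\<lambda>g'. fsum (D2 g') \<Phi>) = 0"
    unfolding g_eq F' pair.tr_d'_sign[OF L(1) UNIV_I L(2) b] by (simp add: sq(2))
  show "fsum (D1 g) (\<lambda>g'. fsum (D2 g') \<Phi>) + fsum (D2 g) (\<lambda>g'. fsum (D1 g') \<Phi>) = 0"
  proof (cases "length hs")
    case 0
    then show ?thesis by (simp add: g_eq F F' pair.tr_d'_tr_d_Nil)
  next
    case (Suc n)
    show ?thesis
      unfolding g_eq F F' pair.tr_d_sign[OF L(1)[unfolded Suc] UNIV_I L(2) b] by (simp add: sq(3) Suc)
  qed
qed

lemma keys_d_bar: "g \<in> gens sH sN (Suc k) \<Longrightarrow> Poly_Mapping.keys (d_bar g) \<subseteq> gens sH sN k"
  by (cases g) (auto simp: d_bar_def intro!: subset_trans[OF keys_sum_subset] UN_least keys_fscale_fgen)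

lemma keys_d_cob: "g \<in> gens sH sN (Suc k) \<Longrightarrow> Poly_Mapping.keys (d_cob \<Delta> g) \<subseteq> gens sH sN k"
proof (cases g)
  case (fields hs a ls b)
  assume "g \<in> gens sH sN (Suc k)"
  then have "length hs + length ls = Suc k" "\<And>i. i < length ls \<Longrightarrow> ls ! i \<in> dual sH" "set ls \<subseteq> dual sH" "b \<in> dual sN"
    by (auto simp: fields dest: nth_mem)
  moreover from this have "x \<in> set (take i ls) \<Longrightarrow> x \<in> dual sH" "x \<in> set (drop i ls) \<Longrightarrow> x \<in> dual sH" for x i
    by (auto dest!: in_set_takeD in_set_dropD)
  ultimately show ?thesis
    by (auto simp: fields d_cob_def intro!: subset_trans[OF keys_sum_subset] UN_least keys_fscale_fgen mul'_closed)
qed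

lemma keys_pi_H_right:
  assumes g: "g \<in> gens sH sN (Suc k)"
  shows "Poly_Mapping.keys (pi_H_right sH \<Delta> \<epsilon> actM g) \<subseteq> gens sH sN k"
proof (cases g)
  case (fields hs a ls b)
  then have l: "ls \<in> lists_on (dual sH) (length ls)" using g by (auto simp: lists_on_def)
  show ?thesis
  proof (cases hs rule: rev_cases)
    case (snoc hs' h)
    show ?thesis
      using g unfolding fields snoc pi_H_right_def
      by (auto simp: lists_on_def intro!: keys_fbind_case keys_fscale_fgen dest!: pair.B.list_keys[OF _ l])
  qed (simp add: fields pi_H_right_def)
qed

lemma keys_pi_H_left:
  assumes g: "g \<in> gens sH sN (Suc k)"
  shows "Poly_Mapping.keys (pi_H_left sH \<Delta> \<epsilon> sN actN g) \<subseteq> gens sH sN k"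
proof (cases g)
  case (fields hs a ls b)
  then have l: "ls \<in> lists_on (dual sH) (length ls)" and b: "b \<in> dual sN" using g by (auto simp: lists_on_def)
  show ?thesis
  proof (cases hs)
    case (Cons h hs')
    show ?thesis
      using g unfolding fields Cons pi_H_left_def
      by (auto simp: lists_on_def intro!: keys_fbind_case keys_fscale_fgen
          dest!: pair.B.list_keys[OF _ l] pair.B.\<delta>_keys[OF _ b])
  qed (simp add: fields pi_H_left_def)
qed

lemma keys_pi_Hdual_left:
  assumes g: "g \<in> gens sH sN (Suc k)"
  shows "Poly_Mapping.keys (pi_Hdual_left \<Delta> \<delta>M g) \<subseteq> gens sH sN k"
proof (cases g)
  case (fields hs a ls b)
  have h: "hs \<in> lists_on UNIV (length hs)" by (auto simp: lists_on_def)
  show ?thesis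
  proof (cases ls)
    case (Cons l ls')
    show ?thesis
      using g unfolding fields Cons pi_Hdual_left_def
      by (auto simp: lists_on_def intro!: keys_fbind_case keys_fscale_fgen dest!: M.list_keys[OF _ h])
  qed (simp add: fields pi_Hdual_left_def)
qed

lemma keys_pi_Hdual_right:
  assumes g: "g \<in> gens sH sN (Suc k)"
  shows "Poly_Mapping.keys (pi_Hdual_right sH \<Delta> \<delta>N g) \<subseteq> gens sH sN k"
proof (cases g)
  case (fields hs a ls b)
  have h: "hs \<in> lists_on UNIV (length hs)" by (auto simp: lists_on_def)
  have b: "b \<in> dual sN" using g fields by auto
  show ?thesis
  proof (cases ls rule: rev_cases)
    case (snoc ls' l)
    then have l: "l \<in> dual sH" using g fields by auto
    show ?thesis
      using g unfolding fields snoc pi_Hdual_right_def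
      by (auto simp: lists_on_def intro!: keys_fbind_case keys_fscale_fgen act'_closed b
          dest!: M.list_keys[OF _ h] pair.B.D_keys[OF _ l])
  qed (simp add: fields pi_Hdual_right_def)
qed

lemmas keys_intros = keys_add_subset subset_trans[OF keys_sign_n] subset_trans[OF keys_sign_nm]
  keys_d_bar keys_d_cob keys_pi_H_right keys_pi_H_left keys_pi_Hdual_left keys_pi_Hdual_right

lemmas fsum_maps = fsum_add fsum_sign_n fsum_sign_nm fsum_d_bar fsum_d_cob fsum_pi_H_right fsum_pi_H_left
  fsum_pi_Hdual_left fsum_pi_Hdual_right pair.tr_d_def pair.tr_d'_eq

text \<open>The four cases are \<open>(s, t) = (0, 0), (1, 0), (0, 1), (1, 1)\<close>.\<close>

lemma bidifferentials:
  defines "X \<equiv> X_space sH sM sN"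
    and "dcob \<equiv> d_cob \<Delta>" and "piH \<equiv> pi_H_right sH \<Delta> \<epsilon> actM" and "Hpi \<equiv> pi_H_left sH \<Delta> \<epsilon> sN actN"
    and "Hdpi \<equiv> pi_Hdual_left \<Delta> \<delta>M" and "piHd \<equiv> pi_Hdual_right sH \<Delta> \<delta>N"
  shows "bidifferential X (family X d_bar) (family X (sign_n dcob))"
    and "bidifferential X (family X (\<lambda>g. d_bar g + sign_n piH g)) (family X (\<lambda>g. sign_n dcob g + sign_n Hdpi g))"
    and "bidifferential X (family X (\<lambda>g. d_bar g + Hpi g)) (family X (\<lambda>g. sign_n dcob g + sign_nm piHd g))"
    and "bidifferential X (family X (\<lambda>g. d_bar g + sign_n piH g + Hpi g))
           (family X (\<lambda>g. sign_n dcob g + sign_n Hdpi g + sign_nm piHd g))"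
  unfolding assms
  by (rule bidifferential_X_space[where s = 0 and t = 0] bidifferential_X_space[where s = 1 and t = 0]
      bidifferential_X_space[where s = 0 and t = 1] bidifferential_X_space[where s = 1 and t = 1];
      (intro keys_intros; assumption)?; simp add: fsum_maps algebra_simps; fail)+

end

theorem theorem7:
  fixes sH :: "'k::field \<Rightarrow> 'h::ring_1 \<Rightarrow> 'h"
    and \<Delta> :: "'h \<Rightarrow> ('h \<times> 'h \<Rightarrow>\<^sub>0 'k) set"
    and \<epsilon> :: "'h \<Rightarrow> 'k"
    and sM :: "'k \<Rightarrow> 'm::ab_group_add \<Rightarrow> 'm"
    and actM :: "'h \<Rightarrow> 'm \<Rightarrow> 'm"
    and \<delta>M :: "'m \<Rightarrow> ('m \<times> 'h \<Rightarrow>\<^sub>0 'k) set"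
    and sN :: "'k \<Rightarrow> 'n::ab_group_add \<Rightarrow> 'n"
    and actN :: "'h \<Rightarrow> 'n \<Rightarrow> 'n"
    and \<delta>N :: "'n \<Rightarrow> ('n \<times> 'h \<Rightarrow>\<^sub>0 'k) set"
  assumes "bialgebra sH \<Delta> \<epsilon>"
    and "\<exists>B. finite_dimensional_vector_space sH B"
    and "yetter_drinfeld sH \<Delta> \<epsilon> sM actM \<delta>M"
    and "yetter_drinfeld sH \<Delta> \<epsilon> sN actN \<delta>N"
    and "\<exists>B. finite_dimensional_vector_space sN B"
  shows "let X = X_space sH sM sN;
             dcob = d_cob \<Delta>;
             piH = pi_H_right sH \<Delta> \<epsilon> actM;
             Hpi = pi_H_left sH \<Delta> \<epsilon> sN actN;
             Hdpi = pi_Hdual_left \<Delta> \<delta>M;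
             piHd = pi_Hdual_right sH \<Delta> \<delta>N
         in
           bidifferential X (family X d_bar) (family X (sign_n dcob)) \<and>
           bidifferential X (family X (\<lambda>g. d_bar g + sign_n piH g))
                            (family X (\<lambda>g. sign_n dcob g + sign_n Hdpi g)) \<and>
           bidifferential X (family X (\<lambda>g. d_bar g + Hpi g))
                            (family X (\<lambda>g. sign_n dcob g + sign_nm piHd g)) \<and>
           bidifferential X (family X (\<lambda>g. d_bar g + sign_n piH g + Hpi g))
                            (family X (\<lambda>g. sign_n dcob g + sign_n Hdpi g + sign_nm piHd g))"
proof -
  obtain BH where BH: "finite_dimensional_vector_space sH BH" using assms(2) by blast
  obtain BN where BN: "finite_dimensional_vector_space sN BN" using assms(5) by blast
  obtain eH eN where "spanned_by (dual sH) BH eH" "spanned_by (dual sN) BN eN"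
    by (metis spanned_by_dual[OF BH] spanned_by_dual[OF BN])
  then interpret yd_dual_pair sH \<Delta> \<epsilon> sN actN \<delta>N BH eH BN eN sM actM \<delta>M
    by (intro yd_dual_pair.intro fin_dim_yd.intro fin_dim_yd_axioms.intro yetter_drinfeld_yd_on[OF assms(3)]
        yetter_drinfeld_yd_on[OF assms(4)] assms(1) finite_dimensional_vector_space.axioms(1)[OF BN])
  show ?thesis
    unfolding Let_def by (intro conjI bidifferentials)
qed

end
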